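(* Let $k$ be a field and let $A=kQ/I$ be a triangular quadratic string algebra. Then for all integers $n>0$ and $m>0$ one has ${\rm HH}^n(A)\cup{\rm HH}^m(A)=0$, i.e. the cup product of any class in ${\rm HH}^n(A)$ with any class in ${\rm HH}^m(A)$ is zero in ${\rm HH}^{n+m}(A)$.
   Context: $Q$ is a finite quiver, $kQ$ its path algebra, and $I$ an admissible ideal of $kQ$; paths are composed left to right (for arrows $\alpha,\beta$ with $t(\alpha)=s(\beta)$, $\alpha\beta$ is the path "first $\alpha$, then $\beta$"). $A$ is triangular if $Q$ has no oriented cycles; quadratic if $I$ is generated by linear combinations of paths of length 2. $A$ is a string algebra if: (S1) $I$ is generated by paths (monomial); (S2) each vertex of $Q$ is the source of at most two arrows and the target of at most two arrows; (S3) for each arrow $\alpha$ there is at most one arrow $\beta$ with $\alpha\beta\notin I$ and at most one arrow $\gamma$ with $\gamma\alpha\notin I$. ${\rm HH}^i(A)={\rm Ext}^i_{A\otimes_k A^{op}}(A,A)$ is the Hochschild cohomology, and $\cup$ is the cup product (equal to the Yoneda product) making ${\rm HH}^*(A)=\bigoplus_{i\ge0}{\rm HH}^i(A)$ a graded commutative ring; at cochain level, for Hochschild cochains $f$ of degree $n$ and $g$ of degree $m$, $(f\cup g)(r_1\otimes\cdots\otimes r_{n+m})=f(r_1\otimes\cdots\otimes r_n)\,g(r_{n+1}\otimes\cdots\otimes r_{n+m})$. *)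

theory Defs
  imports Main "HOL-Library.Function_Algebras"
begin

text \<open>
Quiver Q = (V, Ar, s, t): finite vertex set V, finite arrow set Ar, source s, target t.
A path is a pair (v, as): a starting vertex v and a list of arrows as, composable
left to right (first as!0, then as!1, ...).  (v, []) is the trivial path e_v.
Elements of kQ are finitely supported functions from paths to the field k that vanish
outside the valid paths; the pointwise sum of Function_Algebras is the vector addition.
The multiplication of kQ is the path-concatenation convolution pa_mult (NOT the
pointwise product).
\<close>

type_synonym ('v,'a) path = "'v \<times> 'a list"
type_synonym ('v,'a,'k) pelt = "('v,'a) path \<Rightarrow> 'k"

definition quiver :: "'v set \<Rightarrow> 'a set \<Rightarrow> ('a \<Rightarrow> 'v) \<Rightarrow> ('a \<Rightarrow> 'v) \<Rightarrow> bool" where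
  "quiver V Ar s t \<longleftrightarrow> finite V \<and> finite Ar \<and> s ` Ar \<subseteq> V \<and> t ` Ar \<subseteq> V"

fun chain :: "('a \<Rightarrow> 'v) \<Rightarrow> ('a \<Rightarrow> 'v) \<Rightarrow> 'a list \<Rightarrow> bool" where
  "chain s t [] = True"
| "chain s t [a] = True"
| "chain s t (a # b # as) = (t a = s b \<and> chain s t (b # as))"

definition valid_path :: "'v set \<Rightarrow> 'a set \<Rightarrow> ('a \<Rightarrow> 'v) \<Rightarrow> ('a \<Rightarrow> 'v) \<Rightarrow> ('v,'a) path \<Rightarrow> bool" where
  "valid_path V Ar s t p \<longleftrightarrow> fst p \<in> V \<and> set (snd p) \<subseteq> Ar \<and> chain s t (snd p)
     \<and> (snd p \<noteq> [] \<longrightarrow> s (hd (snd p)) = fst p)"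

definition path_end :: "('a \<Rightarrow> 'v) \<Rightarrow> ('v,'a) path \<Rightarrow> 'v" where
  "path_end t p = (if snd p = [] then fst p else t (last (snd p)))"

text \<open>Concatenation pq ("first p, then q"); None means the product is zero.\<close>
definition path_concat :: "('a \<Rightarrow> 'v) \<Rightarrow> ('v,'a) path \<Rightarrow> ('v,'a) path \<Rightarrow> ('v,'a) path option" where
  "path_concat t p q = (if path_end t p = fst q then Some (fst p, snd p @ snd q) else None)"

definition supp :: "('v,'a,'k::zero) pelt \<Rightarrow> ('v,'a) path set" where
  "supp x = {p. x p \<noteq> 0}"

definition path_alg :: "'v set \<Rightarrow> 'a set \<Rightarrow> ('a \<Rightarrow> 'v) \<Rightarrow> ('a \<Rightarrow> 'v) \<Rightarrow> ('v,'a,'k::field) pelt set" where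
  "path_alg V Ar s t = {x. finite (supp x) \<and> supp x \<subseteq> {p. valid_path V Ar s t p}}"

definition pa_mult :: "('a \<Rightarrow> 'v) \<Rightarrow> ('v,'a,'k::field) pelt \<Rightarrow> ('v,'a,'k) pelt \<Rightarrow> ('v,'a,'k) pelt" where
  "pa_mult t x y = (\<lambda>r. \<Sum>(p,q)\<in>{(p,q). p \<in> supp x \<and> q \<in> supp y \<and> path_concat t p q = Some r}. x p * y q)"

definition smult :: "'k::field \<Rightarrow> ('v,'a,'k) pelt \<Rightarrow> ('v,'a,'k) pelt" where
  "smult c x = (\<lambda>p. c * x p)"

definition path_elt :: "('v,'a) path \<Rightarrow> ('v,'a,'k::field) pelt" where
  "path_elt p = (\<lambda>q. if q = p then 1 else 0)"

definition two_sided_ideal :: "'v set \<Rightarrow> 'a set \<Rightarrow> ('a \<Rightarrow> 'v) \<Rightarrow> ('a \<Rightarrow> 'v) \<Rightarrow> ('v,'a,'k::field) pelt set \<Rightarrow> bool" where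
  "two_sided_ideal V Ar s t I \<longleftrightarrow> I \<subseteq> path_alg V Ar s t \<and> 0 \<in> I
     \<and> (\<forall>x\<in>I. \<forall>y\<in>I. x + y \<in> I) \<and> (\<forall>c. \<forall>x\<in>I. smult c x \<in> I)
     \<and> (\<forall>x\<in>I. \<forall>a\<in>path_alg V Ar s t. pa_mult t a x \<in> I \<and> pa_mult t x a \<in> I)"

definition ideal_gen :: "'v set \<Rightarrow> 'a set \<Rightarrow> ('a \<Rightarrow> 'v) \<Rightarrow> ('a \<Rightarrow> 'v) \<Rightarrow> ('v,'a,'k::field) pelt set \<Rightarrow> ('v,'a,'k) pelt set" where
  "ideal_gen V Ar s t S = \<Inter>{J. two_sided_ideal V Ar s t J \<and> S \<subseteq> J}"

text \<open>Admissible: R_Q^m \<subseteq> I \<subseteq> R_Q^2 for some m \<ge> 2 (R_Q the arrow ideal).\<close>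
definition admissible :: "'v set \<Rightarrow> 'a set \<Rightarrow> ('a \<Rightarrow> 'v) \<Rightarrow> ('a \<Rightarrow> 'v) \<Rightarrow> ('v,'a,'k::field) pelt set \<Rightarrow> bool" where
  "admissible V Ar s t I \<longleftrightarrow> two_sided_ideal V Ar s t I
     \<and> (\<forall>x\<in>I. \<forall>p. length (snd p) < 2 \<longrightarrow> x p = 0)
     \<and> (\<exists>m\<ge>2. \<forall>x\<in>path_alg V Ar s t. (\<forall>p. length (snd p) < m \<longrightarrow> x p = 0) \<longrightarrow> x \<in> I)"

definition triangular :: "'v set \<Rightarrow> 'a set \<Rightarrow> ('a \<Rightarrow> 'v) \<Rightarrow> ('a \<Rightarrow> 'v) \<Rightarrow> bool" where
  "triangular V Ar s t \<longleftrightarrow> (\<forall>p. valid_path V Ar s t p \<and> snd p \<noteq> [] \<longrightarrow> path_end t p \<noteq> fst p)"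

definition quadratic :: "'v set \<Rightarrow> 'a set \<Rightarrow> ('a \<Rightarrow> 'v) \<Rightarrow> ('a \<Rightarrow> 'v) \<Rightarrow> ('v,'a,'k::field) pelt set \<Rightarrow> bool" where
  "quadratic V Ar s t I \<longleftrightarrow> (\<exists>S. S \<subseteq> path_alg V Ar s t
     \<and> (\<forall>x\<in>S. \<forall>p. length (snd p) \<noteq> 2 \<longrightarrow> x p = 0) \<and> I = ideal_gen V Ar s t S)"

definition string_algebra :: "'v set \<Rightarrow> 'a set \<Rightarrow> ('a \<Rightarrow> 'v) \<Rightarrow> ('a \<Rightarrow> 'v) \<Rightarrow> ('v,'a,'k::field) pelt set \<Rightarrow> bool" where
  "string_algebra V Ar s t I \<longleftrightarrow>
     (\<exists>P. P \<subseteq> {p. valid_path V Ar s t p} \<and> I = ideal_gen V Ar s t (path_elt ` P))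
   \<and> (\<forall>v\<in>V. card {a\<in>Ar. s a = v} \<le> 2 \<and> card {a\<in>Ar. t a = v} \<le> 2)
   \<and> (\<forall>a\<in>Ar. card {b\<in>Ar. t a = s b \<and> path_elt (s a, [a, b]) \<notin> I} \<le> 1
            \<and> card {c\<in>Ar. t c = s a \<and> path_elt (s c, [c, a]) \<notin> I} \<le> 1)"

text \<open>
Hochschild cochains of A = kQ/I of degree n, i.e. elements of Hom_k(A^{\<otimes>n}, A), are
represented by k-multilinear maps f from n-tuples (lists) of elements of kQ to kQ which
descend to A (f xs \<in> I as soon as one argument lies in I); values are read modulo I.
\<close>
definition cochain :: "'v set \<Rightarrow> 'a set \<Rightarrow> ('a \<Rightarrow> 'v) \<Rightarrow> ('a \<Rightarrow> 'v) \<Rightarrow> ('v,'a,'k::field) pelt set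
    \<Rightarrow> nat \<Rightarrow> (('v,'a,'k) pelt list \<Rightarrow> ('v,'a,'k) pelt) \<Rightarrow> bool" where
  "cochain V Ar s t I n f \<longleftrightarrow>
     (\<forall>xs. length xs = n \<and> set xs \<subseteq> path_alg V Ar s t \<longrightarrow> f xs \<in> path_alg V Ar s t)
   \<and> (\<forall>xs ys x y c. length xs + length ys + 1 = n \<and> set xs \<subseteq> path_alg V Ar s t
        \<and> set ys \<subseteq> path_alg V Ar s t \<and> x \<in> path_alg V Ar s t \<and> y \<in> path_alg V Ar s t \<longrightarrow>
        f (xs @ [x + y] @ ys) = f (xs @ [x] @ ys) + f (xs @ [y] @ ys)
      \<and> f (xs @ [smult c x] @ ys) = smult c (f (xs @ [x] @ ys))
      \<and> (x \<in> I \<longrightarrow> f (xs @ [x] @ ys) \<in> I))"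

text \<open>Hochschild differential applied to a degree-n cochain f, evaluated on x_1,...,x_{n+1}
  (= xs!0, ..., xs!n).\<close>
definition hoch_d :: "('a \<Rightarrow> 'v) \<Rightarrow> nat \<Rightarrow> (('v,'a,'k::field) pelt list \<Rightarrow> ('v,'a,'k) pelt)
    \<Rightarrow> ('v,'a,'k) pelt list \<Rightarrow> ('v,'a,'k) pelt" where
  "hoch_d t n f xs =
     pa_mult t (xs ! 0) (f (drop 1 xs))
     + (\<Sum>i\<in>{1..n}. smult ((-1) ^ i) (f (take (i - 1) xs @ [pa_mult t (xs ! (i - 1)) (xs ! i)] @ drop (i + 1) xs)))
     + smult ((-1) ^ (n + 1)) (pa_mult t (f (take n xs)) (xs ! n))"

definition cocycle :: "'v set \<Rightarrow> 'a set \<Rightarrow> ('a \<Rightarrow> 'v) \<Rightarrow> ('a \<Rightarrow> 'v) \<Rightarrow> ('v,'a,'k::field) pelt set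
    \<Rightarrow> nat \<Rightarrow> (('v,'a,'k) pelt list \<Rightarrow> ('v,'a,'k) pelt) \<Rightarrow> bool" where
  "cocycle V Ar s t I n f \<longleftrightarrow> cochain V Ar s t I n f
     \<and> (\<forall>xs. length xs = n + 1 \<and> set xs \<subseteq> path_alg V Ar s t \<longrightarrow> hoch_d t n f xs \<in> I)"

definition cup :: "('a \<Rightarrow> 'v) \<Rightarrow> nat \<Rightarrow> (('v,'a,'k::field) pelt list \<Rightarrow> ('v,'a,'k) pelt)
    \<Rightarrow> (('v,'a,'k) pelt list \<Rightarrow> ('v,'a,'k) pelt) \<Rightarrow> ('v,'a,'k) pelt list \<Rightarrow> ('v,'a,'k) pelt" where
  "cup t n f g xs = pa_mult t (f (take n xs)) (g (drop n xs))"

definition coboundary :: "'v set \<Rightarrow> 'a set \<Rightarrow> ('a \<Rightarrow> 'v) \<Rightarrow> ('a \<Rightarrow> 'v) \<Rightarrow> ('v,'a,'k::field) pelt set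
    \<Rightarrow> nat \<Rightarrow> (('v,'a,'k) pelt list \<Rightarrow> ('v,'a,'k) pelt) \<Rightarrow> bool" where
  "coboundary V Ar s t I d f \<longleftrightarrow> (\<exists>h. cochain V Ar s t I (d - 1) h
     \<and> (\<forall>xs. length xs = d \<and> set xs \<subseteq> path_alg V Ar s t \<longrightarrow> f xs - hoch_d t (d - 1) h xs \<in> I))"

end

theory Submission
  imports Defs
begin

text \<open>
  The algebra \<open>A = kQ/I\<close> is monomial, so its nonzero paths together with a zero and a formal unit form a monoid,
  and Hochschild cochains are functions on lists over this monoid.  Since \<open>I\<close> is quadratic, the bar resolution
  retracts onto the Koszul subcomplex spanned by the words \<open>a\<^sub>1\<dots>a\<^sub>N\<close> of arrows with all \<open>a\<^sub>i a\<^sub>i\<^sub>+\<^sub>1\<close> in \<open>I\<close>; by the comparison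
  theorem a cocycle is cohomologous to its pull-back along this retraction, hence is a coboundary as soon as its
  restriction to the Koszul words is one.

  Let \<open>z = f \<union> g\<close>, let \<open>\<epsilon> = \<gamma>\<delta>\<close> be a Koszul word and \<open>r\<close> a nonzero path parallel to it.  If \<open>pq = r\<close> contributes to the
  coefficient of \<open>z \<epsilon>\<close> at \<open>r\<close>, the cocycle equations of \<open>f\<close> at \<open>(\<gamma>, q)\<close> and of \<open>g\<close> at \<open>(p, \<delta>)\<close> show that \<open>r\<close> and \<open>\<epsilon>\<close>
  share their first arrow unless \<open>\<gamma>q \<noteq> 0\<close>, and their last arrow unless \<open>p\<delta> \<noteq> 0\<close>.  If both exceptions occurred, then
  \<open>p\<close> and \<open>q\<close> would be nontrivial (there are no oriented cycles) and the string condition at the last arrow of \<open>p\<close> would force \<open>q\<close> and \<open>\<delta>\<close> to start with the same arrow, contradicting \<open>\<gamma>\<delta> = 0\<close>.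
  So \<open>z\<close> only sees pairs \<open>(\<epsilon>, r)\<close> with a common end arrow.  In the Koszul cochain complex every pair is obtained from
  a pair without common end arrows by adding at most one arrow on each side, these arrows being unique by the string
  condition, and the resulting intervals and squares are acyclic except for isolated pairs; hence \<open>z\<close> has a primitive.
\<close>

section \<open>The bar differential and homotopies\<close>

text \<open>
  The head of the list is treated as a left coefficient: \<open>bar_d\<close> is the bar differential of maps that are linear in the
  right coefficient only.  In this larger complex prepending the unit is a contraction.
\<close>

fun pre :: "('m \<Rightarrow> 'm \<Rightarrow> 'm) \<Rightarrow> ('e \<Rightarrow> 'm \<Rightarrow> 'e) \<Rightarrow> 'm \<Rightarrow> ('m list \<Rightarrow> 'e) \<Rightarrow> 'm list \<Rightarrow> 'e" where
  "pre mul act a F [] = act (F []) a"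
| "pre mul act a F (y # ys) = F (mul a y # ys)"

fun bar_d :: "('m \<Rightarrow> 'm \<Rightarrow> 'm) \<Rightarrow> ('e::ab_group_add \<Rightarrow> 'm \<Rightarrow> 'e) \<Rightarrow> ('m list \<Rightarrow> 'e) \<Rightarrow> 'm list \<Rightarrow> 'e" where
  "bar_d mul act F [] = 0"
| "bar_d mul act F (a # ys) = pre mul act a F ys - bar_d mul act (\<lambda>zs. F (a # zs)) ys"

lemma bar_d_cong_length:
  assumes "\<And>zs. Suc (length zs) = length xs \<Longrightarrow> F zs = G zs"
  shows "bar_d mul act F xs = bar_d mul act G xs"
  using assms
proof (induction xs arbitrary: F G)
  case (Cons a ys)
  have "pre mul act a F ys = pre mul act a G ys"
    using Cons.prems by (cases ys) auto
  moreover have "bar_d mul act (\<lambda>zs. F (a # zs)) ys = bar_d mul act (\<lambda>zs. G (a # zs)) ys"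
    using Cons.prems by (intro Cons.IH) auto
  ultimately show ?case by simp
qed simp

text \<open>Transports the differential along a multiplicative map. The right actions have to agree
  only at values of \<open>F\<close>: for the embedding \<open>emb\<close> of the path monoid used
  later, they differ at the unit unless the value is in normal form.\<close>

lemma bar_d_map:
  assumes "\<And>x y. e (mul x y) = mul' (e x) (e y)" and "\<And>zs x. act (F (map e zs)) x = act' (F (map e zs)) (e x)"
  shows "bar_d mul act (\<lambda>zs. F (map e zs)) xs = bar_d mul' act' F (map e xs)"
  using assms
proof (induction xs arbitrary: F)
  case (Cons a ys)
  have "pre mul act a (\<lambda>zs. F (map e zs)) ys = pre mul' act' (e a) F (map e ys)"
    using Cons.prems(1) Cons.prems(2)[of "[]"] by (cases ys) auto
  moreover have "bar_d mul act (\<lambda>zs. F (e a # map e zs)) ys = bar_d mul' act' (\<lambda>zs. F (e a # zs)) (map e ys)"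
  proof (rule Cons.IH)
    show "act (F (e a # map e zs)) x = act' (F (e a # map e zs)) (e x)" for zs x
      using Cons.prems(2)[of "a # zs"] by simp
  qed (rule Cons.prems)
  ultimately show ?case by simp
qed simp

text \<open>A monoid acting from both sides on an abelian group stands for an algebra and a
  bimodule: cochains over a monoid algebra are plain functions on lists of monoid elements.\<close>

locale bar =
  fixes mul :: "'m \<Rightarrow> 'm \<Rightarrow> 'm" and one :: 'm
    and act :: "'e::ab_group_add \<Rightarrow> 'm \<Rightarrow> 'e" and lact :: "'m \<Rightarrow> 'e \<Rightarrow> 'e"
  assumes mul_assoc: "mul (mul a b) c = mul a (mul b c)"
    and one_mul [simp]: "mul one a = a" and mul_one [simp]: "mul a one = a"
    and act_add: "act (y + z) a = act y a + act z a"
    and act_mul: "act (act y a) b = act y (mul a b)" and act_one [simp]: "act y one = y"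
    and lact_add: "lact a (y + z) = lact a y + lact a z"
    and lact_mul: "lact a (lact b y) = lact (mul a b) y"
    and lact_act: "act (lact a y) b = lact a (act y b)"
begin

abbreviation "pr \<equiv> pre mul act"
abbreviation "d \<equiv> bar_d mul act"

lemma act_0 [simp]: "act 0 a = 0" using act_add[of 0 0 a] by simp
lemma lact_0 [simp]: "lact a 0 = 0" using lact_add[of a 0 0] by simp
lemma act_diff: "act (y - z) a = act y a - act z a" using act_add[of "y - z" z a] by (simp add: eq_diff_eq)
lemma lact_diff: "lact a (y - z) = lact a y - lact a z" using lact_add[of a "y - z" z] by (simp add: eq_diff_eq)

lemma act_minus: "act (- y) a = - act y a" using act_diff[of 0 y a] by simp

lemma pre_add: "pr a (\<lambda>zs. F zs + G zs) ys = pr a F ys + pr a G ys"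
  by (cases ys) (auto simp: act_add)

lemma pre_diff: "pr a (\<lambda>zs. F zs - G zs) ys = pr a F ys - pr a G ys"
  by (cases ys) (auto simp: act_diff)

lemma d_0 [simp]: "d (\<lambda>_. 0) xs = 0"
proof (induction xs)
  case (Cons a ys)
  then show ?case by (cases ys) auto
qed simp

lemma d_add: "d (\<lambda>zs. F zs + G zs) xs = d F xs + d G xs"
  by (induction xs arbitrary: F G) (simp_all add: pre_add)

lemma d_diff: "d (\<lambda>zs. F zs - G zs) xs = d F xs - d G xs"
  by (induction xs arbitrary: F G) (simp_all add: pre_diff)

lemma d_lact: "d (\<lambda>zs. lact a (F zs)) xs = lact a (d F xs)"
proof (induction xs arbitrary: F)
  case (Cons b ys)
  have "pr b (\<lambda>zs. lact a (F zs)) ys = lact a (pr b F ys)" by (cases ys) (auto simp: lact_act)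
  then show ?case by (simp add: Cons.IH lact_diff)
qed simp

lemma pre_one: "pr one F = F"
proof
  show "pr one F xs = F xs" for xs by (cases xs) auto
qed

lemma pre_pre: "pr b (pr a F) = pr (mul a b) F"
proof
  show "pr b (pr a F) xs = pr (mul a b) F xs" for xs by (cases xs) (auto simp: act_mul mul_assoc)
qed

text \<open>On chains this is left linearity of the bar differential: the head may be multiplied by
  \<open>a\<close> before or after taking faces.\<close>

lemma pre_d: "pr a (d F) = d (pr a F)"
proof
  show "pr a (d F) ys = d (pr a F) ys" for ys by (cases ys) (simp_all add: pre_pre)
qed

text \<open>Peeling off the head leaves \<open>pre\<close> of \<open>d F\<close> and
  \<open>d\<close> of \<open>pre\<close>, which cancel by \<open>pre_d\<close>, and a smaller
  instance of the claim.\<close>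

lemma d_d: "d (d F) xs = 0"
proof (induction xs arbitrary: F)
  case (Cons a ys)
  have "d (\<lambda>zs. d F (a # zs)) ys = d (pr a F) ys - d (d (\<lambda>zs. F (a # zs))) ys"
    by (simp add: d_diff)
  then show ?case using Cons.IH by (simp add: pre_d)
qed simp

lemma act_sum: "act (\<Sum>i\<in>X. f i) a = (\<Sum>i\<in>X. act (f i) a)"
  by (induction X rule: infinite_finite_induct) (auto simp: act_add)

lemma lact_sum: "lact a (\<Sum>i\<in>X. f i) = (\<Sum>i\<in>X. lact a (f i))"
  by (induction X rule: infinite_finite_induct) (auto simp: lact_add)

lemma d_sum: "d (\<lambda>zs. \<Sum>i\<in>X. f i zs) xs = (\<Sum>i\<in>X. d (f i) xs)"
  by (induction X rule: infinite_finite_induct) (auto simp: d_add)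

text \<open>Here the head is a genuine argument and not a coefficient: \<open>d f\<close> on the
  whole list supplies every term except the leftmost one, with opposite sign.\<close>

fun hoch :: "('m list \<Rightarrow> 'e) \<Rightarrow> 'm list \<Rightarrow> 'e" where
  "hoch f [] = 0"
| "hoch f (x # xs) = lact x (f xs) - d f (x # xs)"

lemma hoch_diff: "hoch (\<lambda>zs. F zs - G zs) xs = hoch F xs - hoch G xs"
  by (cases xs) (simp_all add: lact_diff d_diff del: bar_d.simps)

text \<open>Cochains are functions on lists of every length; having degree \<open>k\<close> means
  vanishing on all other lengths.\<close>

lemma hoch_wrong_length:
  assumes "\<And>zs. length zs \<noteq> k \<Longrightarrow> F zs = 0" "length xs \<noteq> Suc k"
  shows "hoch F xs = 0"
proof (cases xs)
  case (Cons x ys)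
  have "d F xs = d (\<lambda>_. 0) xs" using assms by (intro bar_d_cong_length) auto
  moreover have "F ys = 0" using assms Cons by auto
  ultimately show ?thesis using Cons by (simp del: bar_d.simps)
qed simp

text \<open>The bimodule map on the bar resolution that belongs to a cochain. The empty list carries
  no left coefficient and gets the default 0.\<close>

definition bimod_ext :: "('m list \<Rightarrow> 'e) \<Rightarrow> 'm list \<Rightarrow> 'e" where
  "bimod_ext f xs = (case xs of [] \<Rightarrow> 0 | a # ys \<Rightarrow> lact a (f ys))"

lemma pre_bimod_ext: "pr x (bimod_ext f) = (\<lambda>ys. lact x (bimod_ext f ys))"
proof
  show "pr x (bimod_ext f) ys = lact x (bimod_ext f ys)" for ys
    by (cases ys) (auto simp: bimod_ext_def lact_mul)
qed

text \<open>The first face multiplies the head \<open>a\<close> by the next entry;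
  \<open>lact_mul\<close> turns it into \<open>a\<close> acting on the leftmost Hochschild term, and
  \<open>a\<close> factors out of all other faces.\<close>

lemma d_bimod_ext: "d (bimod_ext f) = bimod_ext (hoch f)"
proof
  show "d (bimod_ext f) xs = bimod_ext (hoch f) xs" for xs
  proof (cases xs)
    case (Cons a ys)
    have "(\<lambda>zs. bimod_ext f (a # zs)) = (\<lambda>zs. lact a (f zs))" by (simp add: bimod_ext_def)
    then have "d (bimod_ext f) xs = pr a (bimod_ext f) ys - lact a (d f ys)"
      using Cons by (simp add: d_lact)
    then show ?thesis using Cons
      by (cases ys) (simp_all add: bimod_ext_def lact_diff lact_mul)
  qed (simp add: bimod_ext_def)
qed

text \<open>If \<open>\<Psi>\<close> is dual to a bimodule map \<open>\<psi>\<close> of bar modules, then \<open>total_d \<Psi>\<close> is dual to \<open>\<psi> \<circ> d\<close>.\<close>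

definition total_d :: "(('m list \<Rightarrow> 'e) \<Rightarrow> 'm list \<Rightarrow> 'e) \<Rightarrow> ('m list \<Rightarrow> 'e) \<Rightarrow> 'm list \<Rightarrow> 'e" where
  "total_d \<Psi> F xs = (case xs of [] \<Rightarrow> 0 | x # ys \<Rightarrow> \<Psi> (pr x F) ys) - d (\<Psi> F) xs"

lemma total_d_Nil [simp]: "total_d \<Psi> F [] = 0" by (simp add: total_d_def)
lemma total_d_Cons: "total_d \<Psi> F (x # ys) = \<Psi> (pr x F) ys - d (\<Psi> F) (x # ys)" by (simp add: total_d_def)

lemma total_d_diff:
  assumes "\<And>F G xs. \<Psi> (\<lambda>zs. F zs - G zs) xs = \<Psi> F xs - \<Psi> G xs"
  shows "total_d \<Psi> (\<lambda>zs. F zs - G zs) xs = total_d \<Psi> F xs - total_d \<Psi> G xs"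
proof -
  have p: "pr x (\<lambda>zs. F zs - G zs) = (\<lambda>zs. pr x F zs - pr x G zs)" for x
    by (rule ext) (rule pre_diff)
  have h: "\<Psi> (\<lambda>zs. F zs - G zs) = (\<lambda>xs. \<Psi> F xs - \<Psi> G xs)"
    by (rule ext) (rule assms)
  show ?thesis
    unfolding total_d_def h d_diff by (cases xs) (simp_all only: list.case p assms, simp_all)
qed

text \<open>Dual to \<psi> d d = 0. Moving the head into the left coefficient gives
  \<open>total_d\<close> at \<open>pre x F\<close> twice with opposite signs; what remains vanishes
  by \<open>d_d\<close>.\<close>

lemma total_d_total_d: "total_d (total_d \<Psi>) F xs = 0"
proof (cases xs)
  case (Cons x ys)
  define L where "L zs = (case zs of [] \<Rightarrow> 0 | z # zs \<Rightarrow> \<Psi> (pr z F) zs)" for zs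
  have *: "total_d \<Psi> F = (\<lambda>zs. L zs - d (\<Psi> F) zs)" by (auto simp: total_d_def L_def)
  have "d (total_d \<Psi> F) xs = d L xs" unfolding * by (simp only: d_diff d_d diff_zero)
  moreover have "d L (x # ys) = total_d \<Psi> (pr x F) ys"
    by (cases ys) (simp_all add: L_def total_d_Cons pre_pre)
  ultimately show ?thesis using Cons by (simp add: total_d_def)
qed simp

end

text \<open>\<open>\<Phi>\<close> is dual to a bimodule endomorphism of the bar resolution that is a
  chain map (\<open>\<Phi>_chain\<close>) over the identity of the algebra
  (\<open>\<Phi>_augment\<close>). Both laws are demanded at \<open>normalized\<close> functions
  only, so that a zero element of the monoid can play the role of the zero of the algebra.\<close>

locale bar_endo = bar mul one act lact
  for mul :: "'m \<Rightarrow> 'm \<Rightarrow> 'm" and one :: 'm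
    and act :: "'e::ab_group_add \<Rightarrow> 'm \<Rightarrow> 'e" and lact :: "'m \<Rightarrow> 'e \<Rightarrow> 'e" +
  fixes normalized :: "('m list \<Rightarrow> 'e) \<Rightarrow> bool" and \<Phi> :: "('m list \<Rightarrow> 'e) \<Rightarrow> 'm list \<Rightarrow> 'e"
  assumes \<Phi>_diff: "\<Phi> (\<lambda>zs. F zs - G zs) xs = \<Phi> F xs - \<Phi> G xs"
    and \<Phi>_lact: "\<Phi> (\<lambda>zs. lact a (F zs)) xs = lact a (\<Phi> F xs)"
    and normalized_Cons: "normalized F \<Longrightarrow> normalized (\<lambda>zs. F (a # zs))"
    and normalized_pre: "normalized F \<Longrightarrow> normalized (pre mul act a F)"
    and \<Phi>_augment: "normalized F \<Longrightarrow> \<Phi> (bar_d mul act F) [] = F []"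
    and \<Phi>_chain: "normalized F \<Longrightarrow> \<Phi> (bar_d mul act F) (x # xs)
          = \<Phi> (pre mul act x F) xs - bar_d mul act (\<Phi> F) (x # xs)"
begin

text \<open>
  The dual of the bimodule homotopy \<open>h\<^sub>n = S (\<phi> - id - h\<^sub>n\<^sub>-\<^sub>1 d)\<close>, where \<open>S\<close> prepends the unit and \<open>\<Phi>\<close> is dual to \<open>\<phi>\<close>.
\<close>

fun H :: "nat \<Rightarrow> ('m list \<Rightarrow> 'e) \<Rightarrow> 'm list \<Rightarrow> 'e" where
  "H 0 F xs = 0"
| "H (Suc n) F xs = \<Phi> (\<lambda>zs. F (one # zs)) xs - F (one # one # xs) - total_d (H n) (\<lambda>zs. F (one # zs)) xs"

lemma H_diff: "H n (\<lambda>zs. F zs - G zs) xs = H n F xs - H n G xs"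
proof (induction n arbitrary: F G xs)
  case (Suc n)
  have "total_d (H n) (\<lambda>zs. F zs - G zs) xs = total_d (H n) F xs - total_d (H n) G xs" for F G
    by (intro total_d_diff Suc)
  then show ?case by (simp add: \<Phi>_diff)
qed simp

lemma H_0 [simp]: "H n (\<lambda>_. 0) xs = 0"
  using H_diff[of n "\<lambda>_. 0" "\<lambda>_. 0" xs] by simp

lemma H_lact: "H n (\<lambda>zs. lact a (F zs)) xs = lact a (H n F xs)"
proof (induction n arbitrary: F xs)
  case (Suc n)
  have "total_d (H n) (\<lambda>zs. lact a (F zs)) xs = lact a (total_d (H n) F xs)" for F
  proof -
    have p: "pr x (\<lambda>zs. lact a (F zs)) = (\<lambda>zs. lact a (pr x F zs))" for x
    proof
      show "pr x (\<lambda>zs. lact a (F zs)) zs = lact a (pr x F zs)" for zs by (cases zs) (simp_all add: lact_act)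
    qed
    have h: "H n (\<lambda>zs. lact a (F zs)) = (\<lambda>xs. lact a (H n F xs))" using Suc by blast
    show ?thesis unfolding total_d_def h d_lact lact_diff by (cases xs) (simp_all add: p Suc)
  qed
  then show ?case by (simp add: \<Phi>_lact lact_diff)
qed simp

text \<open>Dual to d h + h d = \<phi> - id at left coefficient 1. By the previous degree and the
  chain map property, \<phi> - id - h d takes values in cycles, and on cycles prepending the unit is
  inverted by d.\<close>

lemma homotopy:
  assumes "normalized F" "length xs = n"
  shows "H (Suc n) (d F) xs = \<Phi> F xs - F (one # xs) - total_d (H n) F xs"
  using assms
proof (induction n arbitrary: F xs)
  case 0
  have e: "(\<lambda>zs. d F (one # zs)) = (\<lambda>zs. F zs - d (\<lambda>zs. F (one # zs)) zs)" by (simp add: pre_one)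
  have "normalized (\<lambda>zs. F (one # zs))" using 0 normalized_Cons by blast
  then have "\<Phi> (d (\<lambda>zs. F (one # zs))) [] = F [one]" using \<Phi>_augment by blast
  then show ?case using 0 by (simp add: e \<Phi>_diff pre_one)
next
  case (Suc m)
  define K where "K zs = F (one # zs)" for zs
  have gK: "normalized K" unfolding K_def using Suc normalized_Cons by blast
  obtain x ys where xs: "xs = x # ys" "length ys = m" using Suc.prems(2) by (cases xs) auto
  \<comment> \<open>The contraction identity d S = id - S d in dual form, \<open>K\<close> being
    \<open>F\<close> after \<open>S\<close>.\<close>
  have e: "(\<lambda>zs. d F (one # zs)) = (\<lambda>zs. F zs - d K zs)" by (simp add: pre_one K_def[abs_def])
  have DH: "total_d (H (Suc m)) (\<lambda>zs. F zs - d K zs) xs = total_d (H (Suc m)) F xs - total_d (H (Suc m)) (d K) xs"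
    by (intro total_d_diff H_diff)
  have 1: "H (Suc m) (d (pr x K)) ys = \<Phi> (pr x K) ys - K xs - total_d (H m) (pr x K) ys"
    using Suc.IH[OF normalized_pre[OF gK, of x] xs(2)] xs by simp
  have 2: "d (H (Suc m) (d K)) xs = d (\<lambda>zs. (\<Phi> K zs - K (one # zs)) - total_d (H m) K zs) xs"
    using xs Suc.IH[OF gK] by (intro bar_d_cong_length) auto
  have 3: "d K (one # xs) = K xs - d (\<lambda>zs. K (one # zs)) xs" by (simp add: pre_one)
  have "total_d (H (Suc m)) (d K) xs = H (Suc m) (d (pr x K)) ys - d (H (Suc m) (d K)) xs"
    unfolding xs total_d_Cons pre_d ..
  also have "\<dots> = (\<Phi> (pr x K) ys - d (\<Phi> K) xs) - d K (one # xs) - total_d (total_d (H m)) K xs"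
    unfolding 1 2 3 d_diff unfolding xs total_d_Cons by (simp add: algebra_simps)
  also have "\<dots> = \<Phi> (d K) xs - d K (one # xs)"
    unfolding total_d_total_d using \<Phi>_chain[OF gK] xs by simp
  \<comment> \<open>In dual form: d (\<phi> - id - h d) = 0.\<close>
  finally have key: "total_d (H (Suc m)) (d K) xs = \<Phi> (d K) xs - d K (one # xs)" .
  have "H (Suc (Suc m)) (d F) xs = \<Phi> (\<lambda>zs. F zs - d K zs) xs - (F (one # xs) - d K (one # xs))
      - total_d (H (Suc m)) (\<lambda>zs. F zs - d K zs) xs"
    using e by (subst H.simps) (simp only: fun_cong[OF e])
  then show ?case unfolding DH key \<Phi>_diff by (simp del: H.simps bar_d.simps)
qed

text \<open>For a cocycle the left side of \<open>homotopy\<close> vanishes, and at a bimodule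
  extension \<open>total_d\<close> reduces to \<open>hoch\<close> because \<open>H\<close> commutes
  with the left action.\<close>

lemma cocycle_homotopic:
  assumes "normalized (bimod_ext f)" "\<And>xs. hoch f xs = 0" "xs \<noteq> []" "lact one (f xs) = f xs"
  shows "f xs = \<Phi> (bimod_ext f) xs - hoch (H (length xs) (bimod_ext f)) xs"
proof -
  obtain x ys where xs: "xs = x # ys" using assms(3) by (cases xs) auto
  have z: "d (bimod_ext f) = (\<lambda>_. 0)"
    unfolding d_bimod_ext using assms(2) by (auto simp: bimod_ext_def split: list.split)
  have "0 = \<Phi> (bimod_ext f) xs - bimod_ext f (one # xs) - total_d (H (length xs)) (bimod_ext f) xs"
    using homotopy[OF assms(1) refl, of xs] unfolding z by (simp del: H.simps)
  moreover have "bimod_ext f (one # xs) = f xs" using assms(4) by (simp add: bimod_ext_def)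
  moreover have "total_d (H (length xs)) (bimod_ext f) xs = hoch (H (length xs) (bimod_ext f)) xs"
    unfolding xs total_d_Cons pre_bimod_ext H_lact by simp
  ultimately show ?thesis by (simp add: algebra_simps)
qed

lemma hoch_pullback:
  assumes "normalized (bimod_ext f)" "xs \<noteq> []"
  shows "\<Phi> (bimod_ext (hoch f)) xs = hoch (\<Phi> (bimod_ext f)) xs"
proof -
  obtain x ys where xs: "xs = x # ys" using assms(2) by (cases xs) auto
  show ?thesis using \<Phi>_chain[OF assms(1), of x ys] unfolding d_bimod_ext pre_bimod_ext xs \<Phi>_lact by simp
qed

end

section \<open>Paths modulo quadratic zero relations\<close>

text \<open>
  Paths that are zero in the algebra are not excluded as arguments of \<open>Path\<close>; they are never produced by the
  multiplication and behave like \<open>Zero\<close>.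
\<close>

datatype ('v, 'a) mon = Zero | One | Path 'v "'a list"

text \<open>A sign that makes sense in any abelian group: for values of cochains, for their
  coefficients, and for \<open>bar_d\<close> without scalars.\<close>

definition alternate :: "nat \<Rightarrow> 'z::ab_group_add \<Rightarrow> 'z" where
  "alternate n y = (if even n then y else - y)"

lemma alternate_simps [simp]: "alternate 0 y = y" "alternate (Suc n) y = - alternate n y" "alternate n (- y) = - alternate n y" "alternate n (alternate n y) = y"
  by (auto simp: alternate_def)

lemma alternate_0 [simp]: "alternate n 0 = 0" by (simp add: alternate_def)

lemma alternate_apply: "alternate n y p = (alternate n (y p) :: 'z::ab_group_add)" by (simp add: alternate_def)

lemma sum_split_add: "(\<Sum>i<m + n. f i) = (\<Sum>i<m. f i) + (\<Sum>j<n. f (m + j :: nat) :: 'z::comm_monoid_add)"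
  by (induction n) (simp_all add: add.assoc)

lemma sum_fun_apply: "(\<Sum>i\<in>X. f i) p = (\<Sum>i\<in>X. f i p :: 'z::comm_monoid_add)"
  using sum_comp_morphism[of "\<lambda>x. x p" f X] by (simp add: o_def)

text \<open>The relations are encoded by \<open>nz\<close>: a composable pair of arrows is a zero
  relation exactly when \<open>nz\<close> fails. Since relations have length 2, vanishing of a path
  is tested on consecutive arrows.\<close>

locale mono_quiver =
  fixes V :: "'v set" and Ar :: "'a set" and s t :: "'a \<Rightarrow> 'v" and nz :: "'a \<Rightarrow> 'a \<Rightarrow> bool"
  assumes finite_V: "finite V" and s_V: "a \<in> Ar \<Longrightarrow> s a \<in> V" and t_V: "a \<in> Ar \<Longrightarrow> t a \<in> V"
begin

definition nonzero :: "'v \<Rightarrow> 'a list \<Rightarrow> bool" where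
  "nonzero v as \<longleftrightarrow> v \<in> V \<and> set as \<subseteq> Ar \<and> successively (\<lambda>a b. t a = s b \<and> nz a b) as \<and> (as \<noteq> [] \<longrightarrow> s (hd as) = v)"

definition path_target :: "'v \<Rightarrow> 'a list \<Rightarrow> 'v" where
  "path_target v as = (if as = [] then v else t (last as))"

lemma path_target_Nil [simp]: "path_target v [] = v" by (simp add: path_target_def)
lemma path_target_append [simp]: "path_target v (as @ bs) = path_target (path_target v as) bs" by (simp add: path_target_def)
lemma path_target_Cons [simp]: "path_target v (a # as) = path_target (t a) as" by (simp add: path_target_def)

lemma nonzero_Nil [simp]: "nonzero v [] \<longleftrightarrow> v \<in> V" by (simp add: nonzero_def)

lemma nonzero_target: "nonzero v as \<Longrightarrow> path_target v as \<in> V"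
  by (auto simp: nonzero_def path_target_def intro!: t_V)

lemma nonzero_Cons: "nonzero v (a # as) \<longleftrightarrow> a \<in> Ar \<and> s a = v \<and> nonzero (t a) as \<and> (as \<noteq> [] \<longrightarrow> nz a (hd as))"
  by (cases as) (auto simp: nonzero_def s_V t_V)

lemma nonzero_append: "nonzero v (as @ bs) \<longleftrightarrow> nonzero v as \<and> nonzero (path_target v as) bs \<and> (as \<noteq> [] \<longrightarrow> bs \<noteq> [] \<longrightarrow> nz (last as) (hd bs))"
proof (induction as arbitrary: v)
  case Nil
  then show ?case by (auto simp: nonzero_def)
next
  case (Cons a as)
  note IH = Cons.IH
  show ?case
  proof (cases as)
    case Nil
    then show ?thesis by (auto simp: nonzero_Cons t_V)
  next
    case (Cons b cs)
    then show ?thesis using IH[of "t a"] by (auto simp: nonzero_Cons)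
  qed
qed

lemma nonzero_take_drop:
  assumes "nonzero v as"
  shows "nonzero v (take i as)" "nonzero (path_target v (take i as)) (drop i as)"
  using assms nonzero_append[of v "take i as" "drop i as"] by simp_all

fun mon_mult :: "('v, 'a) mon \<Rightarrow> ('v, 'a) mon \<Rightarrow> ('v, 'a) mon" where
  "mon_mult One y = y"
| "mon_mult x One = x"
| "mon_mult (Path v as) (Path w bs) = (if path_target v as = w \<and> nonzero v (as @ bs) then Path v (as @ bs) else Zero)"
| "mon_mult _ _ = Zero"

lemma mon_mult_Zero [simp]: "mon_mult Zero x = Zero" "mon_mult x Zero = Zero"
  by (cases x; simp)+

lemma mon_mult_One [simp]: "mon_mult x One = x" by (cases x) auto

lemma mon_mult_assoc: "mon_mult (mon_mult x y) z = mon_mult x (mon_mult y z)"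
  by (cases x; cases y; cases z) (auto simp: nonzero_append)

text \<open>
  Elements of the algebra are arbitrary functions on paths, of which only the values at nonzero paths matter; \<open>conv\<close> is
  the product, always returned in normal form.
\<close>

definition conv :: "('v,'a,'k::field) pelt \<Rightarrow> ('v,'a,'k) pelt \<Rightarrow> ('v,'a,'k) pelt" where
  "conv x y = (\<lambda>(v, as). if nonzero v as then \<Sum>i\<le>length as. x (v, take i as) * y (path_target v (take i as), drop i as) else 0)"

definition nf :: "('v,'a,'k::field) pelt \<Rightarrow> ('v,'a,'k) pelt" where
  "nf x = (\<lambda>(v, as). if nonzero v as then x (v, as) else 0)"

definition unit :: "('v,'a,'k::field) pelt" where
  "unit = (\<lambda>(v, as). if v \<in> V \<and> as = [] then 1 else 0)"

primrec emb :: "('v, 'a) mon \<Rightarrow> ('v,'a,'k::field) pelt" where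
  "emb Zero = 0"
| "emb One = unit"
| "emb (Path v as) = nf (path_elt (v, as))"

lemma conv_add_left: "conv (x + y) z = conv x z + conv y z"
  by (auto simp: conv_def fun_eq_iff sum.distrib algebra_simps)

lemma conv_add_right: "conv z (x + y) = conv z x + conv z y"
  by (auto simp: conv_def fun_eq_iff sum.distrib algebra_simps)

lemma conv_0 [simp]: "conv 0 x = 0" "conv x 0 = 0"
  by (auto simp: conv_def fun_eq_iff)

lemma nf_idem [simp]: "nf (nf x) = nf x"
  by (auto simp: nf_def fun_eq_iff)

lemma nf_conv [simp]: "nf (conv x y) = conv x y"
  by (auto simp: nf_def conv_def fun_eq_iff)

lemma conv_nf [simp]: "conv (nf x) y = conv x y" "conv x (nf y) = conv x y"
  by (auto simp: conv_def nf_def fun_eq_iff nonzero_take_drop intro!: sum.cong)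

lemma conv_assoc: "conv (conv x y) z = conv x (conv y z)"
proof (rule ext, clarify)
  fix v as
  show "conv (conv x y) z (v, as) = conv x (conv y z) (v, as)"
  proof (cases "nonzero v as")
    case True
    define n where "n = length as"
    let ?f = "\<lambda>i j. x (v, take j as) * y (path_target v (take j as), take (i - j) (drop j as)) * z (path_target v (take i as), drop i as)"
    have "conv (conv x y) z (v, as) = (\<Sum>i\<le>n. \<Sum>j\<le>i. ?f i j)"
      using True by (auto simp: conv_def nonzero_take_drop sum_distrib_right n_def min_def drop_take intro!: sum.cong)
    also have "\<dots> = (\<Sum>(i,j)\<in>(SIGMA i:{..n}. {..i}). ?f i j)" by (simp add: sum.Sigma)
    also have "\<dots> = (\<Sum>(j,k)\<in>(SIGMA j:{..n}. {..n-j}). ?f (j + k) j)"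
      by (rule sum.reindex_bij_witness[of _ "\<lambda>(j,k). (j + k, j)" "\<lambda>(i,j). (j, i - j)"]) auto
    also have "\<dots> = (\<Sum>j\<le>n. \<Sum>k\<le>n-j. ?f (j + k) j)" by (simp add: sum.Sigma)
    also have "\<dots> = conv x (conv y z) (v, as)"
    proof -
      have "path_target v (take (j + k) as) = path_target (path_target v (take j as)) (take k (drop j as))" for j k
        by (metis path_target_append take_add)
      then show ?thesis
        using True by (auto simp: conv_def nonzero_take_drop sum_distrib_left n_def add.commute mult.assoc intro!: sum.cong)
    qed
    finally show ?thesis .
  qed (simp add: conv_def)
qed

lemma conv_unit [simp]: "conv unit y = nf y" "conv y unit = nf y"
proof -
  have "conv unit y (v, as) = nf y (v, as)" for v as
  proof (cases "nonzero v as")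
    case True
    have "(\<Sum>i\<le>length as. unit (v, take i as) * y (path_target v (take i as), drop i as))
        = (\<Sum>i\<le>length as. if i = 0 then y (v, as) else 0)"
      using True by (intro sum.cong) (auto simp: unit_def nonzero_def)
    then show ?thesis using True by (simp add: conv_def nf_def)
  qed (simp add: conv_def nf_def)
  moreover have "conv y unit (v, as) = nf y (v, as)" for v as
  proof (cases "nonzero v as")
    case True
    have "(\<Sum>i\<le>length as. y (v, take i as) * unit (path_target v (take i as), drop i as))
        = (\<Sum>i\<le>length as. if i = length as then y (v, as) else 0)"
      using True nonzero_target[OF True] by (intro sum.cong) (auto simp: unit_def)
    then show ?thesis using True by (simp add: conv_def nf_def)
  qed (simp add: conv_def nf_def)
  ultimately show "conv unit y = nf y" "conv y unit = nf y" by auto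
qed

lemma conv_path_left:
  "conv (emb (Path v as)) y (w, cs) =
    (if nonzero w cs \<and> w = v \<and> take (length as) cs = as then y (path_target v as, drop (length as) cs) else 0)"
proof (cases "nonzero w cs")
  case True
  have "conv (emb (Path v as)) y (w, cs) = (\<Sum>i\<le>length cs. if i = length as \<and> w = v \<and> take i cs = as
     then y (path_target v as, drop i cs) else 0)"
    using True by (auto simp: conv_def nf_def path_elt_def nonzero_take_drop intro!: sum.cong)
  also have "\<dots> = (\<Sum>i\<le>length cs. if i = length as then if w = v \<and> take (length as) cs = as
     then y (path_target v as, drop (length as) cs) else 0 else 0)"
    by (intro sum.cong) auto
  finally show ?thesis using True by (auto simp: sum.delta)
qed (simp add: conv_def)

lemma conv_path_right:
  "conv y (emb (Path v as)) (w, bs @ as) = (if nonzero w (bs @ as) \<and> path_target w bs = v then y (w, bs) else 0)"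
proof (cases "nonzero w (bs @ as)")
  case True
  have "conv y (emb (Path v as)) (w, bs @ as) = (\<Sum>i\<le>length (bs @ as). if i = length bs
     then if path_target w bs = v then y (w, bs) else 0 else 0)"
    unfolding conv_def using True nonzero_take_drop[OF True]
  proof (simp only: split if_True, intro sum.cong refl)
    fix i assume i: "i \<in> {..length (bs @ as)}"
    have "drop i (bs @ as) = as \<longleftrightarrow> i = length bs"
    proof
      assume "drop i (bs @ as) = as"
      then have "length (drop i (bs @ as)) = length as" by simp
      then show "i = length bs" using i by simp
    qed simp
    then show "y (w, take i (bs @ as)) * emb (Path v as) (path_target w (take i (bs @ as)), drop i (bs @ as)) =
         (if i = length bs then if path_target w bs = v then y (w, bs) else 0 else 0)"
      using nonzero_take_drop[OF True, of i] by (auto simp: nf_def path_elt_def)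
  qed
  then show ?thesis using True by (simp add: sum.delta)
qed (simp add: conv_def)

lemma conv_path_right_0:
  assumes "\<nexists>bs. cs = bs @ as"
  shows "conv y (emb (Path v as)) (w, cs) = 0"
proof -
  have "drop i cs \<noteq> as" for i using assms by (metis append_take_drop_id)
  then show ?thesis by (auto simp: conv_def nf_def path_elt_def intro!: sum.neutral)
qed

lemma nf_0 [simp]: "nf 0 = 0" and nf_unit [simp]: "nf unit = unit"
  by (auto simp: nf_def unit_def fun_eq_iff)

lemma nf_emb [simp]: "nf (emb x) = emb x"
  by (cases x) simp_all

lemma emb_mon_mult: "(emb (mon_mult x y) :: ('v,'a,'k::field) pelt) = conv (emb x) (emb y)"
proof -
  have *: "emb (mon_mult (Path v as) (Path w bs)) = conv (emb (Path v as)) (emb (Path w bs) :: ('v,'a,'k) pelt)" for v w as bs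
  proof (rule ext, clarify)
    fix u cs
    show "emb (mon_mult (Path v as) (Path w bs)) (u, cs) = conv (emb (Path v as)) (emb (Path w bs) :: ('v,'a,'k) pelt) (u, cs)"
    proof (cases "take (length as) cs = as")
      case True
      then obtain ds where "cs = as @ ds" by (metis append_take_drop_id)
      then show ?thesis unfolding conv_path_left by (auto simp: nf_def path_elt_def nonzero_append)
    next
      case False
      then show ?thesis unfolding conv_path_left by (auto simp: nf_def path_elt_def)
    qed
  qed
  show ?thesis
  proof (cases "\<exists>v as w bs. x = Path v as \<and> y = Path w bs")
    case True
    then show ?thesis using * by blast
  next
    case False
    then show ?thesis by (cases x; cases y) (auto simp del: emb.simps(3))
  qed
qed

text \<open>\<open>One\<close> is treated apart because \<open>conv y unit\<close> is
  \<open>nf y\<close>, whereas \<open>bar\<close> asks for a unit that acts as the identity on all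
  functions.\<close>

definition act :: "('v,'a,'k::field) pelt \<Rightarrow> ('v, 'a) mon \<Rightarrow> ('v,'a,'k) pelt" where
  "act y x = (if x = One then y else conv y (emb x))"

definition lact :: "('v, 'a) mon \<Rightarrow> ('v,'a,'k::field) pelt \<Rightarrow> ('v,'a,'k) pelt" where
  "lact x y = (if x = One then y else conv (emb x) y)"

lemma mon_mult_eq_One [simp]: "mon_mult x y = One \<longleftrightarrow> x = One \<and> y = One"
  by (cases x; cases y) auto

sublocale bar mon_mult One act lact
proof
qed (auto simp: mon_mult_assoc act_def lact_def emb_mon_mult conv_assoc conv_add_left conv_add_right)

lemma act_Zero [simp]: "act y Zero = 0" by (simp add: act_def)
lemma lact_Zero [simp]: "lact Zero y = 0" by (simp add: lact_def)

abbreviation arr :: "'a \<Rightarrow> ('v, 'a) mon" where "arr c \<equiv> Path (s c) [c]"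

text \<open>The functions compatible with reading monoid elements in the algebra. Values at vertices
  are unrestricted, so this is not the usual normalised bar complex.\<close>

definition normalized :: "(('v, 'a) mon list \<Rightarrow> ('v,'a,'k::field) pelt) \<Rightarrow> bool" where
  "normalized F \<longleftrightarrow> (\<forall>zs. nf (F zs) = F zs \<and> (Zero \<in> set zs \<longrightarrow> F zs = 0))"

lemma normalized_Cons: "normalized F \<Longrightarrow> normalized (\<lambda>zs. F (a # zs))"
  by (simp add: normalized_def)

lemma normalized_pre:
  assumes "normalized F"
  shows "normalized (pr a F)"
  unfolding normalized_def
proof (intro allI conjI impI)
  show "nf (pr a F zs) = pr a F zs" for zs
    using assms by (cases zs) (auto simp: normalized_def act_def)
  show "pr a F zs = 0" if "Zero \<in> set zs" for zs
    using assms that by (cases zs) (auto simp: normalized_def)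
qed

lemma normalized_Zero: "normalized F \<Longrightarrow> F (Zero # zs) = 0"
  by (simp add: normalized_def)

section \<open>The projection of the bar complex onto the Koszul complex\<close>

text \<open>
  For \<open>n \<ge> 2\<close> the projection sends \<open>[x\<^sub>1|\<dots>|x\<^sub>n]\<close> to \<open>u [a\<^sub>1|\<dots>|a\<^sub>n] w\<close> if \<open>x\<^sub>1 = u a\<^sub>1\<close>, \<open>x\<^sub>i = a\<^sub>i\<close> for \<open>1 < i < n\<close>, \<open>x\<^sub>n = a\<^sub>n w\<close> with
  arrows \<open>a\<^sub>i\<close> whose consecutive products vanish, and to 0 otherwise; \<open>[x]\<close> goes to the sum of \<open>u [a] w\<close> over all
  factorisations \<open>x = u a w\<close>, and \<open>[]\<close> to the sum of the vertices.  In \<open>kproj_from\<close> the arrow \<open>c\<close> has just been split off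
  and \<open>ws\<close> is the rest of the path it came from.
\<close>

fun kproj_from :: "(('v, 'a) mon list \<Rightarrow> ('v,'a,'k::field) pelt) \<Rightarrow> 'a \<Rightarrow> 'a list \<Rightarrow> ('v, 'a) mon list \<Rightarrow> ('v,'a,'k) pelt" where
  "kproj_from F c ws [] = act (F [arr c]) (Path (t c) ws)"
| "kproj_from F c ws (x # xs) = (case x of
      Path v as \<Rightarrow> if ws = [] \<and> as \<noteq> [] \<and> nonzero v as \<and> v = t c \<and> \<not> nz c (hd as)
        then kproj_from (\<lambda>zs. F (arr c # zs)) (hd as) (tl as) xs else 0
    | _ \<Rightarrow> 0)"

fun kproj :: "(('v, 'a) mon list \<Rightarrow> ('v,'a,'k::field) pelt) \<Rightarrow> ('v, 'a) mon list \<Rightarrow> ('v,'a,'k) pelt" where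
  "kproj F [] = (\<Sum>v\<in>V. act (F [Path v []]) (Path v []))"
| "kproj F (x # xs) = (case x of
      Path v as \<Rightarrow> if nonzero v as
        then \<Sum>i<length as. kproj_from (\<lambda>zs. F (Path v (take i as) # zs)) (as ! i) (drop (Suc i) as) xs else 0
    | _ \<Rightarrow> 0)"

lemma kproj_from_diff: "kproj_from (\<lambda>zs. F zs - G zs) c ws xs = kproj_from F c ws xs - kproj_from G c ws xs"
  by (induction xs arbitrary: F G c ws) (auto simp: act_diff split: mon.split)

lemma kproj_from_lact: "kproj_from (\<lambda>zs. lact a (F zs)) c ws xs = lact a (kproj_from F c ws xs)"
  by (induction xs arbitrary: F c ws) (auto simp: lact_act split: mon.split)

lemma kproj_from_0: "(\<And>zs. F (arr c # zs) = 0) \<Longrightarrow> kproj_from F c ws xs = 0"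
  by (induction xs arbitrary: F c ws) (auto split: mon.split)

lemma kproj_diff: "kproj (\<lambda>zs. F zs - G zs) xs = kproj F xs - kproj G xs"
  by (cases xs) (auto simp: act_diff kproj_from_diff sum_subtractf split: mon.split)

lemma kproj_lact: "kproj (\<lambda>zs. lact a (F zs)) xs = lact a (kproj F xs)"
  by (cases xs) (auto simp: lact_act kproj_from_lact lact_sum split: mon.split)

text \<open>The contribution in which \<open>x\<close> is multiplied onto the remainder \<open>ws\<close>.\<close>

definition absorb :: "(('v, 'a) mon list \<Rightarrow> ('v,'a,'k::field) pelt) \<Rightarrow> 'a \<Rightarrow> 'a list \<Rightarrow> ('v, 'a) mon \<Rightarrow> ('v, 'a) mon list \<Rightarrow> ('v,'a,'k) pelt" where
  "absorb G c ws x xs = (case x of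
      Zero \<Rightarrow> 0
    | One \<Rightarrow> kproj_from G c ws xs
    | Path v as \<Rightarrow> if v = path_target (t c) ws \<and> nonzero (s c) (c # ws @ as) then kproj_from G c (ws @ as) xs else 0)"

text \<open>A remainder must be empty before every entry but the last, so the first summand is zero
  unless \<open>x\<close> is \<open>One\<close> or a vertex. If \<open>x\<close> contains an arrow,
  a nonzero product \<open>x y\<close> splits off the same first arrow and \<open>y\<close> lands on
  the remainder of \<open>x\<close>.\<close>

lemma kproj_from_mon_mult:
  assumes "nonzero (s c) (c # ws)"
  shows "kproj_from G c ws (mon_mult x y # ys) = absorb G c ws x (y # ys)
    + (case x of Path v as \<Rightarrow> if ws = [] \<and> as \<noteq> [] \<and> nonzero v as \<and> v = t c \<and> \<not> nz c (hd as)
        then absorb (\<lambda>zs. G (arr c # zs)) (hd as) (tl as) y ys else 0 | _ \<Rightarrow> 0)"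
proof (cases x)
  case x [simp]: (Path v as)
  show ?thesis
  proof (cases y)
    case y [simp]: (Path w cs)
    show ?thesis
    proof (cases as)
      case Nil
      have "kproj_from G c ws (mon_mult x y # ys) = (if v = path_target (t c) ws \<and> nonzero (s c) (c # ws) then kproj_from G c ws (Path w cs # ys) else 0)"
        using Nil assms by (cases ws) (auto simp: nonzero_Cons)
      then show ?thesis using Nil by (simp add: absorb_def)
    next
      case as [simp]: (Cons b bs)
      have 0: "absorb G c ws x (y # ys) = 0" by (simp add: absorb_def)
      show ?thesis
      proof (cases "ws = [] \<and> nonzero v as \<and> v = t c \<and> \<not> nz c b")
        case True
        then have "kproj_from G c ws (mon_mult x y # ys) = (if w = path_target (t b) bs \<and> nonzero v (as @ cs)
            then kproj_from (\<lambda>zs. G (arr c # zs)) b (bs @ cs) ys else 0)"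
          by simp
        moreover have "s b = v" using True by (simp add: nonzero_Cons)
        moreover have "nonzero (t c) (b # bs)" using True by auto
        ultimately show ?thesis using 0 True by (simp add: absorb_def)
      next
        case False
        have "nonzero v (as @ cs) \<Longrightarrow> nonzero v as" by (simp only: nonzero_append)
        then have "kproj_from G c ws (mon_mult x y # ys) = 0" using False by auto
        then show ?thesis using 0 False by auto
      qed
    qed
  next
    case One
    then show ?thesis by (cases as) (auto simp: absorb_def nonzero_Cons)
  next
    case Zero
    then show ?thesis by (simp add: absorb_def)
  qed 
next
  case One
  then show ?thesis by (simp add: absorb_def)
next
  case Zero
  then show ?thesis by (simp add: absorb_def)
qed

text \<open>Induction along the list. The product of the first two entries contributes two
  \<open>absorb\<close> terms; the second cancels against the one in the induction hypothesis, so
  only the one at the front remains.\<close>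

lemma kproj_from_chain:
  assumes "normalized G" "nonzero (s c) (c # ws)"
  shows "d (kproj_from G c ws) (x # xs) = absorb G c ws x xs - kproj_from (d G) c ws (x # xs)"
  using assms
proof (induction xs arbitrary: G c ws x)
  case Nil
  show ?case
  proof (cases x)
    case x [simp]: (Path v as)
    show ?thesis
    proof (cases "ws = [] \<and> as \<noteq> [] \<and> nonzero v as \<and> v = t c \<and> \<not> nz c (hd as)")
      case True
      then obtain b bs where b: "as = b # bs" "nonzero (t c) (b # bs)" "\<not> nz c b" "v = t c" "ws = []"
        by (cases as) auto
      have "mon_mult (arr c) (arr b) = Zero" using b by (auto simp: nonzero_Cons)
      then have "d G [arr c, arr b] = - act (G [arr c]) (arr b)"
        by (simp del: mon_mult.simps add: normalized_Zero[OF Nil.prems(1)])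
      moreover have "kproj_from (d G) c ws [x] = act (d G [arr c, arr b]) (Path (t b) bs)"
        using b by (simp del: bar_d.simps)
      moreover have "mon_mult (arr b) (Path (t b) bs) = x" using b by (auto simp: nonzero_Cons)
      ultimately have "kproj_from (d G) c ws [x] = - act (G [arr c]) x"
        by (simp only: act_minus act_mul)
      moreover have "mon_mult (Path (t c) ws) x = x" using b by (auto simp: nonzero_Cons)
      then have "d (kproj_from G c ws) [x] = act (G [arr c]) x"
        by (simp only: bar_d.simps pre.simps kproj_from.simps act_mul diff_zero)
      moreover have "absorb G c ws x [] = 0" using b by (auto simp: absorb_def nonzero_Cons)
      ultimately show ?thesis by (simp only: diff_0 minus_minus)
    next
      case False
      then have "kproj_from (d G) c ws [x] = 0" by auto
      moreover have "d (kproj_from G c ws) [x] = act (G [arr c]) (mon_mult (Path (t c) ws) x)"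
        by (simp add: act_mul)
      moreover have "\<dots> = absorb G c ws x []"
        using False Nil.prems(2) by (cases ws) (auto simp: absorb_def nonzero_Cons nonzero_append)
      ultimately show ?thesis by (metis diff_zero)
    qed
  qed (auto simp: absorb_def)
next
  case (Cons y ys)
  let ?S = "\<lambda>v as. ws = [] \<and> as \<noteq> [] \<and> nonzero v as \<and> v = t c \<and> \<not> nz c (hd as)"
  have 1: "d (kproj_from G c ws) (x # y # ys) = kproj_from G c ws (mon_mult x y # ys)
     - d (\<lambda>zs. kproj_from G c ws (x # zs)) (y # ys)"
    by simp
  show ?case
  proof (cases "\<exists>v as. x = Path v as \<and> ?S v as")
    case True
    then obtain b bs where x: "x = Path (t c) (b # bs)"
      and S: "ws = []" "nonzero (t c) (b # bs)" "\<not> nz c b"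
      by (metis list.exhaust list.sel(1))
    let ?G = "\<lambda>zs. G (arr c # zs)"
    have "d (kproj_from ?G b bs) (y # ys) = absorb ?G b bs y ys - kproj_from (d ?G) b bs (y # ys)"
      using Cons.prems S by (intro Cons.IH normalized_Cons) (auto simp: nonzero_Cons)
    moreover have "(\<lambda>zs. kproj_from G c ws (x # zs)) = kproj_from ?G b bs"
      using x S by auto
    \<comment> \<open>The face that multiplies \<open>c\<close> and \<open>b\<close> vanishes, their
      product being a relation; the sign comes from peeling off \<open>c\<close>.\<close>
    moreover have "kproj_from (d G) c ws (x # y # ys) = - kproj_from (d ?G) b bs (y # ys)"
    proof -
      have "kproj_from (d G) c ws (x # y # ys) = kproj_from (\<lambda>zs. pr (arr c) G zs - d ?G zs) b bs (y # ys)"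
        using x S by simp
      moreover have "kproj_from (pr (arr c) G) b bs (y # ys) = 0"
        using S Cons.prems(1) by (intro kproj_from_0) (auto simp: nonzero_Cons normalized_Zero[OF Cons.prems(1)])
      ultimately show ?thesis by (simp only: kproj_from_diff) simp
    qed
    moreover have "kproj_from G c ws (mon_mult x y # ys) = absorb G c ws x (y # ys) + absorb ?G b bs y ys"
      unfolding kproj_from_mon_mult[OF Cons.prems(2)] using x S by simp
    ultimately show ?thesis unfolding 1 by simp
  next
    case False
    then have z: "kproj_from G c ws (x # zs) = 0" "kproj_from (d G) c ws (x # zs) = 0" for zs
      by (cases x; auto)+
    have "d (\<lambda>zs. kproj_from G c ws (x # zs)) (y # ys) = 0" unfolding z by (rule d_0)
    moreover have "kproj_from G c ws (mon_mult x y # ys) = absorb G c ws x (y # ys)"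
      unfolding kproj_from_mon_mult[OF Cons.prems(2)] using False by (cases x) auto
    ultimately show ?thesis unfolding 1 z by (simp only: diff_zero)
  qed
qed

lemma conv_sum_right: "conv y (\<Sum>i\<in>X. e i) = (\<Sum>i\<in>X. conv y (e i))"
  using sum_comp_morphism[of "conv y" e X] by (simp add: conv_add_right o_def)

text \<open>The vertices are idempotents with sum 1.\<close>

lemma kproj_augment:
  assumes "nf (F []) = F []"
  shows "kproj (d F) [] = F []"
proof -
  have "act (act (F []) (Path v [])) (Path v []) = conv (F []) (emb (Path v []))" if "v \<in> V" for v
    using that by (simp add: act_mul) (simp add: act_def)
  then have "kproj (d F) [] = conv (F []) (\<Sum>v\<in>V. emb (Path v []))"
    by (simp add: conv_sum_right)
  also have "(\<Sum>v\<in>V. emb (Path v [])) = unit"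
  proof (rule ext, clarify)
    fix w as
    have "(\<Sum>v\<in>V. emb (Path v [])) (w, as) = (\<Sum>v\<in>V. emb (Path v []) (w, as))"
      by (rule sum_fun_apply)
    also have "\<dots> = (\<Sum>v\<in>V. if v = w then unit (w, as) else 0)"
      by (intro sum.cong) (auto simp: nf_def path_elt_def unit_def)
    finally have "(\<Sum>v\<in>V. emb (Path v [])) (w, as) = (\<Sum>v\<in>V. if v = w then unit (w, as) else 0)" .
    then show "(\<Sum>v\<in>V. emb (Path v [])) (w, as) = unit (w, as)"
      using finite_V by (auto simp: sum.delta unit_def)
  qed
  finally show ?thesis using assms by simp
qed

text \<open>The boundary of \<open>u [a] w\<close> is \<open>ua [] w\<close> minus
  \<open>u [] aw\<close>, so the sum over the arrows of a path telescopes to its two ends.\<close>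

lemma kproj_chain_single:
  assumes "normalized F"
  shows "kproj (d F) [x] = kproj (pr x F) [] - d (kproj F) [x]"
proof -
  have dk: "d (kproj F) [x] = (\<Sum>v\<in>V. act (F [Path v []]) (mon_mult (Path v []) x))"
    by (simp only: bar_d.simps pre.simps diff_zero kproj.simps act_sum act_mul)
  have pk: "kproj (pr x F) [] = (\<Sum>v\<in>V. act (F [mon_mult x (Path v [])]) (Path v []))" by simp
  note z = normalized_Zero[OF assms]
  show ?thesis
  proof (cases "\<exists>v as. x = Path v as \<and> nonzero v as")
    case True
    then obtain v as where x: "x = Path v as" and nonzero: "nonzero v as" by auto
    have vV: "v \<in> V" using nonzero by (simp add: nonzero_def)
    \<comment> \<open>\<open>T i\<close> belongs to the cut of the path at position
      \<open>i\<close>, with no arrow singled out.\<close>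
    define T where "T i = act (F [Path v (take i as)]) (Path (path_target v (take i as)) (drop i as))" for i
    have "kproj (d F) [x] = (\<Sum>i<length as. T (Suc i) - T i)"
    proof -
      have "act (d F [Path v (take i as), arr (as ! i)]) (Path (t (as ! i)) (drop (Suc i) as)) = T (Suc i) - T i"
        if i: "i < length as" for i
      proof -
        have dec: "as = take i as @ as ! i # drop (Suc i) as" using i by (simp add: id_take_nth_drop)
        have ts: "take (Suc i) as = take i as @ [as ! i]" using i by (simp add: take_Suc_conv_app_nth)
        have ds: "drop i as = as ! i # drop (Suc i) as" using i by (simp add: Cons_nth_drop_Suc)
        have B2: "nonzero (path_target v (take i as)) (as ! i # drop (Suc i) as)"
          using nonzero_take_drop(2)[OF nonzero, of i] ds by simp
        then have s: "s (as ! i) = path_target v (take i as)" by (simp add: nonzero_Cons)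
        have "nonzero v (take (Suc i) as)" by (rule nonzero_take_drop[OF nonzero])
        then have m1: "mon_mult (Path v (take i as)) (arr (as ! i)) = Path v (take (Suc i) as)" by (simp add: s ts)
        have m2: "mon_mult (arr (as ! i)) (Path (t (as ! i)) (drop (Suc i) as)) = Path (path_target v (take i as)) (drop i as)"
          using B2 by (simp add: s ds)
        have p: "path_target v (take (Suc i) as) = t (as ! i)" by (simp add: ts)
        have "d F [Path v (take i as), arr (as ! i)] = F [Path v (take (Suc i) as)] - act (F [Path v (take i as)]) (arr (as ! i))"
          by (simp only: bar_d.simps pre.simps m1 diff_zero)
        then show ?thesis unfolding T_def p by (simp only: act_diff act_mul m2)
      qed
      then show ?thesis using x nonzero by (simp del: bar_d.simps)
    qed
    also have "\<dots> = T (length as) - T 0" by (rule sum_lessThan_telescope)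
    also have "T (length as) = kproj (pr x F) []"
    proof -
      have "kproj (pr x F) [] = (\<Sum>w\<in>V. if w = path_target v as then T (length as) else 0)"
        unfolding pk using nonzero by (intro sum.cong refl) (auto simp: x z T_def)
      then show ?thesis using finite_V nonzero_target[OF nonzero] by (simp add: sum.delta)
    qed
    also have "T 0 = d (kproj F) [x]"
    proof -
      have "d (kproj F) [x] = (\<Sum>w\<in>V. if w = v then T 0 else 0)"
        unfolding dk using nonzero by (intro sum.cong refl) (auto simp: x T_def)
      then show ?thesis using finite_V vV by (simp add: sum.delta)
    qed
    finally show ?thesis .
  next
    case False
    then have "kproj (d F) [x] = 0" by (auto split: mon.split)
    moreover have "kproj (pr x F) [] - d (kproj F) [x] = 0"
      unfolding pk dk using False by (cases x) (auto simp: z intro!: sum.neutral)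
    ultimately show ?thesis by (simp only:)
  qed
qed

lemma absorb_0:
  assumes "x = Path v as" "v \<noteq> path_target (t c) ws \<or> \<not> nonzero (s c) (c # ws @ as)"
  shows "absorb G c ws x xs = 0"
  using assms by (auto simp: absorb_def)

lemma nonzero_split_at:
  assumes "nonzero v as" "i < length as"
  shows "nonzero (path_target v (take i as)) (as ! i # drop (Suc i) as)" "nonzero v (take (Suc i) as)"
    "s (as ! i) = path_target v (take i as)" "path_target (t (as ! i)) (drop (Suc i) as) = path_target v as"
    "take (Suc i) as = take i as @ [as ! i]"
proof -
  have ds: "drop i as = as ! i # drop (Suc i) as" using assms by (simp add: Cons_nth_drop_Suc)
  show *: "nonzero (path_target v (take i as)) (as ! i # drop (Suc i) as)"
    using nonzero_take_drop(2)[OF assms(1), of i] ds by simp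
  show "nonzero v (take (Suc i) as)" by (rule nonzero_take_drop[OF assms(1)])
  show "s (as ! i) = path_target v (take i as)" using * by (simp add: nonzero_Cons)
  show "path_target (t (as ! i)) (drop (Suc i) as) = path_target v as"
    by (metis append_take_drop_id ds path_target_Cons path_target_append)
  show "take (Suc i) as = take i as @ [as ! i]" using assms by (simp add: take_Suc_conv_app_nth)
qed

lemma kproj_0:
  assumes "\<And>v as. x = Path v as \<Longrightarrow> \<not> nonzero v as"
  shows "kproj F (x # xs) = 0"
  using assms by (cases x) auto

text \<open>Balances the faces at the junction of the first two entries. If their product is
  nonzero, its arrows are those of the first path, giving the \<open>absorb\<close> terms, and those
  of the second, giving the \<open>pre\<close> term. If the junction is a relation, only the last
  arrow of the first path on the right and the empty prefix of the second on the left survive, and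
  they agree.\<close>

lemma kproj_chain_two:
  fixes F :: "('v, 'a) mon list \<Rightarrow> ('v,'a,'k::field) pelt"
  assumes "normalized F" "nonzero v as"
  defines "u \<equiv> \<lambda>i. Path v (take i as)" and "ws \<equiv> \<lambda>i. drop (Suc i) as"
  shows "kproj (pr (Path v as) F) (y # ys) - kproj F (mon_mult (Path v as) y # ys)
      + (\<Sum>i<length as. absorb (\<lambda>zs. F (u i # zs)) (as ! i) (ws i) y ys)
    = (\<Sum>i<length as. kproj_from (pr (u i) F) (as ! i) (ws i) (y # ys))"
proof -
  let ?x = "Path v as"
  let ?a = "\<lambda>i. absorb (\<lambda>zs. F (u i # zs)) (as ! i) (ws i) y ys"
  let ?r = "\<lambda>i. kproj_from (pr (u i) F) (as ! i) (ws i) (y # ys)"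
  note z = normalized_Zero[OF assms(1)]
  have Fx: "kproj F (?x # ys) = (\<Sum>i<length as. kproj_from (\<lambda>zs. F (u i # zs)) (as ! i) (ws i) ys)"
    using assms by simp
  show ?thesis
  proof (cases y)
    case Zero
    then show ?thesis by (simp add: absorb_def)
  next
    case One
    then show ?thesis using Fx by (simp add: absorb_def)
  next
    case y: (Path w bs)
    have pre: "kproj (pr ?x F) (y # ys) = (if nonzero w bs
       then \<Sum>j<length bs. kproj_from (\<lambda>zs. F (mon_mult ?x (Path w (take j bs)) # zs)) (bs ! j) (drop (Suc j) bs) ys else 0)"
      using y by (simp del: mon_mult.simps)
    show ?thesis
    proof (cases "nonzero w bs \<and> w = path_target v as")
      case False
      have "kproj F (mon_mult ?x y # ys) = 0"
        using False y by (intro kproj_0) (auto simp: nonzero_append split: if_splits)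
      moreover have "kproj (pr ?x F) (y # ys) = 0"
        unfolding pre using False by (auto simp: z intro!: sum.neutral kproj_from_0)
      moreover have "?a i = 0" if "i < length as" for i
        using False y nonzero_split_at[OF assms(2) that] unfolding ws_def
        by (intro absorb_0[OF y]) (auto simp: nonzero_append nonzero_Cons)
      moreover have "?r i = 0" if "i < length as" for i
      proof (cases "ws i = [] \<and> nonzero w bs \<and> w = t (as ! i)")
        case True
        then have "w = path_target v as" using nonzero_split_at(4)[OF assms(2) that] by (simp add: ws_def)
        then show ?thesis using False True by blast
      next
        case False
        then show ?thesis using y by auto
      qed
      ultimately show ?thesis by simp
    next
      case True
      then have Bw: "nonzero w bs" and w: "w = path_target v as" by auto
      show ?thesis
      proof (cases "nonzero v (as @ bs)")
        case Bv: True
        have "kproj F (mon_mult ?x y # ys) = (\<Sum>i<length as + length bs. kproj_from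
            (\<lambda>zs. F (Path v (take i (as @ bs)) # zs)) ((as @ bs) ! i) (drop (Suc i) (as @ bs)) ys)"
          using y w Bv by simp
        also have "\<dots> = (\<Sum>i<length as. ?a i) + kproj (pr ?x F) (y # ys)"
          unfolding sum_split_add
        proof (intro arg_cong2[where f = "(+)"])
          show "(\<Sum>i<length as. kproj_from (\<lambda>zs. F (Path v (take i (as @ bs)) # zs)) ((as @ bs) ! i)
              (drop (Suc i) (as @ bs)) ys) = (\<Sum>i<length as. ?a i)"
          proof (intro sum.cong refl)
            fix i assume "i \<in> {..<length as}"
            then have i: "i < length as" by simp
            have "as @ bs = take i as @ as ! i # drop (Suc i) as @ bs"
              using i by (metis append.assoc append_Cons id_take_nth_drop)
            then have "nonzero (s (as ! i)) (as ! i # ws i @ bs)"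
              using Bv nonzero_split_at(3)[OF assms(2) i] unfolding ws_def by (metis nonzero_append)
            moreover have "w = path_target (t (as ! i)) (ws i)"
              unfolding ws_def w nonzero_split_at(4)[OF assms(2) i] ..
            ultimately show "kproj_from (\<lambda>zs. F (Path v (take i (as @ bs)) # zs)) ((as @ bs) ! i)
               (drop (Suc i) (as @ bs)) ys = ?a i"
              using i y by (simp add: absorb_def u_def ws_def nth_append)
          qed
          have "mon_mult ?x (Path w (take j bs)) = Path v (as @ take j bs)" for j
          proof -
            have "nonzero v (as @ take j bs)"
              using Bv nonzero_take_drop(1)[OF Bv, of "length as + j"] by simp
            then show ?thesis using w by simp
          qed
          then show "(\<Sum>j<length bs. kproj_from (\<lambda>zs. F (Path v (take (length as + j) (as @ bs)) # zs))
            ((as @ bs) ! (length as + j)) (drop (Suc (length as + j)) (as @ bs)) ys) = kproj (pr ?x F) (y # ys)"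
            unfolding pre using Bw by (simp add: nth_append)
        qed
        finally have 1: "kproj F (mon_mult ?x y # ys) = (\<Sum>i<length as. ?a i) + kproj (pr ?x F) (y # ys)" .
        have 2: "?r i = 0" if "i < length as" for i
        proof (cases "ws i = [] \<and> bs \<noteq> []")
          case True
          then have "as ! i = last as" using that by (cases as rule: rev_cases) (auto simp: ws_def nth_append)
          then show ?thesis using True Bv y that by (auto simp: nonzero_append)
        next
          case False
          then show ?thesis using y by auto
        qed
        have "(\<Sum>i<length as. ?r i) = 0"
          by (rule sum.neutral, rule ballI, rule 2) simp
        then show ?thesis unfolding 1 by (simp only: algebra_simps add_0_left)
      next
        case Bv: False
        then have ne: "as \<noteq> []" "bs \<noteq> []" and nnz: "\<not> nz (last as) (hd bs)"
          using Bw assms(2) w by (auto simp: nonzero_append)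
        obtain b bs' where bs: "bs = b # bs'" using ne by (cases bs) auto
        obtain n where n: "length as = Suc n" using ne by (cases as) auto
        have an: "as ! n = last as" "drop (Suc n) as = []" using n ne by (auto simp: last_conv_nth)
        have 1: "kproj F (mon_mult ?x y # ys) = 0"
          using Bv y by (intro kproj_0) auto
        have 2: "?a i = 0" if i: "i < length as" for i
        proof (rule absorb_0[OF y])
          have "last (as ! i # ws i) = last as"
            using i by (metis Cons_nth_drop_Suc drop_eq_Nil last_drop not_le ws_def)
          then have "\<not> nonzero (s (as ! i)) ((as ! i # ws i) @ bs)"
            using nnz ne by (simp only: nonzero_append) simp
          then show "w \<noteq> path_target (t (as ! i)) (ws i) \<or> \<not> nonzero (s (as ! i)) (as ! i # ws i @ bs)" by simp
        qed
        have xn: "mon_mult (Path v (take n as)) (arr (as ! n)) = ?x"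
        proof -
          have n': "n < length as" using n by simp
          show ?thesis using nonzero_split_at(2,3,5)[OF assms(2) n'] n by simp
        qed
        have 3: "?r n = kproj_from (\<lambda>zs. F (?x # zs)) b bs' ys"
        proof -
          have "t (as ! n) = w" using w ne an by (simp add: path_target_def)
          then have "?r n = kproj_from (\<lambda>zs. F (mon_mult (u n) (arr (as ! n)) # zs)) b bs' ys"
            using y bs Bw nnz an by (simp add: ws_def del: mon_mult.simps)
          then show ?thesis unfolding u_def xn .
        qed
        have 4: "?r i = 0" if "i < n" for i
          using that n y by (simp add: ws_def)
        have 5: "kproj (pr ?x F) (y # ys) = kproj_from (\<lambda>zs. F (?x # zs)) b bs' ys"
        proof -
          have m: "mon_mult ?x (Path w (take (Suc j) bs)) = Zero" for j
          proof -
            have "\<not> nonzero v (as @ take (Suc j) bs)" using ne nnz bs by (auto simp: nonzero_append)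
            then show ?thesis by simp
          qed
          have m0: "mon_mult ?x (Path w (take 0 bs)) = ?x" using w assms(2) by simp
          have "kproj (pr ?x F) (y # ys) = (\<Sum>j<Suc (length bs'). kproj_from (\<lambda>zs. F (mon_mult ?x (Path w (take j bs)) # zs)) (bs ! j) (drop (Suc j) bs) ys)"
            unfolding pre using Bw bs by (simp del: mon_mult.simps sum.lessThan_Suc)
          also have "\<dots> = kproj_from (\<lambda>zs. F (?x # zs)) b bs' ys"
            unfolding sum.lessThan_Suc_shift m m0 z by (simp add: bs kproj_from_0)
          finally show ?thesis .
        qed
        show ?thesis unfolding 1 5 using 2 3 4 by (simp add: n)
      qed
    qed
  qed
qed

text \<open>For each arrow split off from the head, \<open>kproj_from_chain\<close> settles the
  later junctions and \<open>kproj_chain_two\<close> the first one.\<close>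

lemma kproj_chain:
  assumes "normalized F"
  shows "kproj (d F) (x # xs) = kproj (pr x F) xs - d (kproj F) (x # xs)"
proof (cases xs)
  case Nil
  then show ?thesis using kproj_chain_single[OF assms] by simp
next
  case (Cons y ys)
  have e: "d (kproj F) (x # y # ys) = kproj F (mon_mult x y # ys) - d (\<lambda>zs. kproj F (x # zs)) (y # ys)"
    by (simp only: bar_d.simps pre.simps)
  show ?thesis
  proof (cases "\<exists>v as. x = Path v as \<and> nonzero v as")
    case True
    then obtain v as where x: "x = Path v as" and nonzero: "nonzero v as" by auto
    define u where "u i = Path v (take i as)" for i
    define ws where "ws i = drop (Suc i) as" for i
    have 1: "d (\<lambda>zs. kproj F (x # zs)) (y # ys)
      = (\<Sum>i<length as. absorb (\<lambda>zs. F (u i # zs)) (as ! i) (ws i) y ys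
          - kproj_from (d (\<lambda>zs. F (u i # zs))) (as ! i) (ws i) (y # ys))"
    proof -
      have k: "(\<lambda>zs. kproj F (x # zs)) = (\<lambda>zs. \<Sum>i<length as. kproj_from (\<lambda>zs. F (u i # zs)) (as ! i) (ws i) zs)"
        using x nonzero by (simp add: u_def ws_def)
      show ?thesis unfolding k d_sum
      proof (intro sum.cong refl kproj_from_chain normalized_Cons assms)
        fix i assume "i \<in> {..<length as}"
        then show "nonzero (s (as ! i)) (as ! i # ws i)" using nonzero_split_at[OF nonzero, of i] by (simp add: ws_def)
      qed
    qed
    have 2: "kproj (d F) (x # y # ys) = (\<Sum>i<length as. kproj_from (pr (u i) F) (as ! i) (ws i) (y # ys)
          - kproj_from (d (\<lambda>zs. F (u i # zs))) (as ! i) (ws i) (y # ys))"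
    proof -
      have "kproj (d F) (x # y # ys) = (\<Sum>i<length as. kproj_from (\<lambda>zs. d F (u i # zs)) (as ! i) (ws i) (y # ys))"
        using x nonzero by (simp add: u_def ws_def del: bar_d.simps kproj_from.simps)
      then show ?thesis by (simp only: bar_d.simps kproj_from_diff)
    qed
    show ?thesis
      using kproj_chain_two[OF assms nonzero, of y ys, folded x u_def ws_def]
      unfolding Cons e 1 2 sum_subtractf by (simp only: algebra_simps)
  next
    case False
    then have k: "kproj G (x # zs) = 0" for G :: "('v, 'a) mon list \<Rightarrow> ('v,'a,'b) pelt" and zs
      by (intro kproj_0) auto
    have "d (\<lambda>zs. kproj F (x # zs)) (y # ys) = 0" unfolding k by (rule d_0)
    \<comment> \<open>Here \<open>x\<close> is \<open>One\<close> or stands for zero; in the latter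
      case both sides vanish.\<close>
    moreover have "kproj (pr x F) (y # ys) = kproj F (mon_mult x y # ys)"
    proof (cases x)
      case One
      then show ?thesis by (simp only: pre_one mon_mult.simps)
    next
      case Zero
      note z = normalized_Zero[OF assms]
      have "kproj (pr x F) (y # ys) = 0" unfolding Zero by (cases y) (auto simp: z intro!: sum.neutral kproj_from_0)
      then show ?thesis using Zero by simp
    next
      case (Path v as)
      note z = normalized_Zero[OF assms]
      have "\<not> nonzero v as" "\<not> nonzero v (as @ bs)" for bs using False Path by (simp_all add: nonzero_append)
      then have "kproj (pr x F) (y # ys) = 0 \<and> kproj F (mon_mult x y # ys) = 0"
        unfolding Path by (cases y) (auto simp: z intro!: sum.neutral kproj_from_0)
      then show ?thesis by (simp only:)
    qed
    ultimately show ?thesis unfolding Cons e k by simp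
  qed
qed

sublocale bar_endo mon_mult One act lact normalized kproj
proof
  show "kproj (d F) [] = F []" if "normalized F" for F :: "('v, 'a) mon list \<Rightarrow> ('v,'a,'k::field) pelt"
    using that by (intro kproj_augment) (simp add: normalized_def)
qed (fact kproj_diff kproj_lact normalized_Cons normalized_pre kproj_chain)+

section \<open>Primitives of Koszul cochains\<close>

definition koszul :: "'a list \<Rightarrow> bool" where
  "koszul \<epsilon> \<longleftrightarrow> set \<epsilon> \<subseteq> Ar \<and> successively (\<lambda>a b. t a = s b \<and> \<not> nz a b) \<epsilon>"

lemma koszul_Nil [simp]: "koszul []" by (simp add: koszul_def)

lemma koszul_Cons: "koszul (a # \<epsilon>) \<longleftrightarrow> a \<in> Ar \<and> koszul \<epsilon> \<and> (\<epsilon> \<noteq> [] \<longrightarrow> t a = s (hd \<epsilon>) \<and> \<not> nz a (hd \<epsilon>))"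
  by (cases \<epsilon>) (auto simp: koszul_def)

lemma koszul_append: "koszul (\<epsilon> @ \<delta>) \<longleftrightarrow> koszul \<epsilon> \<and> koszul \<delta> \<and> (\<epsilon> \<noteq> [] \<longrightarrow> \<delta> \<noteq> [] \<longrightarrow> t (last \<epsilon>) = s (hd \<delta>) \<and> \<not> nz (last \<epsilon>) (hd \<delta>))"
  by (auto simp: koszul_def successively_append_iff)

text \<open>Every inner face has an entry \<open>Zero\<close>, where a normalised function vanishes;
  only the right action of the last entry is left.\<close>

lemma d_zero_products:
  assumes "normalized F" "successively (\<lambda>x y. mon_mult x y = Zero) (xs @ [x])"
  shows "d F (xs @ [x]) = alternate (length xs) (act (F xs) x)"
  using assms
proof (induction xs arbitrary: F)
  case Nil
  show ?case by simp
next
  case (Cons y ys)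
  obtain z zs where e: "ys @ [x] = z # zs" by (cases "ys @ [x]") auto
  have "mon_mult y z = Zero" using Cons.prems(2) e by simp
  then have "pr y F (ys @ [x]) = 0" using e normalized_Zero[OF Cons.prems(1)] by simp
  moreover have "d (\<lambda>zs. F (y # zs)) (ys @ [x]) = alternate (length ys) (act (F (y # ys)) x)"
    using Cons.prems e by (intro Cons.IH normalized_Cons) auto
  ultimately show ?case by (simp only: append_Cons bar_d.simps diff_0 list.size alternate_simps add_Suc_right add_0_right)
qed

lemma mon_mult_arr_Zero: "\<not> nz a b \<Longrightarrow> mon_mult (arr a) (arr b) = Zero"
  by (simp add: nonzero_Cons)

lemma koszul_zero_products: "koszul \<epsilon> \<Longrightarrow> successively (\<lambda>x y. mon_mult x y = Zero) (map arr \<epsilon>)"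
  unfolding koszul_def successively_map by (elim conjE, erule successively_mono) (intro mon_mult_arr_Zero, simp)

lemma lact_arr: "lact (arr a) y (v, c # cs) = (if nonzero v (c # cs) \<and> c = a then y (t a, cs) else 0)"
  and lact_arr_Nil: "lact (arr a) y (v, []) = 0"
proof -
  have e: "lact (arr a) y = conv (emb (arr a)) y" by (simp only: lact_def mon.distinct if_False)
  have "nonzero v (c # cs) \<Longrightarrow> v = s c" by (simp only: nonzero_Cons)
  then show "lact (arr a) y (v, c # cs) = (if nonzero v (c # cs) \<and> c = a then y (t a, cs) else 0)"
    unfolding e conv_path_left by auto
  show "lact (arr a) y (v, []) = 0"
    unfolding e conv_path_left by simp
qed

lemma act_arr: "act y (arr a) (v, bs @ [b]) = (if nonzero v (bs @ [b]) \<and> b = a then y (v, bs) else 0)"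
  and act_arr_Nil: "act y (arr a) (v, []) = 0"
proof -
  have e: "act y (arr a) = conv y (emb (arr a))" by (simp only: act_def mon.distinct if_False)
  show "act y (arr a) (v, bs @ [b]) = (if nonzero v (bs @ [b]) \<and> b = a then y (v, bs) else 0)"
  proof (cases "b = a")
    case True
    have "nonzero v (bs @ [b]) \<Longrightarrow> path_target v bs = s b" by (simp only: nonzero_append nonzero_Cons)
    then show ?thesis unfolding e True conv_path_right using True by auto
  next
    case False
    then have "conv y (emb (arr a)) (v, bs @ [b]) = 0" by (intro conv_path_right_0) auto
    then show ?thesis unfolding e using False by simp
  qed
  show "act y (arr a) (v, []) = 0" unfolding e by (rule conv_path_right_0) simp
qed

text \<open>All inner faces vanish on a Koszul word. Multiplication by an arrow shifts coefficients,
  so the one at \<open>rs\<close> comes from the shortened path, provided \<open>rs\<close> has that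
  arrow at the corresponding end.\<close>

lemma hoch_koszul:
  assumes "normalized F" "koszul \<epsilon>" "\<epsilon> \<noteq> []" "rs \<noteq> []" "nonzero v rs"
  shows "hoch F (map arr \<epsilon>) (v, rs)
    = (if hd rs = hd \<epsilon> then F (map arr (tl \<epsilon>)) (t (hd \<epsilon>), tl rs) else 0)
      + alternate (length \<epsilon>) (if last rs = last \<epsilon> then F (map arr (butlast \<epsilon>)) (v, butlast rs) else 0)"
proof -
  have e: "map arr \<epsilon> = arr (hd \<epsilon>) # map arr (tl \<epsilon>)" using assms by (cases \<epsilon>) auto
  have f: "map arr \<epsilon> = map arr (butlast \<epsilon>) @ [arr (last \<epsilon>)]" using assms by (cases \<epsilon> rule: rev_cases) auto
  have "d F (map arr \<epsilon>) = alternate (length (map arr (butlast \<epsilon>))) (act (F (map arr (butlast \<epsilon>))) (arr (last \<epsilon>)))"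
    using d_zero_products[OF assms(1), of "map arr (butlast \<epsilon>)" "arr (last \<epsilon>)"]
      koszul_zero_products[OF assms(2)] unfolding f[symmetric] by simp
  moreover have "length \<epsilon> = Suc (length (map arr (butlast \<epsilon>)))" using assms(3) by simp
  ultimately have "d F (map arr \<epsilon>) = - alternate (length \<epsilon>) (act (F (map arr (butlast \<epsilon>))) (arr (last \<epsilon>)))"
    by (simp only: alternate_simps minus_minus)
  then have "hoch F (map arr \<epsilon>) = lact (arr (hd \<epsilon>)) (F (map arr (tl \<epsilon>)))
      + alternate (length \<epsilon>) (act (F (map arr (butlast \<epsilon>))) (arr (last \<epsilon>)))"
    using hoch.simps(2)[of F "arr (hd \<epsilon>)" "map arr (tl \<epsilon>)"] unfolding e[symmetric]
    by (simp only: diff_minus_eq_add)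
  moreover have "lact (arr (hd \<epsilon>)) y (v, rs) = (if hd rs = hd \<epsilon> then y (t (hd \<epsilon>), tl rs) else 0)" for y :: "('v,'a,'b) pelt"
    using assms(4,5) by (cases rs) (simp_all add: lact_arr lact_arr_Nil)
  moreover have "act y (arr (last \<epsilon>)) (v, rs) = (if last rs = last \<epsilon> then y (v, butlast rs) else 0)" for y :: "('v,'a,'b) pelt"
    using assms(4,5) by (cases rs rule: rev_cases) (simp_all add: act_arr act_arr_Nil)
  ultimately show ?thesis by (simp add: alternate_apply)
qed

end

section \<open>The string condition and parallel pairs\<close>

locale string_quiver = mono_quiver V Ar s t nz
  for V :: "'v set" and Ar :: "'a set" and s t :: "'a \<Rightarrow> 'v" and nz :: "'a \<Rightarrow> 'a \<Rightarrow> bool" +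
  assumes acyclic: "set as \<subseteq> Ar \<Longrightarrow> as \<noteq> [] \<Longrightarrow> successively (\<lambda>a b. t a = s b) as \<Longrightarrow> t (last as) \<noteq> s (hd as)"
    and unique_right: "a \<in> Ar \<Longrightarrow> b \<in> Ar \<Longrightarrow> c \<in> Ar \<Longrightarrow> t a = s b \<Longrightarrow> t a = s c \<Longrightarrow> nz a b \<Longrightarrow> nz a c \<Longrightarrow> b = c"
    and unique_left: "a \<in> Ar \<Longrightarrow> b \<in> Ar \<Longrightarrow> c \<in> Ar \<Longrightarrow> t b = s a \<Longrightarrow> t c = s a \<Longrightarrow> nz b a \<Longrightarrow> nz c a \<Longrightarrow> b = c"
begin

lemma koszul_acyclic: "koszul \<epsilon> \<Longrightarrow> \<epsilon> \<noteq> [] \<Longrightarrow> t (last \<epsilon>) \<noteq> s (hd \<epsilon>)"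
  using successively_mono[of "\<lambda>a b. t a = s b \<and> \<not> nz a b" \<epsilon> "\<lambda>a b. t a = s b"]
  unfolding koszul_def by (intro acyclic) auto

text \<open>These pairs index the standard basis of the Koszul cochain complex: one Koszul word is
  sent to one nonzero path, all other words to 0.\<close>

definition parallel :: "'a list \<Rightarrow> 'v \<Rightarrow> 'a list \<Rightarrow> bool" where
  "parallel \<epsilon> v rs \<longleftrightarrow> koszul \<epsilon> \<and> \<epsilon> \<noteq> [] \<and> nonzero v rs \<and> v = s (hd \<epsilon>) \<and> path_target v rs = t (last \<epsilon>)"

lemma parallel_nonempty: "parallel \<epsilon> v rs \<Longrightarrow> rs \<noteq> []"
  using koszul_acyclic[of \<epsilon>] by (auto simp: parallel_def)

text \<open>After a common first arrow the next ones must differ, since the product with the next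
  arrow is nonzero in \<open>rs\<close> and zero in the Koszul word. Hence at most one arrow can be
  stripped at this end.\<close>

lemma parallel_tl:
  assumes "parallel (a # \<epsilon>) v (a # rs)" "\<epsilon> \<noteq> []"
  shows "parallel \<epsilon> (t a) rs" "rs \<noteq> []" "hd rs \<noteq> hd \<epsilon>"
proof -
  show *: "parallel \<epsilon> (t a) rs" using assms by (auto simp: parallel_def koszul_Cons nonzero_Cons)
  then show "rs \<noteq> []" by (rule parallel_nonempty)
  then show "hd rs \<noteq> hd \<epsilon>" using assms by (auto simp: parallel_def koszul_Cons nonzero_Cons)
qed

lemma parallel_butlast:
  assumes "parallel (\<epsilon> @ [a]) v (rs @ [a])" "\<epsilon> \<noteq> []"
  shows "parallel \<epsilon> v rs" "rs \<noteq> []" "nz (last rs) a" "\<not> nz (last \<epsilon>) a" "t (last rs) = s a" "a \<in> Ar"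
proof -
  show *: "parallel \<epsilon> v rs" using assms by (auto simp: parallel_def koszul_append koszul_Cons nonzero_append nonzero_Cons)
  then show ne: "rs \<noteq> []" by (rule parallel_nonempty)
  show "nz (last rs) a" "\<not> nz (last \<epsilon>) a" "t (last rs) = s a" "a \<in> Ar"
    using assms ne by (auto simp: parallel_def koszul_append koszul_Cons nonzero_append nonzero_Cons path_target_def)
qed

context
  fixes N :: nat and z :: "('v, 'a) mon list \<Rightarrow> ('v,'a,'k::field) pelt"
begin

text \<open>The arrows that prolong a parallel pair to a parallel pair; composability with
  \<epsilon> follows from the common target.\<close>

definition ext_right :: "'a list \<Rightarrow> 'a list \<Rightarrow> 'a \<Rightarrow> bool" where
  "ext_right \<epsilon> rs b \<longleftrightarrow> b \<in> Ar \<and> t (last rs) = s b \<and> nz (last rs) b \<and> \<not> nz (last \<epsilon>) b"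

definition ext_left :: "'a list \<Rightarrow> 'a list \<Rightarrow> 'a \<Rightarrow> bool" where
  "ext_left \<epsilon> rs a \<longleftrightarrow> a \<in> Ar \<and> t a = s (hd rs) \<and> nz a (hd rs) \<and> \<not> nz a (hd \<epsilon>)"

text \<open>
  A primitive of \<open>z\<close> at a pair \<open>(\<epsilon>, rs)\<close> with different first arrows is read off at the extension by an arrow on the
  right if there is one, and otherwise at the extension on the left.  Assigning 0 to pairs with equal first arrows
  avoids counting \<open>z\<close> twice at pairs that share both end arrows.
\<close>

definition primitive_coeff :: "'a list \<Rightarrow> 'v \<Rightarrow> 'a list \<Rightarrow> 'k" where
  "primitive_coeff \<epsilon> v rs =
    (if \<not> parallel \<epsilon> v rs \<or> hd rs = hd \<epsilon> then 0
     else if \<exists>b. ext_right \<epsilon> rs b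
       then let b = SOME b. ext_right \<epsilon> rs b in alternate N (z (map arr (\<epsilon> @ [b])) (v, rs @ [b]))
     else if \<exists>a. ext_left \<epsilon> rs a
       then let a = SOME a. ext_left \<epsilon> rs a in z (map arr (a # \<epsilon>)) (s a, a # rs)
     else 0)"

definition primitive :: "('v, 'a) mon list \<Rightarrow> ('v,'a,'k) pelt" where
  "primitive xs = (if \<exists>\<epsilon>. Suc (length \<epsilon>) = N \<and> xs = map arr \<epsilon>
     then (\<lambda>(v, rs). primitive_coeff (THE \<epsilon>. xs = map arr \<epsilon>) v rs) else 0)"

lemma primitive_arr: "Suc (length \<epsilon>) = N \<Longrightarrow> primitive (map arr \<epsilon>) (v, rs) = primitive_coeff \<epsilon> v rs"
proof -
  assume l: "Suc (length \<epsilon>) = N"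
  have "inj (map arr)" by (rule inj_mapI) (auto intro: injI)
  then have "(THE \<epsilon>'. map arr \<epsilon> = map arr \<epsilon>') = \<epsilon>"
    by (intro the_equality) (auto dest: injD)
  then show ?thesis using l by (auto simp: primitive_def)
qed

lemma normalized_primitive: "normalized primitive"
  unfolding normalized_def
proof (intro allI conjI impI)
  fix zs
  have "primitive_coeff \<epsilon> v rs = 0" if "\<not> nonzero v rs" for \<epsilon> v rs
    using that by (simp add: primitive_coeff_def parallel_def)
  then have "primitive zs (v, rs) = 0" if "\<not> nonzero v rs" for v rs
    using that by (simp add: primitive_def)
  then show "nf (primitive zs) = primitive zs" unfolding nf_def fun_eq_iff by auto
  show "primitive zs = 0" if "Zero \<in> set zs" using that by (auto simp: primitive_def)
qed

text \<open>The string condition leaves a single candidate, so the choice made in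
  \<open>primitive_coeff\<close> is forced.\<close>

lemma some_ext_right: "ext_right \<epsilon> rs b \<Longrightarrow> last rs \<in> Ar \<Longrightarrow> (SOME b. ext_right \<epsilon> rs b) = b"
  by (intro some_equality) (auto simp: ext_right_def intro: unique_right)

lemma some_ext_left: "ext_left \<epsilon> rs a \<Longrightarrow> hd rs \<in> Ar \<Longrightarrow> (SOME a. ext_left \<epsilon> rs a) = a"
  by (intro some_equality) (auto simp: ext_left_def intro: unique_left)

text \<open>\<open>hoch_koszul\<close> leaves the pairs obtained by stripping a common end arrow.
  With no common arrow both sides are 0 by \<open>core\<close>; with a common last arrow only, the
  right extension returns \<open>z\<close>. With a common first arrow the left term alone counts,
  and it is \<open>z\<close> by definition or by the cocycle equation.\<close>

lemma koszul_primitive: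
  assumes "normalized z" and N: "N \<ge> 2"
    and cocycle: "\<And>\<epsilon>. koszul \<epsilon> \<Longrightarrow> length \<epsilon> = Suc N \<Longrightarrow> hoch z (map arr \<epsilon>) = 0"
    and core: "\<And>\<epsilon> v rs. parallel \<epsilon> v rs \<Longrightarrow> length \<epsilon> = N \<Longrightarrow> hd rs \<noteq> hd \<epsilon> \<Longrightarrow> last rs \<noteq> last \<epsilon>
        \<Longrightarrow> z (map arr \<epsilon>) (v, rs) = 0"
    and par: "parallel \<epsilon> v rs" and len: "length \<epsilon> = N"
  shows "hoch primitive (map arr \<epsilon>) (v, rs) = z (map arr \<epsilon>) (v, rs)"
proof -
  have ne: "rs \<noteq> []" "\<epsilon> \<noteq> []" "koszul \<epsilon>" "nonzero v rs" using par parallel_nonempty by (auto simp: parallel_def)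
  have h: "hoch primitive (map arr \<epsilon>) (v, rs)
    = (if hd rs = hd \<epsilon> then primitive_coeff (tl \<epsilon>) (t (hd \<epsilon>)) (tl rs) else 0)
      + alternate N (if last rs = last \<epsilon> then primitive_coeff (butlast \<epsilon>) v (butlast rs) else 0)"
    using hoch_koszul[OF normalized_primitive ne(3,2,1,4)] primitive_arr[of "tl \<epsilon>"] primitive_arr[of "butlast \<epsilon>"] N len by simp
  \<comment> \<open>The removed arrow is the only right extension of the stripped pair; the two
    signs will cancel. If the first arrows agree, the default 0 applies.\<close>
  have right: "primitive_coeff (butlast \<epsilon>) v (butlast rs) = (if hd rs = hd \<epsilon> then 0 else alternate N (z (map arr \<epsilon>) (v, rs)))"
    if eq: "last rs = last \<epsilon>"
  proof -
    define b where "b = last \<epsilon>"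
    obtain \<epsilon>' rs' where e: "\<epsilon> = \<epsilon>' @ [b]" "rs = rs' @ [b]" "\<epsilon>' \<noteq> []"
    proof -
      have "\<epsilon> = butlast \<epsilon> @ [b]" "rs = butlast rs @ [b]"
        using ne(1,2) eq b_def by (metis append_butlast_last_id)+
      moreover have "length (butlast \<epsilon>) \<noteq> 0" using N len by simp
      then have "butlast \<epsilon> \<noteq> []" by (metis list.size(3))
      ultimately show thesis by (rule that)
    qed
    note p = parallel_butlast[OF par[unfolded e(1,2)] e(3)]
    have multilinear_ext: "last rs' \<in> Ar" using p(1,2) by (auto simp: parallel_def nonzero_def)
    have x: "ext_right \<epsilon>' rs' b" using p by (simp add: ext_right_def)
    show ?thesis using p x some_ext_right[OF x multilinear_ext] e by (auto simp: primitive_coeff_def)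
  qed
  show ?thesis
  proof (cases "hd rs = hd \<epsilon>")
    case False
    show ?thesis
    proof (cases "last rs = last \<epsilon>")
      case True
      then show ?thesis unfolding h using False right by simp
    next
      case l: False
      then show ?thesis unfolding h using False core[OF par len] by simp
    qed
  next
    case True
    define a where "a = hd \<epsilon>"
    obtain \<epsilon>' rs' where e': "\<epsilon> = a # \<epsilon>'" "rs = a # rs'"
      using ne True unfolding a_def by (cases \<epsilon>; cases rs) auto
    moreover have "\<epsilon>' \<noteq> []" using N len e' by auto
    ultimately have e: "\<epsilon> = a # \<epsilon>'" "rs = a # rs'" "\<epsilon>' \<noteq> []" .
    note p = parallel_tl[OF par[unfolded e(1,2)] e(3)]
    have v: "v = s a" using par e by (simp add: parallel_def)
    have l: "last \<epsilon> = last \<epsilon>'" "last rs = last rs'" using e p by auto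
    have k: "primitive_coeff \<epsilon>' (t a) rs' = z (map arr \<epsilon>) (v, rs)"
    proof (cases "\<exists>b. ext_right \<epsilon>' rs' b")
      case True
      then obtain b where x: "ext_right \<epsilon>' rs' b" by blast
      have multilinear_ext: "last rs' \<in> Ar" using p(1,2) by (auto simp: parallel_def nonzero_def)
      have tl: "t (last \<epsilon>') = t (last rs')" using p(1,2) by (simp add: parallel_def path_target_def)
      have "primitive_coeff \<epsilon>' (t a) rs' = alternate N (z (map arr (\<epsilon>' @ [b])) (t a, rs' @ [b]))"
        using p True some_ext_right[OF x multilinear_ext] by (simp add: primitive_coeff_def)
      \<comment> \<open>The pair prolonged by \<open>b\<close> shares both end arrows, so its
        cocycle equation ties the value of \<open>z\<close> used by the primitive, where
        \<open>a\<close> is dropped and \<open>b\<close> added, to the value with \<open>a\<close>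
        and without \<open>b\<close>.\<close>
      moreover have "hoch z (map arr (\<epsilon> @ [b])) (v, rs @ [b])
          = z (map arr (\<epsilon>' @ [b])) (t a, rs' @ [b]) + alternate (Suc N) (z (map arr \<epsilon>) (v, rs))"
      proof -
        have "koszul (\<epsilon> @ [b])" "nonzero v (rs @ [b])"
          using ne x tl l by (auto simp: koszul_append koszul_Cons nonzero_append nonzero_Cons ext_right_def path_target_def t_V)
        then have "hoch z (map arr (\<epsilon> @ [b])) (v, rs @ [b])
          = (if hd (rs @ [b]) = hd (\<epsilon> @ [b]) then z (map arr (tl (\<epsilon> @ [b]))) (t (hd (\<epsilon> @ [b])), tl (rs @ [b])) else 0)
          + alternate (length (\<epsilon> @ [b])) (if last (rs @ [b]) = last (\<epsilon> @ [b]) then z (map arr (butlast (\<epsilon> @ [b]))) (v, butlast (rs @ [b])) else 0)"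
          by (intro hoch_koszul assms(1)) auto
        then show ?thesis by (simp add: e len[unfolded e, symmetric] del: hoch.simps)
      qed
      moreover have "hoch z (map arr (\<epsilon> @ [b])) = 0"
        using ne x tl l len by (intro cocycle) (auto simp: koszul_append koszul_Cons ext_right_def)
      ultimately show ?thesis by simp
    next
      case False
      have hin: "hd rs' \<in> Ar" using p(1,2) by (auto simp: parallel_def nonzero_def)
      have "s (hd rs') = t a" using p(1,2) by (simp add: parallel_def nonzero_def)
      \<comment> \<open>Without an extension on the right the primitive looks to the left, where
        putting back \<open>a\<close> is the unique extension.\<close>
      then have x: "ext_left \<epsilon>' rs' a" using p par e by (auto simp: ext_left_def parallel_def koszul_Cons nonzero_Cons)
      have "primitive_coeff \<epsilon>' (t a) rs' = z (map arr (a # \<epsilon>')) (s a, a # rs')"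
        using p False x some_ext_left[OF x hin] by (auto simp: primitive_coeff_def)
      then show ?thesis using e v by simp
    qed
    show ?thesis unfolding h using True right k by (simp add: e)
  qed
qed

end

end

section \<open>The cup product on the path monoid\<close>

context mono_quiver begin

definition cup_mon :: "nat \<Rightarrow> (('v, 'a) mon list \<Rightarrow> ('v,'a,'k::field) pelt) \<Rightarrow> (('v, 'a) mon list \<Rightarrow> ('v,'a,'k) pelt)
    \<Rightarrow> ('v, 'a) mon list \<Rightarrow> ('v,'a,'k) pelt" where
  "cup_mon n f g xs = conv (f (take n xs)) (g (drop n xs))"

lemma conv_act: "conv (act y a) z = conv y (lact a z)"
  by (simp add: act_def lact_def conv_assoc)

lemma act_conv: "nf z = z \<Longrightarrow> act (conv y z) a = conv y (act z a)"
  by (simp add: act_def conv_assoc)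

lemma lact_conv: "lact a (conv y z) = conv (lact a y) z"
  by (simp add: lact_def conv_assoc)

lemma conv_diff_left: "conv (x - y) z = conv x z - conv y z"
  using conv_add_left[of "x - y" y z] by (simp add: algebra_simps)

lemma conv_diff_right: "conv z (x - y) = conv z x - conv z y"
  using conv_add_right[of z "x - y" y] by (simp add: algebra_simps)

lemma d_conv: "normalized g \<Longrightarrow> d (\<lambda>zs. conv y (g zs)) xs = conv y (d g xs)"
proof (induction xs arbitrary: g)
  case (Cons a ys)
  have "pr a (\<lambda>zs. conv y (g zs)) ys = conv y (pr a g ys)"
    using Cons.prems by (cases ys) (simp_all add: act_conv normalized_def)
  moreover have "d (\<lambda>zs. conv y (g (a # zs))) ys = conv y (d (\<lambda>zs. g (a # zs)) ys)"
    using Cons.prems by (intro Cons.IH normalized_Cons)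
  ultimately show ?case by (simp only: bar_d.simps conv_diff_right)
qed simp

text \<open>The right-hand side contains two additional terms that cancel by
  \<open>conv_act\<close>: the last face of \<open>f\<close> and the leftmost term of
  \<open>hoch g\<close> both multiply the same middle entry between the two values.\<close>

lemma leibniz:
  assumes "normalized g" "n < length xs"
  shows "d (cup_mon n f g) xs = conv (d f (take (Suc n) xs)) (g (drop (Suc n) xs))
    - alternate n (conv (f (take n xs)) (hoch g (drop n xs)))"
  using assms(2)
proof (induction n arbitrary: f xs)
  case 0
  then obtain x ys where xs: "xs = x # ys" by (cases xs) auto
  have "cup_mon 0 f g = (\<lambda>zs. conv (f []) (g zs))" by (simp add: cup_mon_def fun_eq_iff)
  then have "d (cup_mon 0 f g) xs = conv (f []) (d g xs)" using d_conv[OF assms(1)] by simp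
  moreover have "d f [x] = act (f []) x" by simp
  then have "conv (d f [x]) (g ys) = conv (f []) (lact x (g ys))" by (simp only: conv_act)
  ultimately show ?case using xs
    by (simp only: take_Suc_Cons take_0 drop_0 drop_Suc_Cons hoch.simps alternate_simps conv_diff_right diff_diff_eq2) simp
next
  case (Suc n)
  then obtain a y zs where xs: "xs = a # y # zs" by (cases xs; cases "tl xs") auto
  let ?f = "\<lambda>zs. f (a # zs)" and ?ys = "y # zs"
  have "(\<lambda>zs. cup_mon (Suc n) f g (a # zs)) = cup_mon n ?f g" by (simp add: cup_mon_def fun_eq_iff)
  then have "d (cup_mon (Suc n) f g) xs = pr a (cup_mon (Suc n) f g) ?ys - d (cup_mon n ?f g) ?ys"
    unfolding xs by (simp only: bar_d.simps)
  also have "d (cup_mon n ?f g) ?ys = conv (d ?f (take (Suc n) ?ys)) (g (drop (Suc n) ?ys))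
    - alternate n (conv (?f (take n ?ys)) (hoch g (drop n ?ys)))"
    using Suc xs by (intro Suc.IH) auto
  also have "pr a (cup_mon (Suc n) f g) ?ys = conv (pr a f (take (Suc n) ?ys)) (g (drop (Suc n) ?ys))"
    by (simp add: cup_mon_def)
  finally show ?case
    unfolding xs by (simp only: take_Suc_Cons drop_Suc_Cons bar_d.simps conv_diff_left alternate_simps) (simp add: algebra_simps)
qed

lemma hoch_cup_mon:
  assumes "normalized g" "\<And>zs. length zs \<noteq> n \<Longrightarrow> f zs = 0" "\<And>zs. length zs \<noteq> m \<Longrightarrow> g zs = 0"
    and "\<And>zs. hoch f zs = 0" "\<And>zs. hoch g zs = 0"
  shows "hoch (cup_mon n f g) xs = 0"
proof (cases "length xs = Suc (n + m)")
  case False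
  have "cup_mon n f g zs = 0" if "length zs \<noteq> n + m" for zs
    using assms(2)[of "take n zs"] assms(3)[of "drop n zs"] that unfolding cup_mon_def by fastforce
  then show ?thesis using False by (rule hoch_wrong_length)
next
  case True
  then obtain x ys where xs: "xs = x # ys" by (cases xs) auto
  have n: "n < length xs" using True by simp
  have "hoch (cup_mon n f g) xs = lact x (cup_mon n f g ys) - d (cup_mon n f g) xs" using xs by (simp only: hoch.simps)
  also have "\<dots> = conv (hoch f (x # take n ys)) (g (drop n ys))"
    unfolding leibniz[OF assms(1) n] assms(5)
    by (simp only: xs cup_mon_def lact_conv hoch.simps conv_diff_left take_Suc_Cons drop_Suc_Cons conv_0 alternate_0 diff_zero)
  finally show ?thesis by (simp only: assms(4) conv_0)
qed

section \<open>Closure properties of normalised functions\<close>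

lemma normalized_cup_mon: "normalized f \<Longrightarrow> normalized g \<Longrightarrow> normalized (cup_mon n f g)"
  unfolding normalized_def
proof (intro allI conjI impI)
  fix zs :: "('v, 'a) mon list"
  assume g: "\<forall>zs. nf (f zs) = f zs \<and> (Zero \<in> set zs \<longrightarrow> f zs = 0)"
     "\<forall>zs. nf (g zs) = g zs \<and> (Zero \<in> set zs \<longrightarrow> g zs = 0)"
  show "nf (cup_mon n f g zs) = cup_mon n f g zs" by (simp add: cup_mon_def)
  assume "Zero \<in> set zs"
  then have "Zero \<in> set (take n zs @ drop n zs)" by simp
  then have "Zero \<in> set (take n zs) \<or> Zero \<in> set (drop n zs)" by (simp only: set_append Un_iff)
  then show "cup_mon n f g zs = 0" using g by (auto simp: cup_mon_def)
qed

lemma normalized_bimod_ext: "normalized f \<Longrightarrow> normalized (bimod_ext f)"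
  by (auto simp: normalized_def bimod_ext_def lact_def split: list.split)

lemma nf_add: "nf (x + y) = nf x + nf y" by (auto simp: nf_def fun_eq_iff)
lemma nf_diff: "nf (x - y) = nf x - nf y" by (auto simp: nf_def fun_eq_iff)

lemma act_nf: "act (nf y) a = nf (act y a)" by (simp add: act_def)

lemma d_nf: "d (\<lambda>zs. nf (f zs)) xs = nf (d f xs)"
proof (induction xs arbitrary: f)
  case (Cons a ys)
  have "pr a (\<lambda>zs. nf (f zs)) ys = nf (pr a f ys)" by (cases ys) (simp_all add: act_nf)
  then show ?case by (simp only: bar_d.simps Cons.IH nf_diff)
qed simp

lemma act_Path: "act y (Path w ws) = conv y (emb (Path w ws))"
  and lact_Path: "lact (Path w ws) y = conv (emb (Path w ws)) y"
  by (simp_all only: act_def lact_def mon.distinct if_False)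

text \<open>A product between two fixed paths sees only the coefficients at paths joining them; this
  confines \<open>kproj\<close> to parallel pairs.\<close>

lemma lact_act_cong:
  assumes "\<And>bs. nonzero (path_target v us) bs \<Longrightarrow> path_target (path_target v us) bs = w \<Longrightarrow> y (path_target v us, bs) = y' (path_target v us, bs)"
  shows "act (lact (Path v us) y) (Path w ws) = act (lact (Path v us) y') (Path w ws)"
proof -
  have a: "act y (Path w ws) (path_target v us, cs) = act y' (Path w ws) (path_target v us, cs)" for cs
  proof (cases "\<exists>bs. cs = bs @ ws")
    case True
    then obtain bs where True: "cs = bs @ ws" by blast
    have "nonzero (path_target v us) (bs @ ws) \<Longrightarrow> nonzero (path_target v us) bs" by (simp only: nonzero_append)
    then show ?thesis using assms[of bs] unfolding act_Path True conv_path_right by auto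
  next
    case False
    show ?thesis by (simp only: act_Path conv_path_right_0[OF False])
  qed
  have "lact (Path v us) (act y (Path w ws)) (x, cs) = lact (Path v us) (act y' (Path w ws)) (x, cs)" for x cs
    by (simp only: lact_Path conv_path_left a)
  then show ?thesis unfolding lact_act by (auto simp: fun_eq_iff)
qed

lemma normalized_0: "normalized (\<lambda>_. 0)"
  by (simp add: normalized_def)

lemma normalized_diff: "normalized F \<Longrightarrow> normalized G \<Longrightarrow> normalized (\<lambda>zs. F zs - G zs)"
  by (simp add: normalized_def nf_diff)

lemma normalized_d: "normalized F \<Longrightarrow> normalized (d F)"
  unfolding normalized_def
proof (intro allI conjI impI)
  fix zs :: "('v, 'a) mon list" assume "\<forall>zs. nf (F zs) = F zs \<and> (Zero \<in> set zs \<longrightarrow> F zs = 0)"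
  then have F: "normalized F" by (simp add: normalized_def)
  then show "nf (d F zs) = d F zs" unfolding d_nf[symmetric] by (simp add: normalized_def)
  show "d F zs = 0" if "Zero \<in> set zs" using F that
  proof (induction zs arbitrary: F)
    case (Cons a ys)
    have "pr a F ys = 0"
      using Cons.prems normalized_pre[OF Cons.prems(1), of a] by (cases ys) (auto simp: normalized_def)
    moreover have "d (\<lambda>zs. F (a # zs)) ys = 0"
    proof (cases "a = Zero")
      case True
      have "(\<lambda>zs. F (a # zs)) = (\<lambda>_. 0)" using Cons.prems(1) True by (simp add: normalized_def)
      then show ?thesis by simp
    next
      case False
      then show ?thesis using Cons.prems by (intro Cons.IH normalized_Cons) auto
    qed
    ultimately show ?case by (simp only: bar_d.simps diff_zero)
  qed simp
qed

lemma kproj_from_nf: "nf (kproj_from F c ws xs) = kproj_from F c ws xs"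
  by (induction xs arbitrary: F c ws) (auto simp: act_Path simp del: emb.simps split: mon.split)

lemma kproj_from_Zero: "Zero \<in> set xs \<Longrightarrow> kproj_from F c ws xs = 0"
  by (induction xs arbitrary: F c ws) (auto split: mon.split)

lemma nf_sum: "nf (\<Sum>i\<in>X. f i) = (\<Sum>i\<in>X. nf (f i))"
  using sum_comp_morphism[of nf f X] by (simp add: nf_add o_def)

lemma normalized_kproj: "normalized (kproj F)"
  unfolding normalized_def
proof (intro allI conjI impI)
  fix zs :: "('v, 'a) mon list"
  show "nf (kproj F zs) = kproj F zs"
    by (cases zs) (simp_all add: act_Path nf_sum kproj_from_nf split: mon.split del: emb.simps)
  show "kproj F zs = 0" if "Zero \<in> set zs"
  proof (cases zs)
    case (Cons x xs)
    then show ?thesis using that by (cases x) (auto intro!: sum.neutral kproj_from_Zero)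
  qed (use that in simp)
qed

text \<open>The final primitive contains \<open>H\<close>, and it has to be normalised for the
  differential to commute with its multilinear extension.\<close>

lemma normalized_H: "normalized F \<Longrightarrow> normalized (H n F)"
proof (induction n arbitrary: F)
  case 0
  have "H 0 F = (\<lambda>_. 0)" by (simp add: fun_eq_iff)
  then show ?case by (simp only: normalized_0)
next
  case (Suc n)
  let ?F = "\<lambda>zs. F (One # zs)"
  have F: "normalized ?F" "normalized (\<lambda>zs. F (One # One # zs))" using Suc.prems by (auto intro: normalized_Cons)
  have "normalized (\<lambda>zs. case zs of [] \<Rightarrow> 0 | x # ys \<Rightarrow> H n (pr x ?F) ys)"
    unfolding normalized_def
  proof (intro allI conjI impI)
    fix zs :: "('v, 'a) mon list"
    have g: "normalized (H n (pr x ?F))" for x by (intro Suc.IH normalized_pre F)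
    show "nf (case zs of [] \<Rightarrow> 0 | x # ys \<Rightarrow> H n (pr x ?F) ys) = (case zs of [] \<Rightarrow> 0 | x # ys \<Rightarrow> H n (pr x ?F) ys)"
      using g by (cases zs) (simp_all add: normalized_def)
    assume z: "Zero \<in> set zs"
    show "(case zs of [] \<Rightarrow> 0 | x # ys \<Rightarrow> H n (pr x ?F) ys) = 0"
    proof (cases zs)
      case (Cons x ys)
      show ?thesis
      proof (cases "x = Zero")
        case True
        have "pr x ?F ws = 0" for ws using normalized_Zero[OF F(1)] by (cases ws) (simp_all add: True)
        then have "pr x ?F = (\<lambda>_. 0)" by (rule ext)
        then show ?thesis using Cons by simp
      next
        case False
        then show ?thesis using Cons z g by (simp add: normalized_def)
      qed
    qed (use z in simp)
  qed
  moreover have "normalized (d (H n ?F))" by (intro normalized_d Suc.IH F)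
  ultimately have "normalized (\<lambda>zs. (case zs of [] \<Rightarrow> 0 | x # ys \<Rightarrow> H n (pr x ?F) ys) - d (H n ?F) zs)"
    by (rule normalized_diff)
  then have "normalized (total_d (H n) ?F)" by (simp only: total_d_def[abs_def])
  then have "normalized (\<lambda>xs. kproj ?F xs - F (One # One # xs) - total_d (H n) ?F xs)"
    by (intro normalized_diff normalized_kproj F)
  then show ?case by (simp only: H.simps[abs_def])
qed

end

section \<open>Exactness of cup products over the path monoid\<close>

context string_quiver begin

text \<open>\<open>\<gamma>\<close> accumulates the arrows already split off; with \<open>c\<close>
  it stays a Koszul word. At the end of the list \<open>lact_act_cong\<close> restricts the
  coefficients to parallel paths.\<close>

lemma kproj_from_cong:
  assumes "\<And>\<epsilon> v rs. parallel \<epsilon> v rs \<Longrightarrow> length \<epsilon> = N \<Longrightarrow> F (map arr \<epsilon>) (v, rs) = G (map arr \<epsilon>) (v, rs)"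
    and "koszul (\<gamma> @ [c])" "N = length \<gamma> + Suc (length xs)" "path_target v us = s (hd (\<gamma> @ [c]))"
  shows "kproj_from (\<lambda>zs. lact (Path v us) (F (map arr \<gamma> @ zs))) c ws xs
    = kproj_from (\<lambda>zs. lact (Path v us) (G (map arr \<gamma> @ zs))) c ws xs"
  using assms(2-)
proof (induction xs arbitrary: \<gamma> c ws)
  case Nil
  have "F (map arr (\<gamma> @ [c])) (path_target v us, bs) = G (map arr (\<gamma> @ [c])) (path_target v us, bs)"
    if "nonzero (path_target v us) bs" "path_target (path_target v us) bs = t c" for bs
  proof (rule assms(1))
    show "parallel (\<gamma> @ [c]) (path_target v us) bs"
      unfolding parallel_def using Nil.prems(1,3) that by (simp only: last_snoc) simp
    show "length (\<gamma> @ [c]) = N" using Nil.prems(2) by simp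
  qed
  then have "act (lact (Path v us) (F (map arr (\<gamma> @ [c])))) (Path (t c) ws)
      = act (lact (Path v us) (G (map arr (\<gamma> @ [c])))) (Path (t c) ws)"
    by (rule lact_act_cong)
  then show ?case by (simp only: kproj_from.simps map_append list.map)
next
  case (Cons x xs)
  show ?case
  proof (cases "\<exists>w as. x = Path w as \<and> ws = [] \<and> as \<noteq> [] \<and> nonzero w as \<and> w = t c \<and> \<not> nz c (hd as)")
    case True
    then obtain b bs where x: "x = Path (t c) (b # bs)" and S: "ws = []" "nonzero (t c) (b # bs)" "\<not> nz c b"
      by (metis list.exhaust list.sel(1))
    have "kproj_from (\<lambda>zs. lact (Path v us) (F (map arr (\<gamma> @ [c]) @ zs))) b bs xs
      = kproj_from (\<lambda>zs. lact (Path v us) (G (map arr (\<gamma> @ [c]) @ zs))) b bs xs"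
    proof (rule Cons.IH)
      have "s b = t c" "b \<in> Ar" using S(2) by (simp_all only: nonzero_Cons)
      then show "koszul ((\<gamma> @ [c]) @ [b])" using Cons.prems(1) S(3)
        unfolding koszul_append[of "\<gamma> @ [c]" "[b]"] by (simp add: koszul_Cons)
      show "N = length (\<gamma> @ [c]) + Suc (length xs)" using Cons.prems(2) by simp
      show "path_target v us = s (hd ((\<gamma> @ [c]) @ [b]))" using Cons.prems(3) by (cases \<gamma>) simp_all
    qed
    then show ?thesis using x S by simp
  next
    case False
    then show ?thesis by (cases x) auto
  qed
qed

lemma kproj_cong:
  assumes "\<And>\<epsilon> v rs. parallel \<epsilon> v rs \<Longrightarrow> length \<epsilon> = N \<Longrightarrow> F (map arr \<epsilon>) (v, rs) = G (map arr \<epsilon>) (v, rs)"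
    and "length xs = N" "N \<noteq> 0"
  shows "kproj (bimod_ext F) xs = kproj (bimod_ext G) xs"
proof -
  obtain x ys where xs: "xs = x # ys" using assms by (cases xs) auto
  show ?thesis
  proof (cases "\<exists>v as. x = Path v as \<and> nonzero v as")
    case True
    then obtain v as where x: "x = Path v as" and nonzero: "nonzero v as" by auto
    have "kproj_from (\<lambda>zs. lact (Path v (take i as)) (F (map arr [] @ zs))) (as ! i) (drop (Suc i) as) ys
        = kproj_from (\<lambda>zs. lact (Path v (take i as)) (G (map arr [] @ zs))) (as ! i) (drop (Suc i) as) ys"
      if "i < length as" for i
      using nonzero_split_at[OF nonzero that] assms(2) xs
      by (intro kproj_from_cong[where N = N] assms(1)) (auto simp: koszul_Cons nonzero_Cons)
    then show ?thesis using x nonzero xs by (simp add: bimod_ext_def)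
  next
    case False
    then show ?thesis unfolding xs by (cases x) auto
  qed
qed

lemma cup_core:
  assumes f: "normalized f" "\<And>zs. hoch f zs = 0" and g: "normalized g" "\<And>zs. hoch g zs = 0"
    and n: "n > 0" and m: "m > 0"
    and par: "parallel \<epsilon> v rs" and len: "length \<epsilon> = n + m"
    and hd: "hd rs \<noteq> hd \<epsilon>" and last: "last rs \<noteq> last \<epsilon>"
  shows "cup_mon n f g (map arr \<epsilon>) (v, rs) = 0"
proof -
  define \<gamma> \<delta> where "\<gamma> = take n \<epsilon>" and "\<delta> = drop n \<epsilon>"
  have e: "\<epsilon> = \<gamma> @ \<delta>" by (simp add: \<gamma>_def \<delta>_def)
  have ne: "\<gamma> \<noteq> []" "\<delta> \<noteq> []" using n m len by (auto simp: \<gamma>_def \<delta>_def)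
  have p: "koszul \<gamma>" "koszul \<delta>" "t (List.last \<gamma>) = s (List.hd \<delta>)" "\<not> nz (List.last \<gamma>) (List.hd \<delta>)" "nonzero v rs"
     "v = s (List.hd \<gamma>)" "path_target v rs = t (List.last \<delta>)"
    using par ne unfolding parallel_def e by (auto simp: koszul_append)
  have hl: "List.hd rs \<noteq> List.hd \<gamma>" "List.last rs \<noteq> List.last \<delta>" using hd last ne by (auto simp: e)
  have "f (map arr \<gamma>) (v, take i rs) * g (map arr \<delta>) (path_target v (take i rs), drop i rs) = 0" for i
  proof (rule ccontr)
    define p q w where "p = take i rs" and "q = drop i rs" and "w = path_target v p"
    have rs: "rs = p @ q" by (simp add: p_def q_def)
    assume "f (map arr \<gamma>) (v, take i rs) * g (map arr \<delta>) (path_target v (take i rs), drop i rs) \<noteq> 0"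
    then have nz: "f (map arr \<gamma>) (v, p) \<noteq> 0" "g (map arr \<delta>) (w, q) \<noteq> 0" by (auto simp: p_def q_def w_def)
    \<comment> \<open>If this product vanished, the cocycle equation of \<open>f\<close> at \<gamma>
      followed by \<open>q\<close> would retain only its two outer terms. The right one has a
      nonzero coefficient at \<open>rs\<close>, so the left one would force \<open>rs\<close> to
      begin with the first arrow of \<gamma>.\<close>
    have 1: "mon_mult (arr (List.last \<gamma>)) (Path w q) \<noteq> Zero"
    proof
      assume z: "mon_mult (arr (List.last \<gamma>)) (Path w q) = Zero"
      have "d f (map arr \<gamma> @ [Path w q]) = alternate (length (map arr \<gamma>)) (act (f (map arr \<gamma>)) (Path w q))"
        using z koszul_zero_products[OF p(1)] ne
        by (intro d_zero_products f) (simp add: successively_append_iff last_map del: mon_mult.simps)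
      moreover obtain c \<gamma>' where c: "\<gamma> = c # \<gamma>'" using ne by (cases \<gamma>) auto
      ultimately have "lact (arr c) (f (map arr \<gamma>' @ [Path w q])) = alternate (length (map arr \<gamma>)) (act (f (map arr \<gamma>)) (Path w q))"
        using f(2)[of "map arr \<gamma> @ [Path w q]"] by (simp add: eq_neg_iff_add_eq_0 del: bar_d.simps)
      moreover have "act (f (map arr \<gamma>)) (Path w q) (v, rs) \<noteq> 0"
        using nz p(5) by (simp add: act_def rs conv_path_right w_def[symmetric] del: emb.simps)
      ultimately have "lact (arr c) (f (map arr \<gamma>' @ [Path w q])) (v, rs) \<noteq> 0"
        by (auto simp: alternate_def)
      then show False using hl(1) c by (cases rs) (auto simp: lact_arr lact_arr_Nil split: if_splits)
    qed
    \<comment> \<open>The mirror argument for \<open>g\<close> at \<open>p\<close> followed by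
      \<delta>.\<close>
    have 2: "mon_mult (Path v p) (arr (List.hd \<delta>)) \<noteq> Zero"
    proof
      assume z: "mon_mult (Path v p) (arr (List.hd \<delta>)) = Zero"
      let ?b = "List.last \<delta>"
      have m: "map arr \<delta> = map arr (butlast \<delta>) @ [arr ?b]" using ne by (cases \<delta> rule: rev_cases) auto
      have "d g ((Path v p # map arr (butlast \<delta>)) @ [arr ?b])
        = alternate (length (Path v p # map arr (butlast \<delta>))) (act (g (Path v p # map arr (butlast \<delta>))) (arr ?b))"
      proof (intro d_zero_products g)
        have "successively (\<lambda>x y. mon_mult x y = Zero) (Path v p # map arr \<delta>)"
          using z koszul_zero_products[OF p(2)] ne by (cases \<delta>) (simp_all del: mon_mult.simps)
        then show "successively (\<lambda>x y. mon_mult x y = Zero) ((Path v p # map arr (butlast \<delta>)) @ [arr ?b])"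
          using m by simp
      qed
      then have "lact (Path v p) (g (map arr \<delta>)) = alternate (length (Path v p # map arr (butlast \<delta>))) (act (g (Path v p # map arr (butlast \<delta>))) (arr ?b))"
        using g(2)[of "Path v p # map arr \<delta>"] m by (simp add: eq_neg_iff_add_eq_0 del: bar_d.simps)
      moreover have "lact (Path v p) (g (map arr \<delta>)) (v, rs) \<noteq> 0"
        using nz p(5) by (simp add: lact_def rs conv_path_left w_def[symmetric] del: emb.simps)
      ultimately have "act (g (Path v p # map arr (butlast \<delta>))) (arr ?b) (v, rs) \<noteq> 0"
        by (auto simp: alternate_def split: if_splits)
      then show False using hl(2) by (cases rs rule: rev_cases) (auto simp: act_arr act_arr_Nil split: if_splits)
    qed
    have w1: "w = t (List.last \<gamma>)" and b1: "q \<noteq> [] \<Longrightarrow> nz (List.last \<gamma>) (List.hd q)"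
      using 1 by (auto simp: nonzero_Cons split: if_splits)
    have w2: "w = s (List.hd \<delta>)" and b2: "nonzero v (p @ [List.hd \<delta>])"
      using 2 by (auto simp: w_def split: if_splits)
    \<comment> \<open>An empty \<open>p\<close> would make \<gamma> an oriented cycle, and an empty
      \<open>q\<close> would do the same to \<delta>.\<close>
    have "p \<noteq> []" using koszul_acyclic[OF p(1) ne(1)] w1 p(6) by (auto simp: w_def)
    moreover have "q \<noteq> []"
    proof
      assume "q = []"
      then have "w = path_target v rs" by (simp add: w_def rs)
      then show False using koszul_acyclic[OF p(2) ne(2)] w2 p(7) by simp
    qed
    moreover note b1 b2 p(4,5)
    \<comment> \<open>Both arrows continue the last arrow of \<open>p\<close> to a nonzero path.
      Their equality contradicts the relation between \<gamma> and \<delta>, because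
      \<open>b1\<close> makes the last arrow of \<gamma> compose nontrivially with
      \<open>q\<close>.\<close>
    moreover have "List.hd \<delta> = List.hd q"
    proof (rule unique_right[of "List.last p"])
      show "List.last p \<in> Ar" "List.hd q \<in> Ar" "List.hd \<delta> \<in> Ar" "t (List.last p) = s (List.hd \<delta>)"
         "t (List.last p) = s (List.hd q)" "nz (List.last p) (List.hd \<delta>)" "nz (List.last p) (List.hd q)"
        using \<open>p \<noteq> []\<close> \<open>q \<noteq> []\<close> b2 p(5) unfolding rs
        by (cases q; auto simp: nonzero_def successively_append_iff)+
    qed
    ultimately show False by auto
  qed
  then show ?thesis
    unfolding cup_mon_def conv_def take_map[symmetric] drop_map[symmetric] \<gamma>_def \<delta>_def
    by (auto simp: take_map drop_map intro!: sum.neutral)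
qed

theorem cup_mon_exact:
  fixes f g :: "('v, 'a) mon list \<Rightarrow> ('v,'a,'k::field) pelt"
  assumes f: "normalized f" "\<And>zs. hoch f zs = 0" "\<And>zs. length zs \<noteq> n \<Longrightarrow> f zs = 0"
    and g: "normalized g" "\<And>zs. hoch g zs = 0" "\<And>zs. length zs \<noteq> m \<Longrightarrow> g zs = 0"
    and n: "n > 0" and m: "m > 0"
  shows "\<exists>h. normalized h \<and> (\<forall>xs. length xs = n + m \<longrightarrow> cup_mon n f g xs = hoch h xs)"
proof -
  define z where "z = cup_mon n f g"
  define \<kappa> where "\<kappa> = primitive (n + m) z"
  \<comment> \<open>The first term pulls the Koszul primitive back along the projection; the second
    corrects for the homotopy between the projection and the identity.\<close>
  define h where "h xs = kproj (bimod_ext \<kappa>) xs - H (n + m) (bimod_ext z) xs" for xs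
  have gz: "normalized z" unfolding z_def by (intro normalized_cup_mon f g)
  have hz: "hoch z xs = 0" for xs unfolding z_def by (rule hoch_cup_mon) (fact g f)+
  have "z xs = hoch h xs" if l: "length xs = n + m" for xs
  proof -
    have ne: "xs \<noteq> []" using l n by auto
    have "hoch \<kappa> (map arr \<epsilon>) (v, rs) = z (map arr \<epsilon>) (v, rs)" if "parallel \<epsilon> v rs" "length \<epsilon> = n + m" for \<epsilon> v rs
      unfolding \<kappa>_def
    proof (rule koszul_primitive[OF gz _ _ _ that])
      show "z (map arr \<epsilon>) (v, rs) = 0" if "parallel \<epsilon> v rs" "length \<epsilon> = n + m" "hd rs \<noteq> hd \<epsilon>" "last rs \<noteq> last \<epsilon>" for \<epsilon> v rs
        unfolding z_def by (rule cup_core[OF f(1,2) g(1,2) n m that])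
    qed (use n m hz in auto)
    \<comment> \<open>The primitive was verified at parallel pairs only, and the pull-back sees no
      other coefficients.\<close>
    then have "kproj (bimod_ext z) xs = kproj (bimod_ext (hoch \<kappa>)) xs"
      using l n by (intro kproj_cong[where N = "n + m"]) auto
    also have "\<dots> = hoch (kproj (bimod_ext \<kappa>)) xs"
      using ne by (intro hoch_pullback normalized_bimod_ext) (simp_all add: \<kappa>_def normalized_primitive)
    finally have "kproj (bimod_ext z) xs = hoch (kproj (bimod_ext \<kappa>)) xs" .
    moreover have "z xs = kproj (bimod_ext z) xs - hoch (H (length xs) (bimod_ext z)) xs"
      by (rule cocycle_homotopic[OF normalized_bimod_ext[OF gz] hz ne]) (simp add: lact_def)
    ultimately show ?thesis unfolding h_def hoch_diff l by simp
  qed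
  moreover have "normalized h"
    unfolding h_def by (intro normalized_diff normalized_kproj normalized_H normalized_bimod_ext gz)
  ultimately show ?thesis unfolding z_def by blast
qed

end

section \<open>Multilinear extension to the algebra\<close>

lemma smult_simps [simp]:
  "smult 0 x = 0" "smult c 0 = 0" "smult 1 x = x" "smult (-1) x = - x"
  by (auto simp: smult_def fun_eq_iff)

lemma smult_add_right: "smult c (x + y) = smult c x + smult c y"
  and smult_diff_right: "smult c (x - y) = smult c x - smult c y"
  and smult_add_left: "smult (c + e) x = smult c x + smult e x"
  and smult_smult: "smult c (smult e x) = smult (c * e) x"
  by (auto simp: smult_def fun_eq_iff algebra_simps)

lemma smult_sum_right: "smult c (\<Sum>i\<in>X. f i) = (\<Sum>i\<in>X. smult c (f i))"
  using sum_comp_morphism[of "smult c" f X] by (simp add: smult_add_right o_def)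

lemma smult_sum_left: "smult (\<Sum>i\<in>X. c i) x = (\<Sum>i\<in>X. smult (c i) x)"
  using sum_comp_morphism[of "\<lambda>e. smult e x" c X] by (simp add: smult_add_left o_def)

text \<open>Bridges the recursion to the sum over positions in which \<open>hoch_d\<close> is
  given.\<close>

lemma bar_d_closed_form:
  assumes "length xs = Suc n"
  shows "bar_d mul act F xs
    = (\<Sum>i<n. alternate i (F (take i xs @ [mul (xs ! i) (xs ! Suc i)] @ drop (Suc (Suc i)) xs)))
      + alternate n (act (F (take n xs)) (xs ! n))"
  using assms
proof (induction n arbitrary: F xs)
  case 0
  then obtain a where "xs = [a]" by (cases xs) auto
  then show ?case by simp
next
  case (Suc n)
  then obtain a y zs where xs: "xs = a # y # zs" by (cases xs; cases "tl xs") auto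
  let ?ys = "y # zs"
  have neg: "- (\<Sum>i<n. alternate i (f i)) = (\<Sum>i<n. alternate (Suc i) (f i))" for f :: "nat \<Rightarrow> 'b"
    by (simp add: sum_negf)
  have "bar_d mul act F xs = F (mul a y # zs) - bar_d mul act (\<lambda>zs. F (a # zs)) ?ys" by (simp add: xs)
  also have "bar_d mul act (\<lambda>zs. F (a # zs)) ?ys
    = (\<Sum>i<n. alternate i (F (a # take i ?ys @ [mul (?ys ! i) (?ys ! Suc i)] @ drop (Suc (Suc i)) ?ys)))
      + alternate n (act (F (a # take n ?ys)) (?ys ! n))"
    using Suc.prems xs by (intro Suc.IH) auto
  finally show ?case
    unfolding sum.lessThan_Suc_shift minus_add diff_conv_add_uminus neg
    by (simp add: xs)
qed

locale finite_string_quiver = string_quiver V Ar s t nz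
  for V :: "'v set" and Ar :: "'a set" and s t :: "'a \<Rightarrow> 'v" and nz :: "'a \<Rightarrow> 'a \<Rightarrow> bool" +
  assumes finite_nonzero: "finite {(v, as). nonzero v as}"
begin

definition nonzero_paths :: "('v,'a) path set" where "nonzero_paths = {(v, as). nonzero v as}"

lemma finite_nonzero_paths: "finite nonzero_paths" using finite_nonzero by (simp add: nonzero_paths_def)

definition mon_of_path :: "('v,'a) path \<Rightarrow> ('v,'a) mon" where "mon_of_path p = Path (fst p) (snd p)"

lemma emb_mon_of_path: "p \<in> nonzero_paths \<Longrightarrow> emb (mon_of_path p) = path_elt p"
  by (auto simp: nonzero_paths_def mon_of_path_def nf_def path_elt_def fun_eq_iff)

lemma act_mon_of_path: "p \<in> nonzero_paths \<Longrightarrow> act y (mon_of_path p) = conv y (path_elt p)"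
  and lact_mon_of_path: "p \<in> nonzero_paths \<Longrightarrow> lact (mon_of_path p) y = conv (path_elt p) y"
  using emb_mon_of_path[of p] unfolding mon_of_path_def act_Path lact_Path by simp_all

lemma nf_expand: "nf x = (\<Sum>p\<in>nonzero_paths. smult (x p) (path_elt p))"
proof
  fix r
  have "(\<Sum>p\<in>nonzero_paths. smult (x p) (path_elt p)) r = (\<Sum>p\<in>nonzero_paths. if p = r then x r else 0)"
    unfolding sum_fun_apply by (intro sum.cong) (auto simp: smult_def path_elt_def)
  then show "nf x r = (\<Sum>p\<in>nonzero_paths. smult (x p) (path_elt p)) r"
    using finite_nonzero_paths by (cases r) (auto simp: nf_def nonzero_paths_def)
qed

lemma nf_smult: "nf (smult c x) = smult c (nf x)" by (auto simp: nf_def smult_def fun_eq_iff)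
lemma conv_smult_left: "conv (smult c x) y = smult c (conv x y)"
  and conv_smult_right: "conv x (smult c y) = smult c (conv x y)"
  by (auto simp: conv_def smult_def fun_eq_iff sum_distrib_left mult_ac)
lemma lact_smult: "lact a (smult c x) = smult c (lact a x)"
  by (auto simp: lact_def conv_smult_right)

lemma conv_sum_left: "conv (\<Sum>i\<in>X. e i) y = (\<Sum>i\<in>X. conv (e i) y)"
  using sum_comp_morphism[of "\<lambda>x. conv x y" e X] by (simp add: conv_add_left o_def)

lemma conv_expand_left: "conv x y = (\<Sum>p\<in>nonzero_paths. smult (x p) (lact (mon_of_path p) y))"
proof -
  have "conv x y = conv (nf x) y" by simp
  also have "\<dots> = (\<Sum>p\<in>nonzero_paths. smult (x p) (conv (path_elt p) y))"
    unfolding nf_expand conv_sum_left conv_smult_left ..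
  finally show ?thesis by (simp add: lact_mon_of_path)
qed

lemma conv_expand_right: "conv x y = (\<Sum>p\<in>nonzero_paths. smult (y p) (act x (mon_of_path p)))"
proof -
  have "conv x y = conv x (nf y)" by simp
  also have "\<dots> = (\<Sum>p\<in>nonzero_paths. smult (y p) (conv x (path_elt p)))"
    unfolding nf_expand conv_sum_right conv_smult_right ..
  finally show ?thesis by (simp add: act_mon_of_path)
qed

text \<open>Extension from the basis of nonzero paths. The formal unit \<open>One\<close> is not a
  basis element, so \<open>h\<close> enters through its values at lists of nonzero paths.\<close>

fun multilinear_ext :: "(('v, 'a) mon list \<Rightarrow> ('v,'a,'k::field) pelt) \<Rightarrow> ('v,'a,'k) pelt list \<Rightarrow> ('v,'a,'k) pelt" where
  "multilinear_ext h [] = h []"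
| "multilinear_ext h (x # xs) = (\<Sum>p\<in>nonzero_paths. smult (x p) (multilinear_ext (\<lambda>zs. h (mon_of_path p # zs)) xs))"

lemma multilinear_ext_cong: "(\<And>zs. length zs = length xs \<Longrightarrow> h zs = h' zs) \<Longrightarrow> multilinear_ext h xs = multilinear_ext h' xs"
proof (induction xs arbitrary: h h')
  case (Cons x xs)
  have "multilinear_ext (\<lambda>zs. h (mon_of_path p # zs)) xs = multilinear_ext (\<lambda>zs. h' (mon_of_path p # zs)) xs" for p
    by (rule Cons.IH) (simp add: Cons.prems)
  then show ?case by (simp only: multilinear_ext.simps)
qed simp

lemma multilinear_ext_diff: "multilinear_ext (\<lambda>zs. h zs - h' zs) xs = multilinear_ext h xs - multilinear_ext h' xs"
  by (induction xs arbitrary: h h') (simp_all only: multilinear_ext.simps smult_diff_right sum_subtractf)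

lemma multilinear_ext_lact: "multilinear_ext (\<lambda>zs. lact a (h zs)) xs = lact a (multilinear_ext h xs)"
  by (induction xs arbitrary: h) (simp_all only: multilinear_ext.simps lact_sum lact_smult)

lemma multilinear_ext_conv: "multilinear_ext (\<lambda>zs. conv y (h zs)) xs = conv y (multilinear_ext h xs)"
  by (induction xs arbitrary: h) (simp_all only: multilinear_ext.simps conv_sum_right conv_smult_right)

lemma nf_multilinear_ext: "(\<And>zs. nf (h zs) = h zs) \<Longrightarrow> nf (multilinear_ext h xs) = multilinear_ext h xs"
  by (induction xs arbitrary: h) (simp_all only: multilinear_ext.simps nf_sum nf_smult)

lemma multilinear_ext_cup: "multilinear_ext (cup_mon n f g) xs = conv (multilinear_ext f (take n xs)) (multilinear_ext g (drop n xs))"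
proof (induction n arbitrary: f xs)
  case 0
  have "cup_mon 0 f g = (\<lambda>zs. conv (f []) (g zs))" by (simp add: cup_mon_def fun_eq_iff)
  then show ?case by (simp add: multilinear_ext_conv)
next
  case (Suc n)
  show ?case
  proof (cases xs)
    case Nil
    then show ?thesis by (simp add: cup_mon_def)
  next
    case (Cons x ys)
    have "(\<lambda>zs. cup_mon (Suc n) f g (p # zs)) = cup_mon n (\<lambda>zs. f (p # zs)) g" for p
      by (simp add: cup_mon_def fun_eq_iff)
    then show ?thesis using Cons by (simp add: Suc.IH conv_sum_left conv_smult_left)
  qed
qed

section \<open>The differential on multilinear extensions\<close>

abbreviation "elem_d \<equiv> bar_d conv conv"

lemma elem_d_sum: "elem_d (\<lambda>zs. \<Sum>i\<in>X. smult (c i) (F i zs)) xs = (\<Sum>i\<in>X. smult (c i) (elem_d (F i) xs))"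
proof (induction xs arbitrary: F)
  case (Cons a ys)
  have "pre conv conv a (\<lambda>zs. \<Sum>i\<in>X. smult (c i) (F i zs)) ys = (\<Sum>i\<in>X. smult (c i) (pre conv conv a (F i) ys))"
    by (cases ys) (simp_all add: conv_sum_left conv_smult_left)
  then show ?case by (simp only: bar_d.simps Cons.IH smult_diff_right sum_subtractf)
qed simp

lemma multilinear_ext_Cons_sum:
  "multilinear_ext h ((\<Sum>i\<in>X. smult (c i) (e i)) # zs) = (\<Sum>i\<in>X. smult (c i) (multilinear_ext h (e i # zs)))"
proof -
  let ?X = "\<lambda>p. multilinear_ext (\<lambda>zs. h (mon_of_path p # zs)) zs"
  have "(\<Sum>i\<in>X. smult (c i) (e i)) p = (\<Sum>i\<in>X. c i * e i p)" for p
    unfolding sum_fun_apply by (simp add: smult_def)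
  then have "multilinear_ext h ((\<Sum>i\<in>X. smult (c i) (e i)) # zs) = (\<Sum>p\<in>nonzero_paths. \<Sum>i\<in>X. smult (c i * e i p) (?X p))"
    by (simp only: multilinear_ext.simps smult_sum_left)
  also have "\<dots> = (\<Sum>i\<in>X. \<Sum>p\<in>nonzero_paths. smult (c i * e i p) (?X p))" by (rule sum.swap)
  finally show ?thesis by (simp only: multilinear_ext.simps smult_sum_right smult_smult)
qed

text \<open>\<open>One\<close> is excluded: \<open>emb One\<close> is a sum of vertices, and the
  values of \<open>h\<close> at vertices are unrelated to those at \<open>One\<close>. Products of
  paths are never \<open>One\<close>, so this covers the faces of the differential.\<close>

lemma multilinear_ext_emb:
  assumes "normalized h" "x = Zero \<or> (\<exists>v as. x = Path v as \<and> nonzero v as)"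
  shows "multilinear_ext h (emb x # zs) = multilinear_ext (\<lambda>zs. h (x # zs)) zs"
  using assms(2)
proof
  assume x: "x = Zero"
  have "multilinear_ext h ((\<Sum>i\<in>({}::nat set). smult (c i) (e i)) # zs) = 0" for c e
    unfolding multilinear_ext_Cons_sum by simp
  then have "multilinear_ext h (0 # zs) = 0" by simp
  moreover have "multilinear_ext (\<lambda>_. 0) zs = 0"
    using multilinear_ext_diff[of "\<lambda>_. 0" "\<lambda>_. 0" zs] by simp
  moreover have "(\<lambda>zs. h (x # zs)) = (\<lambda>_. 0)" unfolding x using normalized_Zero[OF assms(1)] by (rule ext)
  ultimately show ?thesis by (simp only: x emb.simps)
next
  assume "\<exists>v as. x = Path v as \<and> nonzero v as"
  then obtain r where r: "r \<in> nonzero_paths" "x = mon_of_path r" by (auto simp: nonzero_paths_def mon_of_path_def)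
  have "multilinear_ext h (path_elt r # zs) = (\<Sum>p\<in>nonzero_paths. if p = r then multilinear_ext (\<lambda>zs. h (mon_of_path r # zs)) zs else 0)"
    unfolding multilinear_ext.simps by (intro sum.cong) (auto simp: path_elt_def)
  then have "multilinear_ext h (path_elt r # zs) = multilinear_ext (\<lambda>zs. h (mon_of_path r # zs)) zs"
    using finite_nonzero_paths r(1) by (simp del: multilinear_ext.simps)
  then show ?thesis by (simp only: r(2) emb_mon_of_path[OF r(1)])
qed

lemma multilinear_ext_mult:
  assumes "normalized h"
  shows "multilinear_ext h (conv a y # zs) = (\<Sum>p\<in>nonzero_paths. smult (a p) (\<Sum>q\<in>nonzero_paths. smult (y q) (multilinear_ext (\<lambda>zs. h (mon_mult (mon_of_path p) (mon_of_path q) # zs)) zs)))"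
proof -
  have y: "lact (mon_of_path p) y = (\<Sum>q\<in>nonzero_paths. smult (y q) (emb (mon_mult (mon_of_path p) (mon_of_path q))))" if p: "p \<in> nonzero_paths" for p
  proof -
    have "lact (mon_of_path p) y = conv (emb (mon_of_path p)) (nf y)" using p by (simp add: lact_mon_of_path emb_mon_of_path)
    also have "\<dots> = (\<Sum>q\<in>nonzero_paths. smult (y q) (conv (emb (mon_of_path p)) (emb (mon_of_path q))))"
      unfolding nf_expand conv_sum_right conv_smult_right by (intro sum.cong) (simp_all add: emb_mon_of_path)
    finally show ?thesis by (simp only: emb_mon_mult)
  qed
  have m: "mon_mult (mon_of_path p) (mon_of_path q) = Zero \<or> (\<exists>v as. mon_mult (mon_of_path p) (mon_of_path q) = Path v as \<and> nonzero v as)" for p q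
    by (simp add: mon_of_path_def)
  have "conv a y = (\<Sum>p\<in>nonzero_paths. smult (a p) (\<Sum>q\<in>nonzero_paths. smult (y q) (emb (mon_mult (mon_of_path p) (mon_of_path q)))))"
    unfolding conv_expand_left[of a] by (intro sum.cong refl) (simp only: y)
  then show ?thesis by (simp only: multilinear_ext_Cons_sum multilinear_ext_emb[OF assms m])
qed

lemma multilinear_ext_pre:
  assumes "normalized h"
  shows "pre conv conv a (multilinear_ext h) ys = (\<Sum>p\<in>nonzero_paths. smult (a p) (multilinear_ext (pr (mon_of_path p) h) ys))"
  using multilinear_ext_mult[OF assms] by (cases ys) (simp_all add: conv_expand_right)

lemma elem_d_multilinear_ext: "normalized h \<Longrightarrow> elem_d (multilinear_ext h) xs = multilinear_ext (d h) xs"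
proof (induction xs arbitrary: h)
  case Nil
  show ?case by (simp only: bar_d.simps multilinear_ext.simps)
next
  case (Cons a ys)
  have "elem_d (\<lambda>zs. multilinear_ext h (a # zs)) ys = (\<Sum>p\<in>nonzero_paths. smult (a p) (multilinear_ext (d (\<lambda>zs. h (mon_of_path p # zs))) ys))"
    by (simp only: multilinear_ext.simps elem_d_sum Cons.IH normalized_Cons Cons.prems)
  then show ?case
    by (simp only: bar_d.simps multilinear_ext_pre[OF Cons.prems] multilinear_ext.simps multilinear_ext_diff smult_diff_right sum_subtractf)
qed

lemma hoch_multilinear_ext:
  assumes "normalized h" "xs \<noteq> []"
  shows "conv (hd xs) (multilinear_ext h (tl xs)) - elem_d (multilinear_ext h) xs = multilinear_ext (hoch h) xs"
proof -
  obtain x ys where xs: "xs = x # ys" using assms by (cases xs) auto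
  have "multilinear_ext (hoch h) xs = (\<Sum>p\<in>nonzero_paths. smult (x p) (multilinear_ext (\<lambda>zs. lact (mon_of_path p) (h zs) - d h (mon_of_path p # zs)) ys))"
    by (simp add: xs)
  also have "\<dots> = conv x (multilinear_ext h ys) - multilinear_ext (d h) xs"
    by (simp only: multilinear_ext_diff multilinear_ext_lact conv_expand_left xs multilinear_ext.simps smult_diff_right sum_subtractf)
  finally show ?thesis unfolding elem_d_multilinear_ext[OF assms(1)] by (simp only: xs list.sel)
qed

text \<open>Linearity is phrased as the basis expansion in each slot; the slots are expanded from
  left to right.\<close>

lemma multilinear_ext_unique:
  assumes "\<And>as x bs. Suc (length as + length bs) = n
     \<Longrightarrow> G (as @ [x] @ bs) = (\<Sum>p\<in>nonzero_paths. smult (x p) (G (as @ [path_elt p] @ bs)))"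
    and "length xs = n"
  shows "G xs = multilinear_ext (\<lambda>zs. G (map emb zs)) xs"
  using assms
proof (induction n arbitrary: G xs)
  case 0
  then have "xs = []" by simp
  then show ?case by simp
next
  case (Suc n)
  from Suc.prems(2) obtain x ys where xs: "xs = x # ys" "length ys = n" by (cases xs) auto
  have "G xs = (\<Sum>p\<in>nonzero_paths. smult (x p) (G (path_elt p # ys)))"
    using Suc.prems(1)[of "[]" ys x] xs by (simp only: append.simps list.size add_0_left)
  also have "\<dots> = (\<Sum>p\<in>nonzero_paths. smult (x p) (multilinear_ext (\<lambda>zs. G (path_elt p # map emb zs)) ys))"
  proof -
    have "G (path_elt p # ys) = multilinear_ext (\<lambda>zs. G (path_elt p # map emb zs)) ys" for p
    proof (rule Suc.IH[of "\<lambda>zs. G (path_elt p # zs)", OF _ xs(2)])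
      fix as bs :: "('v,'a,'b) pelt list" and x
      assume "Suc (length as + length bs) = n"
      then have "Suc (length (path_elt p # as) + length bs) = Suc n" by simp
      then have "G ((path_elt p # as) @ [x] @ bs) = (\<Sum>pa\<in>nonzero_paths. smult (x pa) (G ((path_elt p # as) @ [path_elt pa] @ bs)))"
        by (rule Suc.prems(1))
      then show "G (path_elt p # as @ [x] @ bs) = (\<Sum>pa\<in>nonzero_paths. smult (x pa) (G (path_elt p # as @ [path_elt pa] @ bs)))"
        by (simp only: append_Cons)
    qed
    then show ?thesis by (simp only:)
  qed
  also have "\<dots> = multilinear_ext (\<lambda>zs. G (map emb zs)) xs"
    unfolding xs multilinear_ext.simps by (intro sum.cong refl) (simp only: list.map emb_mon_of_path)
  finally show ?case .
qed

end

section \<open>Cochains of a monomial presentation\<close>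

lemma smult_neg_one_power: "smult ((-1) ^ n) y = alternate n y"
  by (cases "even n") (simp_all add: alternate_def)

lemma chain_iff_successively: "chain s t as \<longleftrightarrow> successively (\<lambda>a b. t a = s b) as"
  by (induction s t as rule: chain.induct) auto

section \<open>Closure of the path algebra under its operations\<close>

lemma path_alg_0: "0 \<in> path_alg V Ar s t"
  by (simp add: path_alg_def supp_def)

lemma path_alg_add: "x \<in> path_alg V Ar s t \<Longrightarrow> y \<in> path_alg V Ar s t \<Longrightarrow> x + y \<in> path_alg V Ar s t"
proof -
  assume "x \<in> path_alg V Ar s t" "y \<in> path_alg V Ar s t"
  moreover have "supp (x + y) \<subseteq> supp x \<union> supp y" by (auto simp: supp_def)
  ultimately show ?thesis unfolding path_alg_def by (auto intro: finite_subset)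
qed

lemma path_alg_smult: "x \<in> path_alg V Ar s t \<Longrightarrow> smult c x \<in> path_alg V Ar s t"
proof -
  assume "x \<in> path_alg V Ar s t"
  moreover have "supp (smult c x) \<subseteq> supp x" by (auto simp: supp_def smult_def)
  ultimately show ?thesis unfolding path_alg_def by (auto intro: finite_subset)
qed

lemma path_alg_minus: "x \<in> path_alg V Ar s t \<Longrightarrow> - x \<in> path_alg V Ar s t"
  using path_alg_smult[of x V Ar s t "-1"] by simp

lemma path_alg_diff: "x \<in> path_alg V Ar s t \<Longrightarrow> y \<in> path_alg V Ar s t \<Longrightarrow> x - y \<in> path_alg V Ar s t"
  using path_alg_add[OF _ path_alg_minus] by (simp only: diff_conv_add_uminus)

lemma path_alg_sum: "(\<And>i. i \<in> X \<Longrightarrow> f i \<in> path_alg V Ar s t) \<Longrightarrow> (\<Sum>i\<in>X. f i) \<in> path_alg V Ar s t"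
  by (induction X rule: infinite_finite_induct) (simp_all only: sum.infinite sum.empty sum.insert path_alg_0 path_alg_add insert_iff simp_thms)

lemma supp_pa_mult: "supp (pa_mult t x y) \<subseteq> {r. \<exists>p\<in>supp x. \<exists>q\<in>supp y. path_concat t p q = Some r}"
proof
  fix r assume "r \<in> supp (pa_mult t x y)"
  then have "{(p, q). p \<in> supp x \<and> q \<in> supp y \<and> path_concat t p q = Some r} \<noteq> {}"
    unfolding supp_def pa_mult_def by (metis (mono_tags, lifting) mem_Collect_eq sum.empty)
  then show "r \<in> {r. \<exists>p\<in>supp x. \<exists>q\<in>supp y. path_concat t p q = Some r}" by auto
qed

lemma finite_supp_pa_mult:
  assumes "finite (supp x)" "finite (supp y)"
  shows "finite (supp (pa_mult t x y))"
proof -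
  have "supp (pa_mult t x y) \<subseteq> (\<lambda>(p, q). the (path_concat t p q)) ` (supp x \<times> supp y)"
    using supp_pa_mult[of t x y] by force
  then show ?thesis using assms by (meson finite_SigmaI finite_imageI finite_subset)
qed

lemma valid_path_concat:
  assumes "valid_path V Ar s t p" "valid_path V Ar s t q" "path_concat t p q = Some r"
  shows "valid_path V Ar s t r"
  using assms
  by (auto simp: valid_path_def path_concat_def path_end_def chain_iff_successively
      successively_append_iff hd_append split: if_splits)

lemma path_alg_mult:
  assumes "x \<in> path_alg V Ar s t" "y \<in> path_alg V Ar s t"
  shows "pa_mult t x y \<in> path_alg V Ar s t"
  using assms supp_pa_mult[of t x y] finite_supp_pa_mult[of x y t] valid_path_concat
  unfolding path_alg_def by blast

text \<open>\<open>mem_I\<close> makes \<open>I\<close> the kernel of \<open>nf\<close> on the path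
  algebra, so congruences modulo \<open>I\<close> become equations between normal forms.\<close>

locale monomial_presentation = finite_string_quiver V Ar s t nz
  for V :: "'v set" and Ar :: "'a set" and s t :: "'a \<Rightarrow> 'v" and nz :: "'a \<Rightarrow> 'a \<Rightarrow> bool" +
  fixes I :: "('v,'a,'k::field) pelt set"
  assumes mem_I: "x \<in> I \<longleftrightarrow> x \<in> path_alg V Ar s t \<and> nf x = 0"
begin

abbreviation "A \<equiv> path_alg V Ar s t"

lemma nonzero_valid: "nonzero v as \<Longrightarrow> valid_path V Ar s t (v, as)"
  using successively_mono[of "\<lambda>a b. t a = s b \<and> nz a b" as "\<lambda>a b. t a = s b"]
  by (auto simp: nonzero_def valid_path_def chain_iff_successively)

lemma nf_in_A: "nf x \<in> A"
proof -
  have "supp (nf x) \<subseteq> nonzero_paths" by (auto simp: supp_def nf_def nonzero_paths_def split: if_splits)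
  then show ?thesis unfolding path_alg_def
    using finite_subset[OF _ finite_nonzero_paths] nonzero_valid by (auto simp: nonzero_paths_def)
qed

lemma path_elt_in_A: "p \<in> nonzero_paths \<Longrightarrow> path_elt p \<in> A"
  using nf_in_A emb_mon_of_path nf_emb by metis

lemma emb_in_A: "emb x \<in> A"
  using nf_in_A nf_emb by metis

lemma nf_pa_mult:
  assumes "x \<in> A" "y \<in> A"
  shows "nf (pa_mult t x y) = conv x y"
proof (rule ext, clarify)
  fix v as
  show "nf (pa_mult t x y) (v, as) = conv x y (v, as)"
  proof (cases "nonzero v as")
    case True
    \<comment> \<open>Factorisations of a path correspond to its cut positions; \<open>T\<close>
      keeps those with both parts in the supports, over which \<open>pa_mult\<close> sums.\<close>
    define e where "e i = ((v, take i as), (path_target v (take i as), drop i as))" for i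
    define T where "T = {i. i \<le> length as \<and> fst (e i) \<in> supp x \<and> snd (e i) \<in> supp y}"
    have pe: "path_end t (w, bs) = path_target w bs" for w bs by (simp add: path_end_def path_target_def)
    have inj: "inj_on e T"
    proof (rule inj_onI)
      fix i j assume "i \<in> T" "j \<in> T" "e i = e j"
      then have "length (take i as) = length (take j as)" "i \<le> length as" "j \<le> length as"
        by (simp_all add: e_def T_def)
      then show "i = j" by simp
    qed
    have "{(p, q). p \<in> supp x \<and> q \<in> supp y \<and> path_concat t p q = Some (v, as)} = e ` T"
    proof (intro equalityI subsetI)
      fix z assume "z \<in> {(p, q). p \<in> supp x \<and> q \<in> supp y \<and> path_concat t p q = Some (v, as)}"
      then obtain w bs u cs where z: "z = ((w, bs), (u, cs))" "(w, bs) \<in> supp x" "(u, cs) \<in> supp y"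
         "path_target w bs = u" "w = v" "as = bs @ cs"
        by (auto simp: path_concat_def pe split: if_splits)
      then have "z = e (length bs)" "length bs \<in> T" by (auto simp: e_def T_def)
      then show "z \<in> e ` T" by blast
    qed (auto simp: e_def T_def path_concat_def pe)
    then have "pa_mult t x y (v, as) = (\<Sum>i\<in>T. x (fst (e i)) * y (snd (e i)))"
      unfolding pa_mult_def by (simp add: sum.reindex[OF inj] case_prod_beta)
    also have "\<dots> = (\<Sum>i\<le>length as. x (fst (e i)) * y (snd (e i)))"
      by (rule sum.mono_neutral_left) (auto simp: T_def supp_def)
    finally show ?thesis using True by (simp add: nf_def conv_def e_def)
  qed (simp add: nf_def conv_def)
qed

text \<open>\<open>G\<close> is \<open>f\<close> read on normal forms. Inner faces are counted from
  1 in \<open>hoch_d\<close> and from 0 in \<open>bar_d\<close>, whence the minus sign.\<close>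

lemma nf_hoch_d:
  assumes len: "length ys = Suc n" and ys: "set ys \<subseteq> A"
    and f: "\<And>zs. length zs = n \<Longrightarrow> set zs \<subseteq> A \<Longrightarrow> f zs \<in> A \<and> nf (f zs) = G zs"
    and G: "\<And>as a bs. G (as @ [nf a] @ bs) = G (as @ [a] @ bs)"
  shows "nf (hoch_d t n f ys) = conv (hd ys) (G (tl ys)) - elem_d G ys"
proof -
  have in_A: "ys ! i \<in> A" if "i \<le> n" for i using that len ys nth_mem[of i ys] by auto
  have tk: "set (take i ys) \<subseteq> A" "set (drop i ys) \<subseteq> A" for i
    using ys set_take_subset[of i ys] set_drop_subset[of i ys] by auto
  have mid: "nf (f (take i ys @ [pa_mult t (ys ! i) (ys ! Suc i)] @ drop (Suc (Suc i)) ys))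
      = G (take i ys @ [conv (ys ! i) (ys ! Suc i)] @ drop (Suc (Suc i)) ys)" if "i < n" for i
  proof -
    have i: "ys ! i \<in> A" "ys ! Suc i \<in> A" using in_A that by auto
    have "nf (f (take i ys @ [pa_mult t (ys ! i) (ys ! Suc i)] @ drop (Suc (Suc i)) ys))
      = G (take i ys @ [pa_mult t (ys ! i) (ys ! Suc i)] @ drop (Suc (Suc i)) ys)"
      using f that len tk path_alg_mult[OF i] by simp
    then show ?thesis unfolding nf_pa_mult[OF i, symmetric] G .
  qed
  have hd: "nf (pa_mult t (ys ! 0) (f (drop 1 ys))) = conv (hd ys) (G (tl ys))"
  proof -
    have d: "length (drop 1 ys) = n" "set (drop 1 ys) \<subseteq> A" using len tk by auto
    have "nf (pa_mult t (ys ! 0) (f (drop 1 ys))) = conv (ys ! 0) (f (drop 1 ys))"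
      using f[OF d] in_A[of 0] by (intro nf_pa_mult) simp_all
    also have "\<dots> = conv (ys ! 0) (nf (f (drop 1 ys)))" by (simp only: conv_nf)
    also have "nf (f (drop 1 ys)) = G (drop 1 ys)" using f[OF d] by (rule conjunct2)
    finally show ?thesis using len by (cases ys) simp_all
  qed
  have lst: "nf (pa_mult t (f (take n ys)) (ys ! n)) = conv (G (take n ys)) (ys ! n)"
  proof -
    have d: "length (take n ys) = n" "set (take n ys) \<subseteq> A" using len tk by auto
    have "nf (pa_mult t (f (take n ys)) (ys ! n)) = conv (f (take n ys)) (ys ! n)"
      using f[OF d] in_A[of n] by (intro nf_pa_mult) simp_all
    also have "\<dots> = conv (nf (f (take n ys))) (ys ! n)" by (simp only: conv_nf)
    also have "nf (f (take n ys)) = G (take n ys)" using f[OF d] by (rule conjunct2)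
    finally show ?thesis .
  qed
  have nsg: "nf (alternate k y) = alternate k (nf y)" for k y
    using nf_smult[of "(-1) ^ k" y] by (simp only: smult_neg_one_power)
  have mids: "(\<Sum>i<n. alternate (Suc i) (nf (f (take i ys @ [pa_mult t (ys ! i) (ys ! Suc i)] @ drop (Suc (Suc i)) ys))))
      = (\<Sum>i<n. alternate (Suc i) (G (take i ys @ [conv (ys ! i) (ys ! Suc i)] @ drop (Suc (Suc i)) ys)))"
    by (intro sum.cong refl) (simp only: mid lessThan_iff)
  have "(\<Sum>i\<in>{1..n}. smult ((-1) ^ i) (f (take (i - 1) ys @ [pa_mult t (ys ! (i - 1)) (ys ! i)] @ drop (i + 1) ys)))
      = (\<Sum>i<n. alternate (Suc i) (f (take i ys @ [pa_mult t (ys ! i) (ys ! Suc i)] @ drop (Suc (Suc i)) ys)))"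
    by (simp add: sum.atLeast1_atMost_eq smult_neg_one_power del: power_Suc)
  then have "nf (hoch_d t n f ys) = conv (hd ys) (G (tl ys))
    + (\<Sum>i<n. alternate (Suc i) (G (take i ys @ [conv (ys ! i) (ys ! Suc i)] @ drop (Suc (Suc i)) ys)))
    + alternate (Suc n) (conv (G (take n ys)) (ys ! n))"
    unfolding hoch_d_def nf_add hd
    by (simp only: nf_sum nsg mids Suc_eq_plus1[symmetric] smult_neg_one_power lst)
  then show ?thesis
    unfolding bar_d_closed_form[OF len] by (simp add: sum_negf)
qed

end

section \<open>Normal forms of Hochschild cochains\<close>

context monomial_presentation begin

abbreviation "hochschild \<equiv> cochain V Ar s t I"

text \<open>A cochain only respects the ideal for arguments in the path algebra; \<open>hat\<close> makes it total and single-valued modulo \<open>I\<close>.\<close>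

definition hat :: "nat \<Rightarrow> (('v,'a,'k) pelt list \<Rightarrow> ('v,'a,'k) pelt) \<Rightarrow> ('v,'a,'k) pelt list \<Rightarrow> ('v,'a,'k) pelt" where
  "hat n f xs = (if length xs = n then nf (f (map nf xs)) else 0)"

definition hat_mon :: "nat \<Rightarrow> (('v,'a,'k) pelt list \<Rightarrow> ('v,'a,'k) pelt) \<Rightarrow> ('v,'a) mon list \<Rightarrow> ('v,'a,'k) pelt" where
  "hat_mon n f zs = hat n f (map emb zs)"

lemma cochainD:
  assumes "hochschild n f" "Suc (length as + length bs) = n" "set as \<subseteq> A" "set bs \<subseteq> A" "x \<in> A" "y \<in> A"
  shows "f (as @ [x + y] @ bs) = f (as @ [x] @ bs) + f (as @ [y] @ bs)"
    and "f (as @ [smult c x] @ bs) = smult c (f (as @ [x] @ bs))"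
    and "x \<in> I \<Longrightarrow> f (as @ [x] @ bs) \<in> I"
  using assms unfolding cochain_def by auto

lemma cochain_in_A: "hochschild n f \<Longrightarrow> length xs = n \<Longrightarrow> set xs \<subseteq> A \<Longrightarrow> f xs \<in> A"
  unfolding cochain_def by blast

lemma cochain_sum:
  assumes "hochschild n f" "Suc (length as + length bs) = n" "set as \<subseteq> A" "set bs \<subseteq> A"
    and "finite X" "\<And>p. p \<in> X \<Longrightarrow> e p \<in> A"
  shows "f (as @ [\<Sum>p\<in>X. smult (c p) (e p)] @ bs) = (\<Sum>p\<in>X. smult (c p) (f (as @ [e p] @ bs)))"
  using assms(5,6)
proof (induction X rule: finite_induct)
  case empty
  have "f (as @ [smult 0 0] @ bs) = smult 0 (f (as @ [0] @ bs))"
    by (rule cochainD(2)[OF assms(1-4) path_alg_0 path_alg_0])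
  then show ?case by (simp only: smult_simps sum.empty)
next
  case (insert q X)
  have "smult (c q) (e q) \<in> A" "(\<Sum>p\<in>X. smult (c p) (e p)) \<in> A"
    using insert.prems by (auto intro!: path_alg_smult path_alg_sum)
  note add = cochainD(1)[OF assms(1-4) this]
  have "f (as @ [smult (c q) (e q)] @ bs) = smult (c q) (f (as @ [e q] @ bs))"
    using insert.prems by (intro cochainD(2)[OF assms(1-4) _ path_alg_0]) simp
  then show ?case using insert.IH insert.prems add by (simp only: sum.insert[OF insert.hyps] insert_iff simp_thms)
qed

text \<open>The difference of \<open>x\<close> and \<open>nf x\<close> lies in \<open>I\<close>, so
  the cochain sends it into \<open>I\<close>.\<close>

lemma cochain_nf_one:
  assumes "hochschild n f" "Suc (length as + length bs) = n" "set as \<subseteq> A" "set bs \<subseteq> A" "x \<in> A"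
  shows "nf (f (as @ [nf x] @ bs)) = nf (f (as @ [x] @ bs))"
proof -
  have d: "x - nf x \<in> A" by (intro path_alg_diff assms nf_in_A)
  have "nf (x - nf x) = 0" by (simp only: nf_diff nf_idem diff_self)
  then have "x - nf x \<in> I" using d mem_I by blast
  then have "f (as @ [x - nf x] @ bs) \<in> I" by (rule cochainD(3)[OF assms(1-4) d d])
  then have 0: "nf (f (as @ [x - nf x] @ bs)) = 0" using mem_I by blast
  have "f (as @ [nf x + (x - nf x)] @ bs) = f (as @ [nf x] @ bs) + f (as @ [x - nf x] @ bs)"
    by (rule cochainD(1)[OF assms(1-4) nf_in_A d])
  moreover have "nf x + (x - nf x) = x" by (simp only: add_diff_eq add_diff_cancel_left')
  ultimately show ?thesis by (simp only: nf_add 0 add_0_right)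
qed

lemma cochain_nf:
  assumes "hochschild n f" "length xs = n" "set xs \<subseteq> A"
  shows "nf (f (map nf xs)) = nf (f xs)"
proof -
  have "nf (f (as @ map nf bs)) = nf (f (as @ bs))"
    if "length as + length bs = n" "set as \<subseteq> A" "set bs \<subseteq> A" for as bs
    using that
  proof (induction bs arbitrary: as)
    case (Cons b bs)
    have "nf (f ((as @ [nf b]) @ map nf bs)) = nf (f ((as @ [nf b]) @ bs))"
      using Cons.prems nf_in_A[of b] by (intro Cons.IH) auto
    also have "\<dots> = nf (f (as @ [nf b] @ bs))" by simp
    also have "\<dots> = nf (f (as @ [b] @ bs))"
      using Cons.prems by (intro cochain_nf_one[OF assms(1)]) auto
    finally show ?case by simp
  qed simp
  from this[of "[]" xs] show ?thesis using assms by simp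
qed

lemma hat_eq: "hochschild n f \<Longrightarrow> length xs = n \<Longrightarrow> set xs \<subseteq> A \<Longrightarrow> hat n f xs = nf (f xs)"
  using cochain_nf by (simp add: hat_def)

lemma hat_nf: "hat n f (as @ [nf a] @ bs) = hat n f (as @ [a] @ bs)"
  by (simp add: hat_def)

lemma nf_hat: "nf (hat n f xs) = hat n f xs"
  by (simp add: hat_def)

lemma hat_multilinear_ext:
  assumes "hochschild n f" "length xs = n"
  shows "hat n f xs = multilinear_ext (hat_mon n f) xs"
proof -
  have "hat n f (as @ [x] @ bs) = (\<Sum>p\<in>nonzero_paths. smult (x p) (hat n f (as @ [path_elt p] @ bs)))"
    if l: "Suc (length as + length bs) = n" for as x bs
  proof -
    have A: "set (map nf zs) \<subseteq> A" for zs using nf_in_A by auto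
    have len: "Suc (length (map nf as) + length (map nf bs)) = n" using l by simp
    have e: "nf (path_elt p) = path_elt p" if "p \<in> nonzero_paths" for p using emb_mon_of_path[OF that] nf_emb by metis
    have "hat n f (as @ [x] @ bs) = nf (f (map nf as @ [\<Sum>p\<in>nonzero_paths. smult (x p) (path_elt p)] @ map nf bs))"
      using l by (simp add: hat_def nf_expand[of x])
    also have "\<dots> = nf (\<Sum>p\<in>nonzero_paths. smult (x p) (f (map nf as @ [path_elt p] @ map nf bs)))"
      by (simp only: cochain_sum[OF assms(1) len A A finite_nonzero_paths path_elt_in_A])
    also have "\<dots> = (\<Sum>p\<in>nonzero_paths. smult (x p) (hat n f (as @ [path_elt p] @ bs)))"
      unfolding nf_sum nf_smult using l by (intro sum.cong refl) (simp add: hat_def e)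
    finally show ?thesis .
  qed
  from multilinear_ext_unique[OF this assms(2)] show ?thesis
    unfolding hat_mon_def[abs_def] .
qed

lemma normalized_hat_mon:
  assumes "hochschild n f"
  shows "normalized (hat_mon n f)"
  unfolding normalized_def
proof (intro allI conjI impI)
  show "nf (hat_mon n f zs) = hat_mon n f zs" for zs by (simp add: hat_mon_def nf_hat)
  fix zs :: "('v, 'a) mon list" assume "Zero \<in> set zs"
  then obtain as bs where zs: "zs = as @ [Zero] @ bs" by (auto simp: in_set_conv_decomp)
  show "hat_mon n f zs = 0"
  proof (cases "length zs = n")
    case True
    have A: "set (map emb ws) \<subseteq> A" for ws :: "('v, 'a) mon list" using emb_in_A by auto
    have "f (map emb as @ [0] @ map emb bs) \<in> I"
    proof (rule cochainD(3)[OF assms _ A A path_alg_0 path_alg_0])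
      show "Suc (length (map emb as) + length (map emb bs)) = n" using True zs by simp
      show "0 \<in> I" using mem_I path_alg_0 nf_0 by blast
    qed
    then have "nf (f (map emb as @ [0] @ map emb bs)) = 0" using mem_I by blast
    moreover have "map nf (map emb zs :: ('v,'a,'k) pelt list) = map emb as @ [0] @ map emb bs" by (simp add: zs)
    ultimately show ?thesis using True by (simp only: hat_mon_def hat_def length_map if_True simp_thms)
  next
    case False
    then show ?thesis by (simp add: hat_mon_def hat_def)
  qed
qed

text \<open>In normal form the cocycle condition modulo \<open>I\<close> is an equation over the
  algebra; \<open>bar_d_map\<close> restricts it to the path monoid.\<close>

lemma hoch_hat_mon:
  assumes "cocycle V Ar s t I n f"
  shows "hoch (hat_mon n f) zs = 0"
proof (cases "length zs = Suc n")
  case False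
  have "hat_mon n f ws = 0" if "length ws \<noteq> n" for ws using that by (simp add: hat_mon_def hat_def)
  then show ?thesis using False by (rule hoch_wrong_length)
next
  case True
  have c: "hochschild n f" using assms by (simp add: cocycle_def)
  obtain x xs where zs: "zs = x # xs" using True by (cases zs) auto
  let ?ys = "map emb zs :: ('v,'a,'k) pelt list"
  have ys: "length ?ys = Suc n" "set ?ys \<subseteq> A" using True emb_in_A by auto
  have "hoch_d t n f ?ys \<in> I" using assms ys unfolding cocycle_def by simp
  then have "nf (hoch_d t n f ?ys) = 0" using mem_I by blast
  moreover have "nf (hoch_d t n f ?ys) = conv (hd ?ys) (hat n f (tl ?ys)) - elem_d (hat n f) ?ys"
    using ys by (intro nf_hoch_d hat_nf) (auto simp: hat_eq[OF c] cochain_in_A[OF c])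
  moreover have "conv (hd ?ys) (hat n f (tl ?ys)) = lact x (hat_mon n f xs)"
    by (simp add: zs lact_def hat_mon_def nf_hat)
  moreover have "elem_d (hat n f) ?ys = d (hat_mon n f) zs"
    unfolding hat_mon_def[abs_def]
    by (rule bar_d_map[symmetric]) (simp_all add: emb_mon_mult act_def nf_hat)
  ultimately show ?thesis by (simp only: zs hoch.simps)
qed

lemma multilinear_ext_append_linear:
  "multilinear_ext h (as @ [x + y] @ bs) = multilinear_ext h (as @ [x] @ bs) + multilinear_ext h (as @ [y] @ bs)"
  "multilinear_ext h (as @ [smult c x] @ bs) = smult c (multilinear_ext h (as @ [x] @ bs))"
  "multilinear_ext h (as @ [nf x] @ bs) = multilinear_ext h (as @ [x] @ bs)"
proof -
  show "multilinear_ext h (as @ [x + y] @ bs) = multilinear_ext h (as @ [x] @ bs) + multilinear_ext h (as @ [y] @ bs)"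
    by (induction as arbitrary: h)
      (simp_all only: append.simps multilinear_ext.simps plus_fun_apply smult_add_left smult_add_right sum.distrib)
  show "multilinear_ext h (as @ [smult c x] @ bs) = smult c (multilinear_ext h (as @ [x] @ bs))"
  proof (induction as arbitrary: h)
    case Nil
    have "smult c x p = c * x p" for p by (simp add: smult_def)
    then show ?case by (simp only: append.simps multilinear_ext.simps smult_sum_right smult_smult)
  next
    case (Cons a as)
    then show ?case by (simp only: append.simps multilinear_ext.simps smult_sum_right smult_smult mult.commute)
  qed
  show "multilinear_ext h (as @ [nf x] @ bs) = multilinear_ext h (as @ [x] @ bs)"
  proof (induction as arbitrary: h)
    case Nil
    have "nf x p = x p" if "p \<in> nonzero_paths" for p using that by (auto simp: nf_def nonzero_paths_def)
    then show ?case by (simp only: append.simps multilinear_ext.simps cong: sum.cong)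
  next
    case (Cons a as)
    then show ?case by (simp only: append.simps multilinear_ext.simps)
  qed
qed

lemma hoch_d_in_A:
  assumes "length ys = Suc n" "set ys \<subseteq> A" "\<And>zs. length zs = n \<Longrightarrow> set zs \<subseteq> A \<Longrightarrow> f zs \<in> A"
  shows "hoch_d t n f ys \<in> A"
proof -
  have in_A: "ys ! i \<in> A" if "i \<le> n" for i using that assms nth_mem[of i ys] by auto
  have tk: "set (take i ys) \<subseteq> A" "set (drop i ys) \<subseteq> A" for i
    using assms set_take_subset[of i ys] set_drop_subset[of i ys] by auto
  show ?thesis unfolding hoch_d_def
    using assms tk in_A
    by (intro path_alg_add path_alg_sum path_alg_smult path_alg_mult assms(3)) (auto intro!: path_alg_mult)
qed

lemma nf_fixed_in_A: "nf y = y \<Longrightarrow> y \<in> A"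
  using nf_in_A by metis

lemma cochain_multilinear_ext:
  assumes "normalized h"
  shows "hochschild n (multilinear_ext h)"
proof -
  have nl: "nf (multilinear_ext h xs) = multilinear_ext h xs" for xs using assms by (intro nf_multilinear_ext) (simp add: normalized_def)
  have "multilinear_ext h (as @ [x] @ bs) \<in> I" if "x \<in> I" for as x bs
  proof -
    have x: "nf x = 0" using that mem_I by blast
    have "multilinear_ext h (as @ [x] @ bs) = multilinear_ext h (as @ [nf x] @ bs)" by (rule multilinear_ext_append_linear(3)[symmetric])
    also have "\<dots> = multilinear_ext h (as @ [smult 0 0] @ bs)" by (simp only: x smult_simps)
    also have "\<dots> = smult 0 (multilinear_ext h (as @ [0] @ bs))" by (rule multilinear_ext_append_linear(2))
    also have "\<dots> = 0" by (rule smult_simps)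
    finally show ?thesis using mem_I path_alg_0 nf_0 by metis
  qed
  then show ?thesis unfolding cochain_def
    using nl nf_fixed_in_A multilinear_ext_append_linear(1,2) by metis
qed

theorem cup_coboundary:
  assumes n: "n > 0" and m: "m > 0"
    and f: "cocycle V Ar s t I n f" and g: "cocycle V Ar s t I m g"
  shows "coboundary V Ar s t I (n + m) (cup t n f g)"
proof -
  have cf: "hochschild n f" and cg: "hochschild m g" using f g by (simp_all add: cocycle_def)
  obtain h where h: "normalized h"
    and eq: "\<And>zs. length zs = n + m \<Longrightarrow> cup_mon n (hat_mon n f) (hat_mon m g) zs = hoch h zs"
  proof -
    have "hat_mon k u zs = 0" if "length zs \<noteq> k" for k u zs using that by (simp add: hat_mon_def hat_def)
    then show thesis
      using cup_mon_exact[of "hat_mon n f" n "hat_mon m g" m] that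
        normalized_hat_mon[OF cf] normalized_hat_mon[OF cg] hoch_hat_mon[OF f] hoch_hat_mon[OF g] n m by blast
  qed
  have "cup t n f g xs - hoch_d t (n + m - 1) (multilinear_ext h) xs \<in> I" if l: "length xs = n + m" and xs: "set xs \<subseteq> A" for xs
  proof -
    let ?N = "n + m - 1"
    have lN: "length xs = Suc ?N" using l n by simp
    have tk: "set (take n xs) \<subseteq> A" "set (drop n xs) \<subseteq> A"
      using xs set_take_subset[of n xs] set_drop_subset[of n xs] by auto
    have len: "length (take n xs) = n" "length (drop n xs) = m" using l by auto
    have cl: "hochschild ?N (multilinear_ext h)" by (rule cochain_multilinear_ext[OF h])
    have nl: "nf (multilinear_ext h zs) = multilinear_ext h zs" for zs using h by (intro nf_multilinear_ext) (simp add: normalized_def)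
    have fA: "f (take n xs) \<in> A" and gA: "g (drop n xs) \<in> A"
      using cochain_in_A[OF cf len(1) tk(1)] cochain_in_A[OF cg len(2) tk(2)] by auto
    have "nf (cup t n f g xs) = conv (f (take n xs)) (g (drop n xs))"
      unfolding cup_def by (rule nf_pa_mult[OF fA gA])
    also have "\<dots> = conv (nf (f (take n xs))) (nf (g (drop n xs)))" by (simp only: conv_nf)
    \<comment> \<open>A cochain in normal form is the multilinear extension of its values on the
      path monoid, and there the cup product has the primitive \<open>h\<close>.\<close>
    also have "\<dots> = multilinear_ext (cup_mon n (hat_mon n f) (hat_mon m g)) xs"
      unfolding multilinear_ext_cup hat_multilinear_ext[OF cf len(1), symmetric] hat_multilinear_ext[OF cg len(2), symmetric]
        hat_eq[OF cf len(1) tk(1)] hat_eq[OF cg len(2) tk(2)] ..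
    also have "\<dots> = multilinear_ext (hoch h) xs" by (rule multilinear_ext_cong) (simp add: eq l)
    also have "\<dots> = conv (hd xs) (multilinear_ext h (tl xs)) - elem_d (multilinear_ext h) xs"
      using lN by (intro hoch_multilinear_ext[OF h, symmetric]) auto
    also have "\<dots> = nf (hoch_d t ?N (multilinear_ext h) xs)"
      by (rule nf_hoch_d[OF lN xs, symmetric]) (simp_all only: nl nf_fixed_in_A multilinear_ext_append_linear(3) simp_thms)
    finally have "nf (cup t n f g xs - hoch_d t ?N (multilinear_ext h) xs) = 0" by (simp only: nf_diff diff_self)
    moreover have "cup t n f g xs \<in> A" unfolding cup_def by (rule path_alg_mult[OF fA gA])
    moreover have "hoch_d t ?N (multilinear_ext h) xs \<in> A"
      by (rule hoch_d_in_A[OF lN xs]) (rule cochain_in_A[OF cl])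
    ultimately show ?thesis using mem_I path_alg_diff by blast
  qed
  then show ?thesis unfolding coboundary_def using cochain_multilinear_ext[OF h] by blast
qed

end

section \<open>Presentations of quadratic string algebras\<close>

lemma supp_path_elt: "supp (path_elt p :: ('v,'a,'k::field) pelt) = {p}"
  by (auto simp: supp_def path_elt_def)

lemma pa_mult_path_elt:
  assumes "path_concat t p q = Some r"
  shows "pa_mult t (path_elt p) (path_elt q) = (path_elt r :: ('v,'a,'k::field) pelt)"
proof
  fix u
  have "{(p', q'). p' \<in> {p} \<and> q' \<in> {q} \<and> path_concat t p' q' = Some u} = (if u = r then {(p, q)} else {})"
    using assms by auto
  then show "pa_mult t (path_elt p) (path_elt q) u = (path_elt r :: ('v,'a,'k) pelt) u"
    unfolding pa_mult_def supp_path_elt by (simp add: path_elt_def)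
qed

lemma path_elt_in_path_alg: "valid_path V Ar s t p \<Longrightarrow> path_elt p \<in> path_alg V Ar s t"
  by (simp add: path_alg_def supp_path_elt)

text \<open>Such ideals bound \<open>ideal_gen\<close> from above: a support condition on generators
  passes to the whole ideal once it is stable under concatenation.\<close>

lemma two_sided_ideal_supported:
  assumes "\<And>p q r. p \<in> Q \<Longrightarrow> valid_path V Ar s t q \<Longrightarrow> path_concat t p q = Some r \<Longrightarrow> r \<in> Q"
    and "\<And>p q r. p \<in> Q \<Longrightarrow> valid_path V Ar s t q \<Longrightarrow> path_concat t q p = Some r \<Longrightarrow> r \<in> Q"
  shows "two_sided_ideal V Ar s t {x \<in> path_alg V Ar s t. supp x \<subseteq> Q}"
proof -
  have "supp (x + y) \<subseteq> supp x \<union> supp y" "supp (smult c x) \<subseteq> supp x" for c and x y :: "('a,'b,'c) pelt"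
    by (auto simp: supp_def smult_def)
  moreover have "supp (pa_mult t x a) \<subseteq> Q" "supp (pa_mult t a x) \<subseteq> Q"
    if "supp x \<subseteq> Q" "a \<in> path_alg V Ar s t" for x a :: "('a,'b,'c) pelt"
    using that supp_pa_mult[of t x a] supp_pa_mult[of t a x] assms unfolding path_alg_def by blast+
  moreover have "supp (0 :: ('a,'b,'c) pelt) = {}" by (simp add: supp_def)
  ultimately show ?thesis
    unfolding two_sided_ideal_def
    by (auto intro: path_alg_0 path_alg_add path_alg_smult path_alg_mult) blast+
qed

lemma ideal_sum:
  assumes "two_sided_ideal V Ar s t I" "\<And>i. i \<in> X \<Longrightarrow> f i \<in> I"
  shows "(\<Sum>i\<in>X. f i) \<in> I"
  using assms(2)
proof (induction X rule: infinite_finite_induct)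
  case (insert x F)
  then have "f x \<in> I" "sum f F \<in> I" by auto
  then have "f x + sum f F \<in> I" using assms(1) unfolding two_sided_ideal_def by blast
  then show ?case by (simp only: sum.insert[OF insert.hyps])
qed (use assms(1) in \<open>simp_all add: two_sided_ideal_def\<close>)

lemma ideal_of_paths:
  assumes I: "two_sided_ideal V Ar s t I" and x: "x \<in> path_alg V Ar s t"
    and p: "\<And>p. p \<in> supp x \<Longrightarrow> path_elt p \<in> I"
  shows "x \<in> I"
proof -
  have fin: "finite (supp x)" using x by (simp add: path_alg_def)
  have "x = (\<Sum>p\<in>supp x. smult (x p) (path_elt p))"
  proof
    fix r
    have "(\<Sum>p\<in>supp x. smult (x p) (path_elt p)) r = (\<Sum>p\<in>supp x. if p = r then x r else 0)"
      unfolding sum_fun_apply by (intro sum.cong) (auto simp: smult_def path_elt_def)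
    then show "x r = (\<Sum>p\<in>supp x. smult (x p) (path_elt p)) r"
      using fin by (simp add: supp_def)
  qed
  also have "\<dots> \<in> I"
    using I p by (intro ideal_sum[OF I]) (simp add: two_sided_ideal_def)
  finally show ?thesis .
qed

lemma ideal_gen_least: "two_sided_ideal V Ar s t J \<Longrightarrow> S \<subseteq> J \<Longrightarrow> ideal_gen V Ar s t S \<subseteq> J"
  by (auto simp: ideal_gen_def)

lemma ideal_gen_generators: "S \<subseteq> ideal_gen V Ar s t S"
  by (auto simp: ideal_gen_def)

theorem theorem3p1:
  fixes V :: "'v set" and Ar :: "'a set" and s t :: "'a \<Rightarrow> 'v"
    and I :: "('v,'a,'k::field) pelt set"
  assumes "quiver V Ar s t"
    and "admissible V Ar s t I"
    and "triangular V Ar s t"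
    and "quadratic V Ar s t I"
    and "string_algebra V Ar s t I"
    and "n > 0" and "m > 0"
    and "cocycle V Ar s t I n f" and "cocycle V Ar s t I m g"
  shows "coboundary V Ar s t I (n + m) (cup t n f g)"
proof -
  \<comment> \<open>Composability of the two arrows is not part of \<open>nz\<close>; the notions
    built on it ask for it separately.\<close>
  define nz where "nz a b \<longleftrightarrow> (path_elt (s a, [a, b]) :: ('v,'a,'k) pelt) \<notin> I" for a b
  have I: "two_sided_ideal V Ar s t I" using assms(2) by (simp add: admissible_def)
  interpret mono_quiver V Ar s t nz
    using assms(1) by unfold_locales (auto simp: quiver_def)
  have valid: "valid_path V Ar s t (v, as) \<longleftrightarrow> v \<in> V \<and> set as \<subseteq> Ar \<and> successively (\<lambda>a b. t a = s b) as \<and> (as \<noteq> [] \<longrightarrow> s (hd as) = v)" for v as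
    by (auto simp: valid_path_def chain_iff_successively)
  have cat: "path_concat t (v, as) (w, bs) = (if path_target v as = w then Some (v, as @ bs) else None)" for v as w bs
    by (simp add: path_concat_def path_end_def path_target_def)

  \<comment> \<open>A valid path that is not \<open>nonzero\<close> contains two consecutive arrows
    whose product lies in \<open>I\<close>; the other arrows are multiplied on.\<close>
  have not_nonzero: "path_elt (v, as) \<in> I" if val: "valid_path V Ar s t (v, as)" and nB: "\<not> nonzero v as" for v as
    using val nB
  proof (induction as arbitrary: v)
    case Nil
    then show ?case by (simp add: valid)
  next
    case (Cons a as)
    have v: "v = s a" "a \<in> Ar" using Cons.prems(1) by (simp_all add: valid)
    have val_tl: "valid_path V Ar s t (t a, as)"
      using Cons.prems(1) s_V t_V by (cases as) (auto simp: valid)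
    have val_a: "valid_path V Ar s t (v, [a])" using v s_V by (simp add: valid)
    show ?case
    proof (cases "nonzero (t a) as")
      case False
      then have "path_elt (t a, as) \<in> I" by (rule Cons.IH[OF val_tl])
      then have "pa_mult t (path_elt (v, [a])) (path_elt (t a, as)) \<in> I"
        using I path_elt_in_path_alg[OF val_a] unfolding two_sided_ideal_def by blast
      moreover have "path_concat t (v, [a]) (t a, as) = Some (v, a # as)" by (simp add: cat)
      ultimately show ?thesis by (simp only: pa_mult_path_elt)
    next
      case True
      then obtain b bs where as: "as = b # bs" and nnz: "\<not> nz a b"
        using Cons.prems(2) v by (cases as) (auto simp: nonzero_Cons)
      have "path_elt (v, [a, b]) \<in> I" using nnz v by (simp add: nz_def)
      moreover have "valid_path V Ar s t (t b, bs)"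
        using val_tl s_V t_V unfolding as by (cases bs) (auto simp: valid)
      ultimately have "pa_mult t (path_elt (v, [a, b])) (path_elt (t b, bs)) \<in> I"
        using I path_elt_in_path_alg unfolding two_sided_ideal_def by blast
      moreover have "path_concat t (v, [a, b]) (t b, bs) = Some (v, a # as)" by (simp add: cat as)
      ultimately show ?thesis by (simp only: pa_mult_path_elt)
    qed
  qed

  obtain Ps where Ps: "Ps \<subseteq> {p. valid_path V Ar s t p}" "I = ideal_gen V Ar s t (path_elt ` Ps)"
    using assms(5) unfolding string_algebra_def by blast
  \<comment> \<open>The elements supported on paths that lie in \<open>I\<close> form an ideal
    containing the monomial generators, hence all of \<open>I\<close>.\<close>
  have monomial: "path_elt p \<in> I" if "x \<in> I" "p \<in> supp x" for x p
  proof -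
    let ?Q = "{p. valid_path V Ar s t p \<and> path_elt p \<in> I}"
    have "two_sided_ideal V Ar s t {x \<in> path_alg V Ar s t. supp x \<subseteq> ?Q}"
    proof (rule two_sided_ideal_supported)
      fix p q r
      assume p: "p \<in> ?Q" and q: "valid_path V Ar s t q"
      have pq: "pa_mult t (path_elt p) (path_elt q) \<in> I" "pa_mult t (path_elt q) (path_elt p) \<in> I"
        using I p path_elt_in_path_alg[OF q] unfolding two_sided_ideal_def by blast+
      show "r \<in> ?Q" if c: "path_concat t p q = Some r"
        using p q pq(1) valid_path_concat[OF _ q c] unfolding pa_mult_path_elt[OF c] by blast
      show "r \<in> ?Q" if c: "path_concat t q p = Some r"
        using p q pq(2) valid_path_concat[OF q _ c] unfolding pa_mult_path_elt[OF c] by blast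
    qed
    moreover have "path_elt ` Ps \<subseteq> {x \<in> path_alg V Ar s t. supp x \<subseteq> ?Q}"
      using Ps ideal_gen_generators[of "path_elt ` Ps" V Ar s t] path_elt_in_path_alg[of V Ar s t]
      by (auto simp: supp_path_elt)
    ultimately have "I \<subseteq> {x \<in> path_alg V Ar s t. supp x \<subseteq> ?Q}"
      unfolding Ps(2) using Ps(2) by (intro ideal_gen_least) simp_all
    then show ?thesis using that by blast
  qed

  obtain S where S: "S \<subseteq> path_alg V Ar s t" "\<forall>x\<in>S. \<forall>p. length (snd p) \<noteq> 2 \<longrightarrow> x p = 0" "I = ideal_gen V Ar s t S"
    using assms(4) unfolding quadratic_def by blast
  let ?N = "{p. valid_path V Ar s t p \<and> \<not> nonzero (fst p) (snd p)}"
  \<comment> \<open>The quadratic generators may be sums of paths. By \<open>monomial\<close> each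
    path in their supports lies in \<open>I\<close> and is thus a relation of length 2, which
    reconciles the two generating sets of \<open>I\<close>.\<close>
  have supp_I: "I \<subseteq> {x \<in> path_alg V Ar s t. supp x \<subseteq> ?N}"
    unfolding S(3)
  proof (rule ideal_gen_least)
    show "two_sided_ideal V Ar s t {x \<in> path_alg V Ar s t. supp x \<subseteq> ?N}"
    proof (rule two_sided_ideal_supported)
      fix p q r
      assume p: "p \<in> ?N" and q: "valid_path V Ar s t q"
      obtain v as w bs where e: "p = (v, as)" "q = (w, bs)" by (metis surj_pair)
      show "r \<in> ?N" if c: "path_concat t p q = Some r"
      proof -
        have "r = (v, as @ bs)" using c by (simp add: e cat split: if_splits)
        then show ?thesis using p valid_path_concat[OF _ q c] by (simp add: e nonzero_append)
      qed
      show "r \<in> ?N" if c: "path_concat t q p = Some r"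
      proof -
        have "r = (w, bs @ as)" "path_target w bs = v" using c by (simp_all add: e cat split: if_splits)
        then show ?thesis using p valid_path_concat[OF q _ c] by (simp add: e nonzero_append)
      qed
    qed
    show "S \<subseteq> {x \<in> path_alg V Ar s t. supp x \<subseteq> ?N}"
    proof
      fix x assume x: "x \<in> S"
      have xA: "x \<in> path_alg V Ar s t" using S x by blast
      have "p \<in> ?N" if p: "p \<in> supp x" for p
      proof -
        obtain v as where e: "p = (v, as)" by (cases p)
        have val: "valid_path V Ar s t (v, as)" using xA p by (auto simp: path_alg_def e)
        have "length as = 2" using S(2) x p by (force simp: supp_def e)
        then obtain a b where as: "as = [a, b]" by (auto simp: length_Suc_conv numeral_2_eq_2)
        have "x \<in> I" using x ideal_gen_generators unfolding S(3) by blast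
        then have "path_elt (v, as) \<in> I" using p unfolding e by (rule monomial)
        then have "\<not> nz a b" using val by (simp add: nz_def as valid)
        then show ?thesis using val by (simp add: e as nonzero_Cons)
      qed
      then show "x \<in> {x \<in> path_alg V Ar s t. supp x \<subseteq> ?N}" using xA by blast
    qed
  qed

  have mem: "x \<in> I \<longleftrightarrow> x \<in> path_alg V Ar s t \<and> nf x = 0" for x
  proof
    assume "x \<in> I"
    then have x: "x \<in> path_alg V Ar s t" "supp x \<subseteq> ?N" using supp_I by auto
    then have "nf x (v, as) = 0" for v as by (auto simp: nf_def supp_def)
    then show "x \<in> path_alg V Ar s t \<and> nf x = 0" using x by (auto simp: fun_eq_iff)
  next
    assume x: "x \<in> path_alg V Ar s t \<and> nf x = 0"
    show "x \<in> I"
    proof (rule ideal_of_paths[OF I])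
      fix p assume p: "p \<in> supp x"
      obtain v as where e: "p = (v, as)" by (cases p)
      have "nf x (v, as) = 0" using x by simp
      then have "\<not> nonzero v as" using p by (auto simp: e nf_def supp_def)
      then show "path_elt p \<in> I" using p x not_nonzero by (auto simp: e path_alg_def)
    qed (use x in simp)
  qed

  \<comment> \<open>Admissibility puts all long paths into \<open>I\<close>, so nonzero paths have
    bounded length.\<close>
  have fin: "finite {(v, as). nonzero v as}"
  proof -
    obtain k where k: "\<forall>x\<in>path_alg V Ar s t. (\<forall>p. length (snd p) < k \<longrightarrow> x p = 0) \<longrightarrow> x \<in> I"
      using assms(2) unfolding admissible_def by blast
    have lk: "length as < k" if b: "nonzero v as" for v as
    proof (rule ccontr)
      assume l: "\<not> length as < k"
      have val: "valid_path V Ar s t (v, as)"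
        using b successively_mono[of "\<lambda>a b. t a = s b \<and> nz a b" as "\<lambda>a b. t a = s b"] by (auto simp: nonzero_def valid)
      have "path_elt (v, as) \<in> I"
        using k path_elt_in_path_alg[OF val] l by (auto simp: path_elt_def)
      then have "(v, as) \<in> ?N" using supp_I supp_path_elt by blast
      then show False using b by simp
    qed
    have "(v, as) \<in> V \<times> {as. set as \<subseteq> Ar \<and> length as \<le> k}" if "nonzero v as" for v as
      using lk[OF that] that by (simp add: nonzero_def)
    then have "{(v, as). nonzero v as} \<subseteq> V \<times> {as. set as \<subseteq> Ar \<and> length as \<le> k}" by blast
    moreover have "finite Ar" using assms(1) by (simp add: quiver_def)
    then have "finite (V \<times> {as. set as \<subseteq> Ar \<and> length as \<le> k})"
      by (intro finite_cartesian_product finite_V finite_lists_length_le)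
    ultimately show ?thesis by (rule finite_subset)
  qed

  have finA: "finite Ar" using assms(1) by (simp add: quiver_def)
  interpret monomial_presentation V Ar s t nz I
  proof unfold_locales
    show "t (last as) \<noteq> s (hd as)" if "set as \<subseteq> Ar" "as \<noteq> []" "successively (\<lambda>a b. t a = s b) as" for as
    proof -
      have "hd as \<in> Ar" using that by (auto dest: hd_in_set)
      then have "valid_path V Ar s t (s (hd as), as)" using that s_V by (simp add: valid)
      then show ?thesis using assms(3) that(2) by (fastforce simp: triangular_def path_end_def)
    qed
    show "b = c" if "a \<in> Ar" "b \<in> Ar" "c \<in> Ar" "t a = s b" "t a = s c" "nz a b" "nz a c" for a b c
    proof -
      have "card {b \<in> Ar. t a = s b \<and> path_elt (s a, [a, b]) \<notin> I} \<le> Suc 0"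
        using assms(5) that(1) by (simp add: string_algebra_def)
      then show ?thesis using that finA by (subst (asm) card_le_Suc0_iff_eq) (auto simp: nz_def)
    qed
    show "b = c" if "a \<in> Ar" "b \<in> Ar" "c \<in> Ar" "t b = s a" "t c = s a" "nz b a" "nz c a" for a b c
    proof -
      have "card {c \<in> Ar. t c = s a \<and> path_elt (s c, [c, a]) \<notin> I} \<le> Suc 0"
        using assms(5) that(1) by (simp add: string_algebra_def)
      then show ?thesis using that finA by (subst (asm) card_le_Suc0_iff_eq) (auto simp: nz_def)
    qed
  qed (fact fin mem)+
  show ?thesis by (rule cup_coboundary) (fact assms)+
qed

end
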